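(* Let $\operatorname{Re}a>0$, $\nu\ge-\tfrac12$, and $z\in\mathbb{C}\setminus(-\infty,0]$. Then $$\int_0^\infty \frac{J_\nu(bz)}{\sqrt{b^2+4a^2}}\,db=I_{\nu/2}(az)\,K_{\nu/2}(az).$$
   Context: $J_\nu$ is the Bessel function of the first kind, and $I_\nu$ and $K_\nu$ are the modified Bessel functions of the first and second kind, of order $\nu$.
   Formalization: For nonreal z the integral diverges (e.g. z = i, a = 1, ν = 0, where the integrand I_0(b)/√(b²+4) grows without bound), so the identity is asserted only where the integral exists; convergence and the identity are asserted for all z > 0. *)

theory Defs
  imports "HOL-Analysis.Analysis"
begin

text \<open>
  Bessel functions of complex order and argument, given by their standard power series on
  the principal branch (cut along the nonpositive reals). The factor \<open>rGamma\<close> is the entire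
  function \<open>1 / Gamma\<close>, so all orders are covered, including negative integers. Because
  \<open>0 powr \<nu> = 0\<close>, the value at argument \<open>0\<close> is not the conventional one for
  \<open>\<nu> = 0\<close>.
\<close>

definition Bessel_J :: "complex \<Rightarrow> complex \<Rightarrow> complex" where
  "Bessel_J \<nu> z =
     (z / 2) powr \<nu> * (\<Sum>k. (- 1) ^ k * rGamma (\<nu> + of_nat k + 1) / fact k * (z / 2) ^ (2 * k))"

definition Bessel_I :: "complex \<Rightarrow> complex \<Rightarrow> complex" where
  "Bessel_I \<nu> z =
     (z / 2) powr \<nu> * (\<Sum>k. rGamma (\<nu> + of_nat k + 1) / fact k * (z / 2) ^ (2 * k))"

text \<open>At integer order the quotient is \<open>0 / 0\<close>, and the function is its limit in the order.\<close>

definition Bessel_K :: "complex \<Rightarrow> complex \<Rightarrow> complex" where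
  "Bessel_K \<nu> z =
     (let q = (\<lambda>\<mu>. of_real pi / 2 * (Bessel_I (- \<mu>) z - Bessel_I \<mu> z) / sin (of_real pi * \<mu>))
      in if \<nu> \<in> \<int> then Lim (at \<nu>) q else q \<nu>)"

text \<open>
  For \<open>b \<ge> 0\<close> and \<open>Re a > 0\<close> the number \<open>b\<^sup>2 + 4 * a\<^sup>2\<close> never lies on the
  branch cut of \<open>csqrt\<close>.
\<close>

definition Bessel_integrand :: "complex \<Rightarrow> real \<Rightarrow> complex \<Rightarrow> real \<Rightarrow> complex" where
  "Bessel_integrand a \<nu> z b =
     Bessel_J (of_real \<nu>) (of_real b * z) / csqrt ((of_real b)\<^sup>2 + 4 * a\<^sup>2)"

text \<open>
  \<open>Bessel_J \<nu> (b * z)\<close> grows like \<open>exp (b * \<bar>Im z\<bar>) / sqrt b\<close>, so the integral of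
  \<open>Bessel_integrand a \<nu> z\<close> over \<open>{0<..}\<close> diverges for nonreal \<open>z\<close>. An identity for this
  integral over the whole cut plane can therefore only be asserted where the integral exists;
  its existence for positive real \<open>z\<close> has to be asserted separately. The Henstock-Kurzweil
  integral also covers conditionally convergent improper integrals.
\<close>

end

theory Submission
  imports Defs "HOL-Complex_Analysis.Complex_Analysis"
begin

text \<open>
  For real \<open>z > 0\<close> scaling reduces the claim to \<open>z = 1\<close>. The Bessel equation and integration by
  parts show that the integral \<open>G(\<alpha>)\<close> satisfies
  \<open>\<theta>(\<theta>\<^sup>2 - \<nu>\<^sup>2)G = 4\<alpha>\<^sup>2(\<theta> + 1)G\<close> with \<open>\<theta> = \<alpha> d/d\<alpha>\<close>. This is the symmetric square of the
  modified Bessel equation of order \<open>\<mu> = \<nu>/2\<close>, so \<open>G\<close> is a combination of \<open>I\<^bsub>\<mu>\<^esub>\<^sup>2\<close>,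
  \<open>I\<^bsub>\<mu>\<^esub> I\<^bsub>-\<mu>\<^esub>\<close> and \<open>I\<^bsub>-\<mu>\<^esub>\<^sup>2\<close>. For \<open>0 < \<nu> < 1\<close> the three coefficients are read off from
  \<open>G(\<alpha>) = 1/\<nu> + c \<alpha>\<^sup>\<nu> + o(\<alpha>\<^sup>\<nu>)\<close> at the origin; all other orders follow by analytic
  continuation in \<open>\<nu>\<close>.

  For nonreal \<open>z\<close> the integral does not exist: a bounded primitive of the integrand would continue the
  Laplace transform of \<open>J\<^bsub>\<nu>\<^esub>(bz)\<close> analytically to \<open>Re s > 0\<close>, but its expansion in powers of
  \<open>1/s\<^sup>2\<close> blows up at whichever of \<open>\<plusminus>\<i>z\<close> lies in that half-plane.
\<close>

subsection \<open>Integration on the positive half-line\<close>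

text \<open>Continuation in \<nu> forces every estimate of the Bessel function to be uniform over
  discs of complex orders: the integral must be holomorphic on Re \<nu> > -1 before an identity on 0
  < \<nu> < 1 can spread. No uniqueness theory for the third-order equation is invoked. Its
  invariant bilinear form pairs G with the three products of solutions, giving three constants, and
  the nonzero Wronskian solves these linear relations for G. The term 1/\<nu> is Weber's integral of
  J(b)/b, the formal value at \<alpha> = 0; the constant c is a Beta integral. Legendre's
  duplication formula makes the coefficient of I_\<mu>^2 the negative of that of I_\<mu> I_(-\<mu>),
  and this is how K appears. For 0 < \<nu> < 1 the functions I_\<mu> and I_(-\<mu>) are independent,
  and \<alpha>^\<nu> dominates the \<alpha>^2 corrections of I_\<mu> I_(-\<mu>), so the coefficients
  can be separated. For nonreal z, growth alone does not contradict Henstock-Kurzweil integrability,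
  since oscillation may compensate. The contradiction comes from positivity instead: along a
  suitable ray all terms of the expansion are positive, so its partial sums would be bounded by a
  value of the continuation.\<close>

lemma absolutely_integrable_continuous_bounded:
  fixes f :: "real \<Rightarrow> complex"
  assumes "continuous_on {0<..} f" "g integrable_on {0<..}" "\<And>x. x > 0 \<Longrightarrow> norm (f x) \<le> g x"
  shows "f absolutely_integrable_on {0<..}"
proof (rule measurable_bounded_by_integrable_imp_absolutely_integrable)
  show "f \<in> borel_measurable (lebesgue_on {0<..})"
    using assms(1) by (rule continuous_imp_measurable_on_sets_lebesgue) auto
qed (use assms in auto)

text \<open>Exhaustion by the intervals from 1/(n+1) to n+1; absolute integrability supplies the
  majorant for dominated convergence. The later integrations by parts over the half-line are
  instances in which both boundary limits are 0.\<close>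

lemma integral_FTC_positive_reals:
  fixes f :: "real \<Rightarrow> complex"
  assumes der: "\<And>x. x > 0 \<Longrightarrow> (f has_vector_derivative f' x) (at x)"
    and int: "f' absolutely_integrable_on {0<..}"
    and lim0: "(f \<longlongrightarrow> A) (at_right 0)" and liminf: "(f \<longlongrightarrow> B) at_top"
  shows "integral {0<..} f' = B - A"
proof -
  define a b :: "nat \<Rightarrow> real" where "a n = 1 / real (n + 1)" and "b n = real (n + 1)" for n
  have ab: "a n > 0" "a n \<le> b n" for n
    by (auto simp: a_def b_def field_simps)
  have FTC: "(f' has_integral (f (b n) - f (a n))) {a n..b n}" for n
    by (rule fundamental_theorem_of_calculus)
       (use ab[of n] in \<open>auto intro!: has_vector_derivative_at_within[OF der]\<close>)
  define F where "F n x = (if x \<in> {a n..b n} then f' x else 0)" for n x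
  have sub: "{a n..b n} \<inter> {0<..} = {a n..b n}" for n
    using ab(1)[of n] by force
  have F: "(F n has_integral (f (b n) - f (a n))) {0<..}" for n
    unfolding F_def has_integral_restrict_Int sub by (rule FTC)
  have "(\<lambda>n. integral {0<..} (F n)) \<longlonglongrightarrow> integral {0<..} f'"
  proof (rule dominated_convergence)
    show "(\<lambda>x. norm (f' x)) integrable_on {0<..}"
      using int absolutely_integrable_on_def by blast
    show "(\<lambda>n. F n x) \<longlonglongrightarrow> f' x" if "x \<in> {0<..}" for x
    proof (rule tendsto_eventually)
      have x: "x > 0" using that by simp
      have l: "a \<longlonglongrightarrow> 0" unfolding a_def
        using LIMSEQ_inverse_real_of_nat by (simp add: inverse_eq_divide)
      have e1: "\<forall>\<^sub>F n in sequentially. a n < x"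
        using order_tendstoD(2)[OF l x] .
      have e2: "\<forall>\<^sub>F n in sequentially. x \<le> b n"
        unfolding b_def using eventually_ge_at_top[of "nat \<lceil>x\<rceil>"]
        by eventually_elim linarith
      show "\<forall>\<^sub>F n in sequentially. F n x = f' x"
        using e1 e2 by eventually_elim (auto simp: F_def)
    qed
  qed (use F in \<open>auto simp: F_def\<close>)
  moreover have "integral {0<..} (F n) = f (b n) - f (a n)" for n
    using F by (rule integral_unique)
  moreover have "(\<lambda>n. f (b n) - f (a n)) \<longlonglongrightarrow> B - A"
  proof (intro tendsto_diff)
    have "filterlim b at_top sequentially" unfolding b_def
      by (intro filterlim_compose[OF filterlim_real_sequentially] filterlim_add_const_nat_at_top)
    then show "(\<lambda>n. f (b n)) \<longlonglongrightarrow> B"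
      by (rule filterlim_compose[OF liminf])
    have "filterlim a (at_right 0) sequentially"
      unfolding filterlim_at a_def using LIMSEQ_inverse_real_of_nat by (auto simp: inverse_eq_divide)
    then show "(\<lambda>n. f (a n)) \<longlonglongrightarrow> A"
      by (rule filterlim_compose[OF lim0])
  qed
  ultimately show ?thesis
    using LIMSEQ_unique by simp
qed

text \<open>Only \<open>f\<close> needs a majorant. Cauchy's inequality on discs of radius
  \<open>r / 4\<close> bounds \<open>f'\<close> by \<open>4 / r * g\<close>, and the resulting
  Lipschitz bound dominates the difference quotients. This pays off for the derivative in the order
  \<nu>, which is never estimated directly.\<close>

lemma has_field_derivative_integral_dominated:
  fixes f f' :: "complex \<Rightarrow> real \<Rightarrow> complex"
  assumes r: "r > 0"
    and der: "\<And>w b. w \<in> ball w0 r \<Longrightarrow> b > 0 \<Longrightarrow> ((\<lambda>w. f w b) has_field_derivative f' w b) (at w)"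
    and cont: "\<And>w. w \<in> ball w0 r \<Longrightarrow> continuous_on {0<..} (f w)"
    and g: "g integrable_on {0<..}"
    and bound: "\<And>w b. w \<in> ball w0 r \<Longrightarrow> b > 0 \<Longrightarrow> norm (f w b) \<le> g b"
  shows "((\<lambda>w. integral {0<..} (f w)) has_field_derivative integral {0<..} (f' w0)) (at w0)"
proof -
  have int: "f w absolutely_integrable_on {0<..}" if "w \<in> ball w0 r" for w
    using cont[OF that] g bound[OF that] by (rule absolutely_integrable_continuous_bounded)
  have der_bound: "norm (f' w b) \<le> 4 / r * g b" if w: "w \<in> ball w0 (r / 2)" and b: "b > 0" for w b
  proof -
    have sub: "cball w (r / 4) \<subseteq> ball w0 r"
    proof
      fix x assume "x \<in> cball w (r / 4)"
      then show "x \<in> ball w0 r"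
        using w r dist_triangle[of w0 x w] by auto
    qed
    have hol: "(\<lambda>w. f w b) holomorphic_on cball w (r / 4)"
      unfolding holomorphic_on_def field_differentiable_def
      using der b sub by (blast intro: has_field_derivative_at_within)
    have "norm ((deriv ^^ 1) (\<lambda>w. f w b) w) \<le> fact 1 * g b / (r / 4) ^ 1"
    proof (rule Cauchy_inequality)
      show "(\<lambda>w. f w b) holomorphic_on ball w (r / 4)"
        using hol holomorphic_on_subset ball_subset_cball by blast
      show "continuous_on (cball w (r / 4)) (\<lambda>w. f w b)"
        using hol holomorphic_on_imp_continuous_on by blast
      show "norm (f x b) \<le> g b" if "norm (w - x) = r / 4" for x
        by (rule bound) (use sub that b in \<open>auto simp: dist_norm subset_iff\<close>)
    qed (use r in auto)
    moreover have "deriv (\<lambda>w. f w b) w = f' w b"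
      by (rule DERIV_imp_deriv, rule der) (use sub r b w in auto)
    ultimately show ?thesis by (simp add: mult.commute)
  qed
  have lip: "norm (f w b - f w0 b) \<le> 4 / r * g b * norm (w - w0)" if "w \<in> ball w0 (r / 2)" "b > 0" for w b
  proof (rule field_differentiable_bound[of "ball w0 (r / 2)"])
    show "((\<lambda>w. f w b) has_field_derivative f' z b) (at z within ball w0 (r / 2))"
      if "z \<in> ball w0 (r / 2)" for z
      by (rule has_field_derivative_at_within, rule der) (use that \<open>b > 0\<close> r in auto)
  qed (use der_bound that r in auto)
  show ?thesis
    unfolding has_field_derivative_iff tendsto_at_iff_sequentially comp_def
  proof safe
    fix X :: "nat \<Rightarrow> complex"
    assume X: "\<forall>i. X i \<in> UNIV - {w0}" and lim: "X \<longlonglongrightarrow> w0"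
    have "\<forall>\<^sub>F n in sequentially. X n \<in> ball w0 (r / 2)"
      using lim r by (metis centre_in_ball half_gt_zero open_ball topological_tendstoD)
    then obtain N where N: "\<And>n. n \<ge> N \<Longrightarrow> X n \<in> ball w0 (r / 2)"
      by (auto simp: eventually_at_top_linorder)
    \<comment> \<open>Dominated convergence wants the bound at every index, so only the tail inside
      the smaller ball is used; the shift is undone at the end.\<close>
    define Y where "Y n = X (n + N)" for n
    have Y: "Y n \<in> ball w0 (r / 2)" "Y n \<noteq> w0" for n
      using N X by (auto simp: Y_def)
    then have Y': "Y n \<in> ball w0 r" for n
      using Y(1)[of n] r unfolding mem_ball by linarith
    have limY: "Y \<longlonglongrightarrow> w0"
      unfolding Y_def using lim by (rule LIMSEQ_ignore_initial_segment)
    have "(\<lambda>n. integral {0<..} (\<lambda>b. (f (Y n) b - f w0 b) / (Y n - w0))) \<longlonglongrightarrow> integral {0<..} (f' w0)"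
    proof (rule dominated_convergence)
      show "(\<lambda>b. (f (Y n) b - f w0 b) / (Y n - w0)) integrable_on {0<..}" for n
        using int[OF Y'[of n]] int[of w0] r
        by (intro integrable_on_divide integrable_diff set_lebesgue_integral_eq_integral(1)) auto
      show "(\<lambda>b. 4 / r * g b) integrable_on {0<..}"
        using g by (rule integrable_on_mult_right)
      show "norm ((f (Y n) b - f w0 b) / (Y n - w0)) \<le> 4 / r * g b" if "b \<in> {0<..}" for n b
        using lip[OF Y(1)[of n], of b] that Y(2)[of n] by (simp add: norm_divide divide_le_eq)
      show "(\<lambda>n. (f (Y n) b - f w0 b) / (Y n - w0)) \<longlonglongrightarrow> f' w0 b" if "b \<in> {0<..}" for b
      proof -
        have "((\<lambda>w. (f w b - f w0 b) / (w - w0)) \<longlongrightarrow> f' w0 b) (at w0)"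
          using der[of w0 b] that r by (simp add: has_field_derivative_iff)
        then show ?thesis
          by (rule filterlim_compose) (use limY Y(2) in \<open>auto simp: filterlim_at\<close>)
      qed
    qed
    moreover have "integral {0<..} (\<lambda>b. (f (Y n) b - f w0 b) / (Y n - w0)) =
        (integral {0<..} (f (Y n)) - integral {0<..} (f w0)) / (Y n - w0)" for n
      using int[OF Y'[of n]] int[of w0] r
      by (simp add: integral_diff set_lebesgue_integral_eq_integral(1))
    ultimately have "(\<lambda>n. (integral {0<..} (f (Y n)) - integral {0<..} (f w0)) / (Y n - w0))
        \<longlonglongrightarrow> integral {0<..} (f' w0)"
      by (simp only:)
    then show "(\<lambda>n. (integral {0<..} (f (X n)) - integral {0<..} (f w0)) / (X n - w0))
        \<longlonglongrightarrow> integral {0<..} (f' w0)"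
      unfolding Y_def by (rule LIMSEQ_offset[where k = N])
  qed
qed

lemma has_integral_scale_positive_reals:
  fixes f :: "real \<Rightarrow> complex"
  assumes "f absolutely_integrable_on {0<..}" "c > 0"
  shows "(\<lambda>x. f (c * x)) absolutely_integrable_on {0<..}"
    and "integral {0<..} (\<lambda>x. f (c * x)) = integral {0<..} f / of_real c"
proof -
  have im: "(\<lambda>x. c * x) ` {0<..} = {0<..}"
  proof (intro subset_antisym subsetI)
    fix y :: real assume "y \<in> {0<..}"
    then show "y \<in> (\<lambda>x. c * x) ` {0<..}"
      using assms(2) by (intro image_eqI[of _ _ "y / c"]) auto
  qed (use assms(2) in auto)
  have "(\<lambda>x. \<bar>c\<bar> *\<^sub>R f (c * x)) absolutely_integrable_on {0<..} \<and>
      integral {0<..} (\<lambda>x. \<bar>c\<bar> *\<^sub>R f (c * x)) = integral {0<..} f"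
    using assms
    by (subst has_absolute_integral_change_of_variables_real)
       (auto intro!: derivative_eq_intros simp: inj_on_def im)
  then have 1: "(\<lambda>x. c *\<^sub>R f (c * x)) absolutely_integrable_on {0<..}"
    and 2: "integral {0<..} (\<lambda>x. c *\<^sub>R f (c * x)) = integral {0<..} f"
    using assms(2) by auto
  have "(\<lambda>x. (1 / c) *\<^sub>R (c *\<^sub>R f (c * x))) absolutely_integrable_on {0<..}"
    using 1 by (rule absolutely_integrable_scaleR_left)
  then show "(\<lambda>x. f (c * x)) absolutely_integrable_on {0<..}"
    using assms(2) by simp
  show "integral {0<..} (\<lambda>x. f (c * x)) = integral {0<..} f / of_real c"
    using 2 assms(2) by (simp add: scaleR_conv_of_real field_simps)
qed

subsection \<open>The entire function underlying the Bessel functions\<close>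

text \<open>Compactness handles the finitely many \<open>k\<close> up to R. Beyond that |\<nu> + k +
  1| is at least 1, and rGamma(w) = w rGamma(w + 1) shows that raising \<open>k\<close> cannot
  increase the modulus.\<close>

lemma rGamma_shift_bounded:
  obtains M where "M > 0" "\<And>\<nu> k. norm (\<nu> :: complex) \<le> R \<Longrightarrow> norm (rGamma (\<nu> + of_nat k + 1)) \<le> M"
proof -
  have "\<exists>m. \<forall>\<nu> \<in> cball 0 R. norm (rGamma (\<nu> + of_nat k + 1 :: complex)) \<le> m" for k
  proof -
    have "compact ((\<lambda>\<nu>. rGamma (\<nu> + of_nat k + 1)) ` cball (0 :: complex) R)"
      by (intro compact_continuous_image compact_cball)
         (auto intro!: continuous_intros holomorphic_on_imp_continuous_on holomorphic_intros)
    then have "bounded ((\<lambda>\<nu>. rGamma (\<nu> + of_nat k + 1)) ` cball (0 :: complex) R)"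
      by (rule compact_imp_bounded)
    then show ?thesis unfolding bounded_iff by blast
  qed
  then obtain m where m: "\<And>k \<nu>. \<nu> \<in> cball 0 R \<Longrightarrow> norm (rGamma (\<nu> + of_nat k + 1 :: complex)) \<le> m k"
    by metis
  define N where "N = nat \<lceil>R\<rceil>"
  define M where "M = (\<Sum>k\<le>N. \<bar>m k\<bar>) + 1"
  have "M > 0" unfolding M_def by (simp add: add_nonneg_pos sum_nonneg)
  moreover have "norm (rGamma (\<nu> + of_nat k + 1)) \<le> M" if \<nu>: "norm \<nu> \<le> R" for \<nu> :: complex and k
  proof (induction k)
    case 0
    have "norm (rGamma (\<nu> + of_nat 0 + 1)) \<le> \<bar>m 0\<bar>"
      using m[of \<nu> 0] \<nu> by auto
    also have "\<dots> \<le> (\<Sum>k\<le>N. \<bar>m k\<bar>)"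
      by (rule member_le_sum) auto
    finally show ?case unfolding M_def by simp
  next
    case (Suc k)
    show ?case
    proof (cases "Suc k \<le> N")
      case True
      have "norm (rGamma (\<nu> + of_nat (Suc k) + 1)) \<le> \<bar>m (Suc k)\<bar>"
        using m[of \<nu> "Suc k"] \<nu> by auto
      also have "\<dots> \<le> (\<Sum>k\<le>N. \<bar>m k\<bar>)"
        by (rule member_le_sum) (use True in auto)
      finally show ?thesis unfolding M_def by simp
    next
      case False
      have "R \<le> real k" using False unfolding N_def by linarith
      moreover have "real k + 1 \<le> norm (\<nu> + of_nat k + 1) + norm \<nu>"
        using norm_triangle_ineq4[of "\<nu> + of_nat k + 1" \<nu>]
        by (simp add: algebra_simps) (metis norm_of_nat of_nat_Suc)
      ultimately have "1 \<le> norm (\<nu> + of_nat k + 1)" using \<nu> by linarith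
      then have "norm (rGamma (\<nu> + of_nat (Suc k) + 1)) \<le>
          norm (\<nu> + of_nat k + 1) * norm (rGamma (\<nu> + of_nat k + 1 + 1))"
        using mult_right_mono[of 1 "norm (\<nu> + of_nat k + 1)" "norm (rGamma (\<nu> + of_nat k + 1 + 1))"]
        by (simp add: add_ac)
      also have "\<dots> = norm (rGamma (\<nu> + of_nat k + 1))"
        by (metis norm_mult rGamma_plus1)
      finally show ?thesis using Suc by simp
    qed
  qed
  ultimately show ?thesis using that by blast
qed

text \<open>The regularised hypergeometric function 0F1(; \<nu> + 1; w). It is entire in both
  variables, so branch questions are confined to the factor
  \<open>(z / 2) powr \<nu>\<close>.\<close>

definition bessel_E :: "complex \<Rightarrow> complex \<Rightarrow> complex" where
  "bessel_E \<nu> w = (\<Sum>k. rGamma (\<nu> + of_nat k + 1) / fact k * w ^ k)"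

lemma bessel_E_term_bound:
  obtains M where "M > 0" "\<And>\<nu> k w. norm \<nu> \<le> R \<Longrightarrow>
    norm (rGamma (\<nu> + of_nat k + 1) / fact k * w ^ k :: complex) \<le> M * (norm w ^ k / fact k)"
proof -
  obtain M where M: "M > 0" "\<And>\<nu> k. norm (\<nu> :: complex) \<le> R \<Longrightarrow> norm (rGamma (\<nu> + of_nat k + 1)) \<le> M"
    using rGamma_shift_bounded by blast
  have "norm (rGamma (\<nu> + of_nat k + 1) / fact k * w ^ k) \<le> M * (norm w ^ k / fact k)"
    if "norm \<nu> \<le> R" for \<nu> w :: complex and k
    using mult_right_mono[OF M(2)[OF that, of k], of "norm w ^ k / fact k"]
    by (simp add: norm_mult norm_divide norm_power)
  with M(1) show ?thesis using that by blast
qed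

lemma exp_series_scaled: "(\<lambda>k. M * (x ^ k / fact k)) sums (M * exp (x :: real))"
proof -
  have "(\<lambda>k. x ^ k / fact k) sums exp x"
    using exp_converges[of x] by (simp add: divide_inverse mult.commute)
  then show ?thesis by (rule sums_mult)
qed

lemma Suc_divide_fact_Suc: "of_nat (Suc k) * x / fact (Suc k) = (x / fact k :: complex)"
  by (simp add: fact_Suc divide_simps del: of_nat_Suc)

lemma bessel_E_norm_summable: "summable (\<lambda>k. norm (rGamma (\<nu> + of_nat k + 1) / fact k * w ^ k :: complex))"
proof -
  obtain M where "M > 0" and M: "\<And>\<nu>' k w. norm \<nu>' \<le> norm \<nu> \<Longrightarrow>
      norm (rGamma (\<nu>' + of_nat k + 1) / fact k * w ^ k :: complex) \<le> M * (norm w ^ k / fact k)"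
    using bessel_E_term_bound by blast
  have bd: "norm (norm (rGamma (\<nu> + of_nat k + 1) / fact k * w ^ k)) \<le> M * (norm w ^ k / fact k)" for k
    unfolding real_norm_def abs_norm_cancel by (rule M) simp
  show ?thesis
    by (rule summable_comparison_test'[OF sums_summable[OF exp_series_scaled] bd])
qed

lemma bessel_E_sums: "(\<lambda>k. rGamma (\<nu> + of_nat k + 1) / fact k * w ^ k) sums bessel_E \<nu> w"
  unfolding bessel_E_def by (rule summable_sums, rule summable_norm_cancel, rule bessel_E_norm_summable)

lemma bessel_E_bound:
  obtains M where "M > 0" "\<And>\<nu> w. norm \<nu> \<le> R \<Longrightarrow> norm (bessel_E \<nu> w) \<le> M * exp (norm w)"
proof -
  obtain M where M: "M > 0" "\<And>\<nu> k w. norm \<nu> \<le> R \<Longrightarrow>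
      norm (rGamma (\<nu> + of_nat k + 1) / fact k * w ^ k :: complex) \<le> M * (norm w ^ k / fact k)"
    using bessel_E_term_bound by blast
  have "norm (bessel_E \<nu> w) \<le> M * exp (norm w)" if "norm \<nu> \<le> R" for \<nu> w
    unfolding bessel_E_def sums_unique[OF exp_series_scaled]
    using M(2)[OF that] exp_series_scaled by (intro norm_suminf_le sums_summable)
  with M(1) show ?thesis using that by blast
qed

lemma bessel_E_0 [simp]: "bessel_E \<nu> 0 = rGamma (\<nu> + 1)"
  using powser_zero[of "\<lambda>k. rGamma (\<nu> + of_nat k + 1) / fact k"] by (simp add: bessel_E_def)

lemma has_field_derivative_bessel_E:
  "(bessel_E \<nu> has_field_derivative bessel_E (\<nu> + 1) w) (at w)"
proof -
  have "((\<lambda>w. \<Sum>k. rGamma (\<nu> + of_nat k + 1) / fact k * w ^ k) has_field_derivative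
      (\<Sum>k. diffs (\<lambda>k. rGamma (\<nu> + of_nat k + 1) / fact k) k * w ^ k)) (at w)"
    by (rule termdiffs_strong_converges_everywhere)
       (rule summable_norm_cancel, rule bessel_E_norm_summable)
  moreover have "diffs (\<lambda>k. rGamma (\<nu> + of_nat k + 1) / fact k) =
      (\<lambda>k. rGamma (\<nu> + 1 + of_nat k + 1) / fact k)"
    unfolding diffs_def times_divide_eq_right Suc_divide_fact_Suc by (simp add: add_ac)
  ultimately show ?thesis by (simp add: bessel_E_def [abs_def])
qed

lemma bessel_E_has_derivative' [derivative_intros]:
  assumes "(f has_field_derivative f') (at w within A)"
  shows "((\<lambda>w. bessel_E \<nu> (f w)) has_field_derivative bessel_E (\<nu> + 1) (f w) * f') (at w within A)"
  using DERIV_chain2[OF has_field_derivative_bessel_E assms] .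

lemma holomorphic_on_bessel_E [holomorphic_intros]:
  "f holomorphic_on A \<Longrightarrow> (\<lambda>w. bessel_E \<nu> (f w)) holomorphic_on A"
proof -
  assume "f holomorphic_on A"
  moreover have "bessel_E \<nu> holomorphic_on UNIV"
    using has_field_derivative_bessel_E by (auto simp: holomorphic_on_open)
  ultimately show ?thesis
    using holomorphic_on_compose_gen[of f A "bessel_E \<nu>" UNIV] by (simp add: o_def)
qed

text \<open>Each partial sum is holomorphic in the order because rGamma is entire; the bound on
  rGamma, uniform in \<open>k\<close>, makes the convergence locally uniform by the M-test.\<close>

lemma bessel_E_order_holomorphic: "(\<lambda>\<nu>. bessel_E \<nu> w) holomorphic_on UNIV"
proof (rule holomorphic_uniform_sequence[where f = "\<lambda>n \<nu>. \<Sum>k<n. rGamma (\<nu> + of_nat k + 1) / fact k * w ^ k"])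
  show "(\<lambda>\<nu>. \<Sum>k<n. rGamma (\<nu> + of_nat k + 1) / fact k * w ^ k) holomorphic_on UNIV" for n
    by (intro holomorphic_intros) auto
  fix x :: complex
  obtain M where M: "M > 0" "\<And>\<nu> k w. norm \<nu> \<le> norm x + 1 \<Longrightarrow>
      norm (rGamma (\<nu> + of_nat k + 1) / fact k * w ^ k :: complex) \<le> M * (norm w ^ k / fact k)"
    using bessel_E_term_bound by blast
  have "uniform_limit (cball x 1) (\<lambda>n \<nu>. \<Sum>k<n. rGamma (\<nu> + of_nat k + 1) / fact k * w ^ k)
      (\<lambda>\<nu>. \<Sum>k. rGamma (\<nu> + of_nat k + 1) / fact k * w ^ k) sequentially"
  proof (rule Weierstrass_m_test)
    show "norm (rGamma (\<nu> + of_nat k + 1) / fact k * w ^ k) \<le> M * (norm w ^ k / fact k)"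
      if "\<nu> \<in> cball x 1" for k \<nu>
      by (rule M(2)) (use that norm_triangle_ineq2[of \<nu> x] in \<open>auto simp: dist_norm norm_minus_commute\<close>)
    show "summable (\<lambda>k. M * (norm w ^ k / fact k))"
      using exp_series_scaled by (rule sums_summable)
  qed
  then show "\<exists>d>0. cball x d \<subseteq> UNIV \<and>
      uniform_limit (cball x d) (\<lambda>n \<nu>. \<Sum>k<n. rGamma (\<nu> + of_nat k + 1) / fact k * w ^ k)
        (\<lambda>\<nu>. bessel_E \<nu> w) sequentially"
    unfolding bessel_E_def by (intro exI[of _ 1]) auto
qed auto

lemma holomorphic_on_bessel_E_order [holomorphic_intros]:
  "f holomorphic_on A \<Longrightarrow> (\<lambda>\<nu>. bessel_E (f \<nu>) w) holomorphic_on A"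
  using holomorphic_on_compose_gen[OF _ bessel_E_order_holomorphic, of f A w] by (simp add: o_def)

text \<open>Termwise, rGamma(\<nu> + k + 1) = (\<nu> + 1 + k) rGamma(\<nu> + k + 2): the summand
  \<nu> + 1 gives the first series, the summand \<open>k\<close> the second after an index
  shift.\<close>

lemma bessel_E_contiguous: "bessel_E \<nu> w = (\<nu> + 1) * bessel_E (\<nu> + 1) w + w * bessel_E (\<nu> + 2) w"
proof -
  \<comment> \<open>The contribution of the summand \<open>k\<close>. It vanishes at
    \<open>k = 0\<close>, so the shift by one loses nothing.\<close>
  define c where "c k = of_nat k * rGamma (\<nu> + 1 + of_nat k + 1) / fact k * w ^ k" for k
  have "(\<lambda>k. w * (rGamma (\<nu> + 2 + of_nat k + 1) / fact k * w ^ k)) sums (w * bessel_E (\<nu> + 2) w)"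
    by (intro sums_mult bessel_E_sums)
  also have "(\<lambda>k. w * (rGamma (\<nu> + 2 + of_nat k + 1) / fact k * w ^ k)) = (\<lambda>k. c (Suc k))"
  proof
    fix k
    have "\<nu> + 1 + of_nat (Suc k) + 1 = \<nu> + 2 + of_nat k + 1" by simp
    then show "w * (rGamma (\<nu> + 2 + of_nat k + 1) / fact k * w ^ k) = c (Suc k)"
      unfolding c_def Suc_divide_fact_Suc by (simp only: power_Suc mult_ac)
  qed
  finally have "c sums (w * bessel_E (\<nu> + 2) w)"
    by (subst (asm) sums_Suc_iff) (simp add: c_def)
  from sums_add[OF sums_mult[OF bessel_E_sums, of "\<nu> + 1" "\<nu> + 1" w] this]
  have "(\<lambda>k. (\<nu> + 1) * (rGamma (\<nu> + 1 + of_nat k + 1) / fact k * w ^ k) + c k) sums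
      ((\<nu> + 1) * bessel_E (\<nu> + 1) w + w * bessel_E (\<nu> + 2) w)" .
  also have "(\<lambda>k. (\<nu> + 1) * (rGamma (\<nu> + 1 + of_nat k + 1) / fact k * w ^ k) + c k) =
      (\<lambda>k. rGamma (\<nu> + of_nat k + 1) / fact k * w ^ k)"
  proof
    fix k
    have "rGamma (\<nu> + of_nat k + 1) = (\<nu> + of_nat k + 1) * rGamma (\<nu> + 1 + of_nat k + 1)"
      using rGamma_plus1[of "\<nu> + of_nat k + 1"] by (simp add: add_ac)
    then show "(\<nu> + 1) * (rGamma (\<nu> + 1 + of_nat k + 1) / fact k * w ^ k) + c k =
        rGamma (\<nu> + of_nat k + 1) / fact k * w ^ k"
      by (simp add: c_def field_simps)
  qed
  finally show ?thesis
    using bessel_E_sums sums_unique2 by blast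
qed

text \<open>The first n coefficients vanish because rGamma is zero at the poles of Gamma; the rest
  is the series of order n shifted by n places.\<close>

lemma bessel_E_minus_nat: "bessel_E (- of_nat n) w = w ^ n * bessel_E (of_nat n) w"
proof -
  define c where "c k = rGamma (- of_nat n + of_nat k + 1) / fact k * w ^ k" for k
  have c0: "c k = 0" if "k < n" for k
  proof -
    have "- of_nat n + of_nat k + 1 = (of_int (int k + 1 - int n) :: complex)" by simp
    then show ?thesis unfolding c_def using that by (simp only: rGamma_of_int) simp
  qed
  have "c (k + n) = w ^ n * (rGamma (of_nat n + of_nat k + 1) / fact k * w ^ k)" for k
  proof -
    have 1: "rGamma (- of_nat n + of_nat (k + n) + 1 :: complex) = 1 / fact k"
      using rGamma_inverse_Gamma[of "1 + of_nat k :: complex"] Gamma_fact[of k, where 'a = complex]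
      by (simp add: inverse_eq_divide add_ac)
    have 2: "rGamma (of_nat n + of_nat k + 1 :: complex) = 1 / fact (k + n)"
      using rGamma_inverse_Gamma[of "1 + of_nat (k + n) :: complex"] Gamma_fact[of "k + n", where 'a = complex]
      by (simp add: inverse_eq_divide add_ac)
    show ?thesis unfolding c_def 1 2 by (simp add: power_add mult.commute)
  qed
  then have "(\<lambda>k. c (k + n)) sums (w ^ n * bessel_E (of_nat n) w)"
    using sums_mult[OF bessel_E_sums[of "of_nat n" w], of "w ^ n"] by simp
  then have "c sums (w ^ n * bessel_E (of_nat n) w)"
    by (subst (asm) sums_iff_shift) (simp add: c0)
  then show ?thesis
    using sums_unique2[OF bessel_E_sums[of "- of_nat n" w]] unfolding c_def by blast
qed

subsection \<open>Bessel functions of the first kind\<close>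

text \<open>The sign \<sigma> = -1 gives J and \<sigma> = 1 gives I, so the recurrences and
  derivative formulas are proved once for both.\<close>

definition bessel_cyl :: "complex \<Rightarrow> complex \<Rightarrow> complex \<Rightarrow> complex" where
  "bessel_cyl \<sigma> \<nu> z = (z / 2) powr \<nu> * bessel_E \<nu> (\<sigma> * (z / 2)\<^sup>2)"

lemma Bessel_J_conv: "Bessel_J = bessel_cyl (- 1)"
proof (intro ext)
  fix \<nu> z :: complex
  have "(- 1) ^ k * rGamma (\<nu> + of_nat k + 1) / fact k * (z / 2) ^ (2 * k) =
      rGamma (\<nu> + of_nat k + 1) / fact k * (- ((z / 2)\<^sup>2)) ^ k" for k
    by (simp add: power_minus[of "(z / 2)\<^sup>2"] power_mult)
  then show "Bessel_J \<nu> z = bessel_cyl (- 1) \<nu> z"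
    by (simp only: Bessel_J_def bessel_cyl_def bessel_E_def mult_minus1)
qed

lemma Bessel_I_conv: "Bessel_I = bessel_cyl 1"
  by (intro ext) (simp add: Bessel_I_def bessel_cyl_def bessel_E_def power_mult)

lemma half_powr_plus_1:
  fixes z :: complex
  assumes "z \<noteq> 0"
  shows "(z / 2) powr (\<nu> + 1) = (z / 2) powr \<nu> * (z / 2)"
  using assms by (simp add: powr_add)

lemma half_notin_nonpos_Reals: "z \<notin> \<real>\<^sub>\<le>\<^sub>0 \<Longrightarrow> z / 2 \<notin> (\<real>\<^sub>\<le>\<^sub>0 :: complex set)"
  by (simp add: complex_nonpos_Reals_iff)

lemma has_field_derivative_bessel_cyl:
  assumes z: "z \<notin> \<real>\<^sub>\<le>\<^sub>0"
  shows "(bessel_cyl \<sigma> \<nu> has_field_derivative \<nu> / z * bessel_cyl \<sigma> \<nu> z + \<sigma> * bessel_cyl \<sigma> (\<nu> + 1) z) (at z)"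
proof -
  have z0: "z \<noteq> 0" using z by auto
  have pw: "(z / 2) powr (\<nu> - 1) = (z / 2) powr \<nu> / (z / 2)"
    using z0 by (simp add: powr_diff)
  have d1: "((\<lambda>z. (z / 2) powr \<nu>) has_field_derivative \<nu> * (z / 2) powr (\<nu> - 1) * (1 / 2)) (at z)"
    by (rule DERIV_chain2[where f = "\<lambda>z. z powr \<nu>" and g = "\<lambda>z. z / 2"])
       (use half_notin_nonpos_Reals[OF z] in
        \<open>auto intro!: has_field_derivative_powr derivative_eq_intros\<close>)
  have d2: "((\<lambda>z. bessel_E \<nu> (\<sigma> * (z / 2)\<^sup>2)) has_field_derivative
      bessel_E (\<nu> + 1) (\<sigma> * (z / 2)\<^sup>2) * (\<sigma> * (z / 2))) (at z)"
    by (rule bessel_E_has_derivative') (auto intro!: derivative_eq_intros simp: power2_eq_square)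
  have "(bessel_cyl \<sigma> \<nu> has_field_derivative
      \<nu> * (z / 2) powr (\<nu> - 1) * (1 / 2) * bessel_E \<nu> (\<sigma> * (z / 2)\<^sup>2) +
      (bessel_E (\<nu> + 1) (\<sigma> * (z / 2)\<^sup>2) * (\<sigma> * (z / 2))) * (z / 2) powr \<nu>) (at z)"
    unfolding bessel_cyl_def [abs_def] using DERIV_mult[OF d1 d2] .
  then show ?thesis
    unfolding pw bessel_cyl_def half_powr_plus_1[OF z0]
    by (rule DERIV_cong) (use z0 in \<open>simp add: field_simps\<close>)
qed

lemma bessel_cyl_contiguous:
  assumes z: "z \<noteq> 0"
  shows "\<sigma> * bessel_cyl \<sigma> (\<nu> + 2) z = bessel_cyl \<sigma> \<nu> z - 2 * (\<nu> + 1) / z * bessel_cyl \<sigma> (\<nu> + 1) z"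
proof -
  have p2: "(z / 2) powr (\<nu> + 2) = (z / 2) powr \<nu> * (z / 2) * (z / 2)"
  proof -
    have "\<nu> + 2 = \<nu> + 1 + 1" by simp
    then show ?thesis by (simp only: half_powr_plus_1[OF z])
  qed
  show ?thesis
    unfolding bessel_cyl_def p2 half_powr_plus_1[OF z] bessel_E_contiguous[of \<nu>]
    using z by (simp add: field_simps power2_eq_square)
qed

text \<open>Eliminating the order \<nu> + 2 by the recurrence closes the orders \<nu> and \<nu> + 1
  into a first-order system. This is the form in which Bessel's equation is used from here
  on.\<close>

lemma has_field_derivative_bessel_cyl_plus_1:
  assumes z: "z \<notin> \<real>\<^sub>\<le>\<^sub>0"
  shows "(bessel_cyl \<sigma> (\<nu> + 1) has_field_derivative
      bessel_cyl \<sigma> \<nu> z - (\<nu> + 1) / z * bessel_cyl \<sigma> (\<nu> + 1) z) (at z)"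
proof -
  have z0: "z \<noteq> 0" using z by auto
  have "\<nu> + 1 + 1 = \<nu> + 2" by simp
  then show ?thesis
    using has_field_derivative_bessel_cyl[OF z, of \<sigma> "\<nu> + 1"] bessel_cyl_contiguous[OF z0, of \<sigma> \<nu>]
    by (auto elim!: DERIV_cong simp: field_simps)
qed

lemma holomorphic_bessel_cyl_order:
  "z \<noteq> 0 \<Longrightarrow> (\<lambda>\<nu>. bessel_cyl \<sigma> \<nu> z) holomorphic_on A"
  unfolding bessel_cyl_def by (intro holomorphic_intros)

text \<open>The constant is uniform over complex orders in a disc, as holomorphy in \<nu> will
  require; \<open>2 powr R\<close> absorbs the factor 2^(-Re \<nu>) from the halved
  argument.\<close>

lemma bessel_cyl_bound_0_1:
  obtains M where "M > 0" "\<And>\<nu> b. norm \<nu> \<le> R \<Longrightarrow> 0 < b \<Longrightarrow> b \<le> 1 \<Longrightarrow>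
    norm (bessel_cyl (- 1) \<nu> (of_real b)) \<le> M * b powr Re \<nu>"
proof -
  obtain M where M: "M > 0" "\<And>\<nu> w. norm \<nu> \<le> R \<Longrightarrow> norm (bessel_E \<nu> w) \<le> M * exp (norm w)"
    using bessel_E_bound by blast
  have "norm (bessel_cyl (- 1) \<nu> (of_real b)) \<le> (2 powr R * (M * exp 1)) * b powr Re \<nu>"
    if \<nu>: "norm \<nu> \<le> R" and b: "0 < b" "b \<le> 1" for \<nu> b
  proof -
    have "norm ((of_real b / 2) powr \<nu>) = (b / 2) powr Re \<nu>"
      using b norm_powr_real_powr[of "of_real (b / 2)" \<nu>] by simp
    also have "\<dots> = 2 powr (- Re \<nu>) * b powr Re \<nu>"
      using b by (simp add: powr_divide powr_minus field_simps)
    also have "\<dots> \<le> 2 powr R * b powr Re \<nu>"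
      using \<nu> abs_Re_le_cmod[of \<nu>] by (intro mult_right_mono powr_mono) auto
    finally have 1: "norm ((of_real b / 2) powr \<nu>) \<le> 2 powr R * b powr Re \<nu>" .
    have "norm (- 1 * (complex_of_real b / 2)\<^sup>2) \<le> 1"
      using b power_le_one[of "b / 2" 2] by (simp add: norm_power norm_divide norm_mult)
    then have "M * exp (norm (- 1 * (complex_of_real b / 2)\<^sup>2)) \<le> M * exp 1"
      using M(1) by simp
    then have 2: "norm (bessel_E \<nu> (- 1 * (of_real b / 2)\<^sup>2)) \<le> M * exp 1"
      using M(2)[OF \<nu>] order_trans by blast
    have "norm (bessel_cyl (- 1) \<nu> (of_real b)) \<le> (2 powr R * b powr Re \<nu>) * (M * exp 1)"
      unfolding bessel_cyl_def norm_mult using 1 2 M(1) by (intro mult_mono) auto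
    then show ?thesis by (simp add: mult_ac)
  qed
  then show ?thesis using that[of "2 powr R * (M * exp 1)"] M(1) by simp
qed


lemma has_vector_derivative_bessel_J:
  assumes "b > 0"
  shows "((\<lambda>b. bessel_cyl (- 1) \<nu> (of_real b)) has_vector_derivative
      \<nu> / of_real b * bessel_cyl (- 1) \<nu> (of_real b) - bessel_cyl (- 1) (\<nu> + 1) (of_real b)) (at b)"
    and "((\<lambda>b. bessel_cyl (- 1) (\<nu> + 1) (of_real b)) has_vector_derivative
      bessel_cyl (- 1) \<nu> (of_real b) - (\<nu> + 1) / of_real b * bessel_cyl (- 1) (\<nu> + 1) (of_real b)) (at b)"
proof -
  have b: "complex_of_real b \<notin> \<real>\<^sub>\<le>\<^sub>0" using assms by (simp add: complex_nonpos_Reals_iff)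
  show "((\<lambda>b. bessel_cyl (- 1) \<nu> (of_real b)) has_vector_derivative
      \<nu> / of_real b * bessel_cyl (- 1) \<nu> (of_real b) - bessel_cyl (- 1) (\<nu> + 1) (of_real b)) (at b)"
    using has_vector_derivative_real_field[OF has_field_derivative_bessel_cyl[OF b, of "- 1" \<nu>]]
    by simp
  show "((\<lambda>b. bessel_cyl (- 1) (\<nu> + 1) (of_real b)) has_vector_derivative
      bessel_cyl (- 1) \<nu> (of_real b) - (\<nu> + 1) / of_real b * bessel_cyl (- 1) (\<nu> + 1) (of_real b)) (at b)"
    using has_vector_derivative_real_field[OF has_field_derivative_bessel_cyl_plus_1[OF b, of "- 1" \<nu>]] .
qed

lemma continuous_on_bessel_J [continuous_intros]:
  "continuous_on {0<..} (\<lambda>b. bessel_cyl (- 1) \<nu> (of_real b))"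
  using has_vector_derivative_bessel_J(1)
  by (intro continuous_at_imp_continuous_on ballI has_vector_derivative_continuous) auto

text \<open>Gronwall for the energy e = |U|^2 + |w|^2. The unperturbed rotation conserves it, so
  |e'| is at most e |\<kappa>| / b^2, and exp(|\<kappa>| / b) is the integrating factor that makes
  the product nonincreasing.\<close>

lemma perturbed_oscillator_energy_bound:
  fixes U w :: "real \<Rightarrow> complex"
  assumes U: "\<And>b. b \<ge> 1 \<Longrightarrow> (U has_vector_derivative - w b) (at b)"
    and w: "\<And>b. b \<ge> 1 \<Longrightarrow> (w has_vector_derivative (1 + \<kappa> / of_real b ^ 2) * U b) (at b)"
    and b: "b \<ge> 1"
  shows "(norm (U b))\<^sup>2 + (norm (w b))\<^sup>2 \<le> ((norm (U 1))\<^sup>2 + (norm (w 1))\<^sup>2) * exp (norm \<kappa>)"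
proof -
  define e where "e b = U b \<bullet> U b + w b \<bullet> w b" for b
  define F where "F b = e b * exp (norm \<kappa> / b)" for b
  have e': "(e has_real_derivative 2 * (w b \<bullet> (\<kappa> / of_real b ^ 2 * U b))) (at b)" if b: "b \<ge> 1" for b
  proof -
    note D = bounded_bilinear.has_vector_derivative[OF bounded_bilinear_inner]
    have "(e has_vector_derivative (U b \<bullet> (- w b) + (- w b) \<bullet> U b) +
        (w b \<bullet> ((1 + \<kappa> / of_real b ^ 2) * U b) + ((1 + \<kappa> / of_real b ^ 2) * U b) \<bullet> w b)) (at b)"
      unfolding e_def [abs_def]
      by (intro has_vector_derivative_add D U[OF b] w[OF b])
    moreover have "(U b \<bullet> (- w b) + (- w b) \<bullet> U b) +
        (w b \<bullet> ((1 + \<kappa> / of_real b ^ 2) * U b) + ((1 + \<kappa> / of_real b ^ 2) * U b) \<bullet> w b) =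
        2 * (w b \<bullet> (\<kappa> / of_real b ^ 2 * U b))"
      by (simp add: distrib_right inner_add_left inner_add_right inner_commute)
    ultimately show ?thesis by (simp add: has_real_derivative_iff_has_vector_derivative)
  qed
  have F': "\<exists>y. (F has_real_derivative y) (at x) \<and> y \<le> 0" if "1 \<le> x" "x \<le> b" for x
  proof (intro exI conjI)
    show "(F has_real_derivative
        (2 * (w x \<bullet> (\<kappa> / of_real x ^ 2 * U x)) - e x * (norm \<kappa> / x\<^sup>2)) * exp (norm \<kappa> / x)) (at x)"
      unfolding F_def [abs_def] using that
      by (auto intro!: derivative_eq_intros e' simp: power2_eq_square field_simps)
    have "2 * (w x \<bullet> (\<kappa> / of_real x ^ 2 * U x)) \<le> 2 * (norm (w x) * (norm \<kappa> / x\<^sup>2 * norm (U x)))"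
      using norm_cauchy_schwarz[of "w x" "\<kappa> / of_real x ^ 2 * U x"] by (simp add: norm_mult norm_divide norm_power)
    also have "\<dots> = (2 * norm (U x) * norm (w x)) * (norm \<kappa> / x\<^sup>2)" by simp
    also have "\<dots> \<le> e x * (norm \<kappa> / x\<^sup>2)"
      unfolding e_def dot_square_norm by (intro mult_right_mono sum_squares_bound) auto
    finally show "(2 * (w x \<bullet> (\<kappa> / of_real x ^ 2 * U x)) - e x * (norm \<kappa> / x\<^sup>2)) * exp (norm \<kappa> / x) \<le> 0"
      by (simp add: mult_nonpos_nonneg)
  qed
  have "e b \<le> F b"
    using mult_left_mono[of 1 "exp (norm \<kappa> / b)" "e b"] b by (simp add: F_def e_def)
  also have "F b \<le> F 1"
    using b F' by (rule DERIV_nonpos_imp_nonincreasing)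
  finally show ?thesis by (simp add: F_def e_def dot_square_norm)
qed

text \<open>
  The energy method is applied to \<open>u(b) = \<surd>b J\<^bsub>\<nu>\<^esub>(b)\<close>, which satisfies
  \<open>u'' = -(1 + (1/4 - \<nu>\<^sup>2)/b\<^sup>2)u\<close>; the perturbation is integrable at infinity.
\<close>

lemma bessel_J_bound_1_inf:
  obtains M where "M > 0" "\<And>\<nu> b. norm \<nu> \<le> R \<Longrightarrow> 1 \<le> b \<Longrightarrow>
    norm (bessel_cyl (- 1) \<nu> (of_real b)) \<le> M * b powr (- 1 / 2)"
proof -
  \<comment> \<open>The radius is enlarged by 1 because the initial energy at b = 1 also involves
    the order \<nu> + 1.\<close>
  obtain M where M: "M > 0" "\<And>\<nu> b. norm \<nu> \<le> \<bar>R\<bar> + 1 \<Longrightarrow> 0 < b \<Longrightarrow> b \<le> 1 \<Longrightarrow>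
      norm (bessel_cyl (- 1) \<nu> (of_real b)) \<le> M * b powr Re \<nu>"
    using bessel_cyl_bound_0_1 by blast
  define N where "N = (M\<^sup>2 + (M + (\<bar>R\<bar> + 1) * M)\<^sup>2) * exp ((\<bar>R\<bar> + 1) + (\<bar>R\<bar> + 1)\<^sup>2)"
  have N: "N > 0" using M(1) unfolding N_def by (intro mult_pos_pos add_pos_nonneg) auto
  have "norm (bessel_cyl (- 1) \<nu> (of_real b)) \<le> sqrt N * b powr (- 1 / 2)"
    if \<nu>: "norm \<nu> \<le> R" and b: "1 \<le> b" for \<nu> b
  proof -
    \<comment> \<open>Here \<open>w\<close> is -U', with the derivative of the square root merged
      into \<open>c\<close>; then c - c^2 = 1/4 - \<nu>^2 is the coefficient of the
      perturbation.\<close>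
    define c where "c = \<nu> + 1 / 2"
    define U where "U b = of_real (sqrt b) * bessel_cyl (- 1) \<nu> (of_real b)" for b
    define w where "w b = of_real (sqrt b) * bessel_cyl (- 1) (\<nu> + 1) (of_real b) - c / of_real b * U b" for b
    have sq: "((\<lambda>b. complex_of_real (sqrt b)) has_vector_derivative of_real (sqrt b) / (2 * of_real b)) (at b)"
      if "b \<ge> 1" for b
    proof -
      have "(sqrt has_real_derivative inverse (sqrt b) / 2) (at b)"
        by (rule DERIV_real_sqrt) (use that in auto)
      also have "inverse (sqrt b) / 2 = sqrt b / (2 * b)"
        using that by (simp add: field_simps)
      finally have "((\<lambda>b. complex_of_real (sqrt b)) has_vector_derivative of_real (sqrt b / (2 * b))) (at b)"
        by (intro has_vector_derivative_of_real) (simp add: has_real_derivative_iff_has_vector_derivative)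
      then show ?thesis by simp
    qed
    have U': "(U has_vector_derivative - w b) (at b)" if "b \<ge> 1" for b
    proof -
      have "b > 0" using that by simp
      show ?thesis
        unfolding U_def [abs_def]
        by (rule has_vector_derivative_eq_rhs[OF has_vector_derivative_mult[OF sq[OF that]
                has_vector_derivative_bessel_J(1)[OF \<open>b > 0\<close>]]])
           (use that in \<open>simp add: w_def U_def c_def field_simps\<close>)
    qed
    have inv: "((\<lambda>b. c / complex_of_real b) has_vector_derivative - c / of_real b ^ 2) (at b)" if "b \<ge> 1" for b
    proof -
      have "((\<lambda>z. c / z) has_field_derivative - c / of_real b ^ 2) (at (complex_of_real b))"
        using that by (auto intro!: derivative_eq_intros simp: power2_eq_square)
      then show ?thesis by (rule has_vector_derivative_real_field)
    qed
    have w': "(w has_vector_derivative (1 + (c - c\<^sup>2) / of_real b ^ 2) * U b) (at b)" if "b \<ge> 1" for b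
    proof -
      have "b > 0" using that by simp
      show ?thesis
        unfolding w_def [abs_def]
        by (rule has_vector_derivative_eq_rhs[OF has_vector_derivative_diff[OF
                has_vector_derivative_mult[OF sq[OF that] has_vector_derivative_bessel_J(2)[OF \<open>b > 0\<close>]]
                has_vector_derivative_mult[OF inv[OF that] U'[OF that]]]])
           (use that in \<open>simp add: w_def U_def c_def field_simps power2_eq_square\<close>)
    qed
    have c: "norm c \<le> \<bar>R\<bar> + 1"
      using norm_triangle_ineq[of \<nu> "1 / 2"] \<nu> by (simp add: c_def norm_divide)
    have J1: "norm (bessel_cyl (- 1) \<nu> 1) \<le> M" "norm (bessel_cyl (- 1) (\<nu> + 1) 1) \<le> M"
      using M(2)[of \<nu> 1] M(2)[of "\<nu> + 1" 1] \<nu> norm_triangle_ineq[of \<nu> 1] by auto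
    have "norm (w 1) \<le> norm (bessel_cyl (- 1) (\<nu> + 1) 1) + norm (c * bessel_cyl (- 1) \<nu> 1)"
      unfolding w_def U_def using norm_triangle_ineq4 by simp
    also have "\<dots> \<le> M + (\<bar>R\<bar> + 1) * M"
      unfolding norm_mult using J1 c M(1) by (intro add_mono mult_mono) auto
    finally have w1: "norm (w 1) \<le> M + (\<bar>R\<bar> + 1) * M" .
    have \<kappa>: "norm (c - c\<^sup>2) \<le> (\<bar>R\<bar> + 1) + (\<bar>R\<bar> + 1)\<^sup>2"
      using norm_triangle_ineq4[of c "c\<^sup>2", unfolded norm_power] power_mono[OF c norm_ge_zero, of 2] c
      by linarith
    have "(norm (U b))\<^sup>2 \<le> (norm (U b))\<^sup>2 + (norm (w b))\<^sup>2" by simp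
    also have "\<dots> \<le> ((norm (U 1))\<^sup>2 + (norm (w 1))\<^sup>2) * exp (norm (c - c\<^sup>2))"
      using U' w' b by (rule perturbed_oscillator_energy_bound)
    also have "\<dots> \<le> N"
      unfolding N_def using J1(1) w1 \<kappa> by (intro mult_mono add_mono power_mono) (auto simp: U_def)
    finally have "norm (U b) \<le> sqrt N" by (rule real_le_rsqrt)
    then have "sqrt b * norm (bessel_cyl (- 1) \<nu> (of_real b)) \<le> sqrt N"
      using b by (simp add: U_def norm_mult)
    moreover have pw: "b powr (- 1 / 2) = 1 / sqrt b"
      using b powr_minus_divide[of b "1 / 2"] by (simp add: powr_half_sqrt)
    ultimately show ?thesis unfolding pw using b by (simp add: field_simps)
  qed
  then show ?thesis using that[of "sqrt N"] N by simp
qed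

lemma bessel_J_bound:
  obtains M where "M > 0"
    "\<And>\<nu> b. norm \<nu> \<le> R \<Longrightarrow> 0 < b \<Longrightarrow> b \<le> 1 \<Longrightarrow> norm (bessel_cyl (- 1) \<nu> (of_real b)) \<le> M * b powr Re \<nu>"
    "\<And>\<nu> b. norm \<nu> \<le> R \<Longrightarrow> 1 \<le> b \<Longrightarrow> norm (bessel_cyl (- 1) \<nu> (of_real b)) \<le> M * b powr (- 1 / 2)"
proof -
  obtain M1 where M1: "M1 > 0" "\<And>\<nu> b. norm \<nu> \<le> R \<Longrightarrow> 0 < b \<Longrightarrow> b \<le> 1 \<Longrightarrow>
      norm (bessel_cyl (- 1) \<nu> (of_real b)) \<le> M1 * b powr Re \<nu>"
    using bessel_cyl_bound_0_1 by blast
  obtain M2 where M2: "M2 > 0" "\<And>\<nu> b. norm \<nu> \<le> R \<Longrightarrow> 1 \<le> b \<Longrightarrow>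
      norm (bessel_cyl (- 1) \<nu> (of_real b)) \<le> M2 * b powr (- 1 / 2)"
    using bessel_J_bound_1_inf by blast
  show ?thesis
  proof (rule that[of "max M1 M2"])
    show "norm (bessel_cyl (- 1) \<nu> (of_real b)) \<le> max M1 M2 * b powr Re \<nu>"
      if "norm \<nu> \<le> R" "0 < b" "b \<le> 1" for \<nu> b
      using M1(2)[OF that] by (rule order_trans) (intro mult_right_mono; simp)
    show "norm (bessel_cyl (- 1) \<nu> (of_real b)) \<le> max M1 M2 * b powr (- 1 / 2)"
      if "norm \<nu> \<le> R" "1 \<le> b" for \<nu> b
      using M2(2)[OF that] by (rule order_trans) (intro mult_right_mono; simp)
  qed (use M1(1) in auto)
qed

subsection \<open>The integral as a function of its parameters\<close>

text \<open>Common majorant, up to a constant, of J(b)/(1 + b) for orders with Re \<nu> at least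
  \<sigma>: the power b^(-3/2) combines the decay b^(-1/2) of J with 1/b from the kernel.\<close>

definition bessel_dom :: "real \<Rightarrow> real \<Rightarrow> real" where
  "bessel_dom \<sigma> b = (if b \<le> 1 then b powr \<sigma> else b powr (- 3 / 2))"

lemma bessel_dom_nonneg [simp]: "bessel_dom \<sigma> b \<ge> 0"
  by (simp add: bessel_dom_def)

lemma bessel_dom_integrable:
  assumes "\<sigma> > - 1"
  shows "bessel_dom \<sigma> integrable_on {0<..}"
proof -
  have "(\<lambda>b. b powr \<sigma>) integrable_on {0<..1}"
    using assms by (intro integrable_on_powr_from_0') auto
  then have 1: "bessel_dom \<sigma> integrable_on {0<..1}"
    by (rule integrable_eq) (auto simp: bessel_dom_def)
  have "(\<lambda>b :: real. b powr (- 3 / 2)) integrable_on {1..}"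
    using has_integral_powr_to_inf[of "- 3 / 2" 1] by (auto simp: integrable_on_def)
  then have 2: "bessel_dom \<sigma> integrable_on {1..}"
    by (rule integrable_eq) (auto simp: bessel_dom_def)
  have "{0<..1} \<inter> {1..} = {1 :: real}" "{0<..} = {0<..1} \<union> {1 :: real..}" by auto
  then show ?thesis
    using integrable_Un'[OF 1 2] by simp
qed

lemma bessel_J_dominated:
  obtains M where "M > 0" "\<And>\<nu> b. norm \<nu> \<le> R \<Longrightarrow> \<sigma> \<le> Re \<nu> \<Longrightarrow> 0 < b \<Longrightarrow>
    norm (bessel_cyl (- 1) \<nu> (of_real b)) / (1 + b) \<le> M * bessel_dom \<sigma> b"
proof -
  obtain M where M: "M > 0"
    "\<And>\<nu> b. norm \<nu> \<le> R \<Longrightarrow> 0 < b \<Longrightarrow> b \<le> 1 \<Longrightarrow> norm (bessel_cyl (- 1) \<nu> (of_real b)) \<le> M * b powr Re \<nu>"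
    "\<And>\<nu> b. norm \<nu> \<le> R \<Longrightarrow> 1 \<le> b \<Longrightarrow> norm (bessel_cyl (- 1) \<nu> (of_real b)) \<le> M * b powr (- 1 / 2)"
    using bessel_J_bound by blast
  have "norm (bessel_cyl (- 1) \<nu> (of_real b)) / (1 + b) \<le> M * bessel_dom \<sigma> b"
    if \<nu>: "norm \<nu> \<le> R" "\<sigma> \<le> Re \<nu>" and b: "0 < b" for \<nu> b
  proof (cases "b \<le> 1")
    case True
    have "norm (bessel_cyl (- 1) \<nu> (of_real b)) / (1 + b) \<le> norm (bessel_cyl (- 1) \<nu> (of_real b)) / 1"
      using b by (intro divide_left_mono) auto
    also have "\<dots> \<le> M * b powr Re \<nu>"
      using M(2)[OF \<nu>(1) b True] by simp
    also have "\<dots> \<le> M * b powr \<sigma>"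
      using M(1) b True \<nu>(2) by (intro mult_left_mono powr_mono') auto
    finally show ?thesis using True by (simp add: bessel_dom_def)
  next
    case False
    have "norm (bessel_cyl (- 1) \<nu> (of_real b)) / (1 + b) \<le> norm (bessel_cyl (- 1) \<nu> (of_real b)) / b"
      using b by (intro divide_left_mono) auto
    also have "\<dots> \<le> M * b powr (- 1 / 2) / b"
      using M(3)[OF \<nu>(1), of b] False b by (intro divide_right_mono) auto
    also have "\<dots> = M * b powr (- 3 / 2)"
      using b powr_diff[of b "- 1 / 2" 1] by simp
    finally show ?thesis using False by (simp add: bessel_dom_def)
  qed
  with M(1) show ?thesis using that by blast
qed

section \<open>The square-root kernel for complex \<alpha> in the right half-plane\<close>

definition ker_root :: "complex \<Rightarrow> real \<Rightarrow> complex" where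
  "ker_root \<alpha> b = csqrt ((of_real b)\<^sup>2 + 4 * \<alpha>\<^sup>2)"

lemma ker_radicand_not_nonpos:
  assumes "Re \<alpha> > 0"
  shows "(of_real b)\<^sup>2 + 4 * \<alpha>\<^sup>2 \<notin> \<real>\<^sub>\<le>\<^sub>0"
proof
  assume "(of_real b)\<^sup>2 + 4 * \<alpha>\<^sup>2 \<in> \<real>\<^sub>\<le>\<^sub>0"
  then have "Im ((of_real b)\<^sup>2 + 4 * \<alpha>\<^sup>2) = 0" "Re ((of_real b)\<^sup>2 + 4 * \<alpha>\<^sup>2) \<le> 0"
    by (auto simp: complex_nonpos_Reals_iff)
  then have "Im \<alpha> = 0" and "b * b + 4 * (Re \<alpha> * Re \<alpha> - Im \<alpha> * Im \<alpha>) \<le> 0"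
    using assms by (simp_all add: power2_eq_square)
  moreover have "Re \<alpha> * Re \<alpha> > 0" using assms by simp
  ultimately show False using zero_le_square[of b] by simp
qed

lemma ker_root_square: "ker_root \<alpha> b ^ 2 = (of_real b)\<^sup>2 + 4 * \<alpha>\<^sup>2"
  by (simp add: ker_root_def)

lemma ker_root_nonzero: "Re \<alpha> > 0 \<Longrightarrow> ker_root \<alpha> b \<noteq> 0"
  using ker_radicand_not_nonpos[of \<alpha> b] by (auto simp: ker_root_def)

text \<open>With \<alpha> = x + iy and s = |\<alpha>|^2, the squared modulus equals (x^2/s)(b^2 +
  4s)^2 + (y^2/s)(b^2 - 4s)^2; the second square is dropped.\<close>

lemma norm_ker_radicand_ge:
  assumes "Re \<alpha> > 0"
  shows "Re \<alpha> / norm \<alpha> * (b\<^sup>2 + 4 * (norm \<alpha>)\<^sup>2) \<le> norm ((of_real b)\<^sup>2 + 4 * \<alpha>\<^sup>2)"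
proof (rule power2_le_imp_le)
  define x y where "x = Re \<alpha>" and "y = Im \<alpha>"
  have x: "x > 0" using assms by (simp add: x_def)
  define s where "s = x\<^sup>2 + y\<^sup>2"
  have s: "(norm \<alpha>)\<^sup>2 = s" "s > 0"
    using x by (auto simp: cmod_power2 s_def x_def y_def add_pos_nonneg)
  have "(norm ((of_real b)\<^sup>2 + 4 * \<alpha>\<^sup>2))\<^sup>2 = (b\<^sup>2 + 4 * (x\<^sup>2 - y\<^sup>2))\<^sup>2 + (8 * x * y)\<^sup>2"
    unfolding cmod_power2 by (simp add: x_def y_def power2_eq_square)
  also have "\<dots> = x\<^sup>2 / s * (b\<^sup>2 + 4 * s)\<^sup>2 + y\<^sup>2 / s * (b\<^sup>2 - 4 * s)\<^sup>2"
  proof -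
    have "s * ((b\<^sup>2 + 4 * (x\<^sup>2 - y\<^sup>2))\<^sup>2 + (8 * x * y)\<^sup>2) = x\<^sup>2 * (b\<^sup>2 + 4 * s)\<^sup>2 + y\<^sup>2 * (b\<^sup>2 - 4 * s)\<^sup>2"
      by (simp add: s_def power2_eq_square algebra_simps)
    then show ?thesis using s(2) by (simp add: field_simps)
  qed
  also have "\<dots> \<ge> x\<^sup>2 / s * (b\<^sup>2 + 4 * s)\<^sup>2"
    using s(2) by simp
  finally show "(Re \<alpha> / norm \<alpha> * (b\<^sup>2 + 4 * (norm \<alpha>)\<^sup>2))\<^sup>2 \<le> (norm ((of_real b)\<^sup>2 + 4 * \<alpha>\<^sup>2))\<^sup>2"
    by (simp add: power_mult_distrib power_divide s x_def)
qed auto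

lemma ker_root_lower_bound:
  assumes "Re \<alpha>0 > 0"
  obtains c where "c > 0"
    "\<And>\<alpha> b. \<alpha> \<in> ball \<alpha>0 (Re \<alpha>0 / 2) \<Longrightarrow> 0 < b \<Longrightarrow> c * (1 + b) \<le> norm (ker_root \<alpha> b)"
proof -
  define x where "x = Re \<alpha>0"
  have x: "x > 0" using assms by (simp add: x_def)
  have n0: "norm \<alpha>0 > 0" using assms by auto
  have n0x: "x \<le> norm \<alpha>0" using complex_Re_le_cmod[of \<alpha>0] by (simp add: x_def)
  \<comment> \<open>On the ball Re \<alpha> > x/2 and |\<alpha>| is at most 2|\<alpha>0|, which
    bounds Re \<alpha> / |\<alpha>| from below; the minimum turns b^2 + 4|\<alpha>|^2 into a
    multiple of b^2 + 1. The halving in \<open>sqrt (c / 2)\<close> pays for (1 + b)^2 being at most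
    2(b^2 + 1).\<close>
  define c where "c = x / 2 / (2 * norm \<alpha>0) * min 1 (x\<^sup>2)"
  have c: "c > 0" using x n0 by (simp add: c_def)
  have "sqrt (c / 2) * (1 + b) \<le> norm (ker_root \<alpha> b)"
    if \<alpha>: "\<alpha> \<in> ball \<alpha>0 (Re \<alpha>0 / 2)" and b: "0 < b" for \<alpha> b
  proof -
    have d: "norm (\<alpha>0 - \<alpha>) < x / 2" using \<alpha> by (simp add: dist_norm x_def)
    have Re: "Re \<alpha> > x / 2"
      using abs_Re_le_cmod[of "\<alpha>0 - \<alpha>"] d by (simp add: x_def)
    have nu: "norm \<alpha> \<le> 2 * norm \<alpha>0"
      using norm_triangle_ineq4[of \<alpha>0 "\<alpha>0 - \<alpha>"] d n0x x by simp
    have nl: "norm \<alpha> \<ge> x / 2" using Re complex_Re_le_cmod[of \<alpha>] by linarith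
    have "(x / 2)\<^sup>2 \<le> (norm \<alpha>)\<^sup>2" using nl x by (intro power_mono) auto
    then have "x\<^sup>2 \<le> 4 * (norm \<alpha>)\<^sup>2" by (simp add: power_divide)
    moreover have "min 1 (x\<^sup>2) * b\<^sup>2 \<le> 1 * b\<^sup>2" by (rule mult_right_mono) auto
    ultimately have "min 1 (x\<^sup>2) * (b\<^sup>2 + 1) \<le> b\<^sup>2 + 4 * (norm \<alpha>)\<^sup>2"
      by (simp add: distrib_left)
    moreover have "x / 2 / (2 * norm \<alpha>0) \<le> Re \<alpha> / norm \<alpha>"
      using Re nu nl x by (intro frac_le) auto
    ultimately have "x / 2 / (2 * norm \<alpha>0) * (min 1 (x\<^sup>2) * (b\<^sup>2 + 1)) \<le> Re \<alpha> / norm \<alpha> * (b\<^sup>2 + 4 * (norm \<alpha>)\<^sup>2)"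
      using x n0 Re by (intro mult_mono) auto
    then have "c * (b\<^sup>2 + 1) \<le> norm ((of_real b)\<^sup>2 + 4 * \<alpha>\<^sup>2)"
      using norm_ker_radicand_ge[of \<alpha> b] Re x by (simp add: c_def mult.assoc)
    moreover have "(1 + b)\<^sup>2 \<le> 2 * (b\<^sup>2 + 1)"
      using sum_squares_bound[of 1 b] by (simp add: power2_sum)
    then have "c / 2 * (1 + b)\<^sup>2 \<le> c / 2 * (2 * (b\<^sup>2 + 1))" using c by (intro mult_left_mono) auto
    moreover have "(norm (ker_root \<alpha> b))\<^sup>2 = norm ((of_real b)\<^sup>2 + 4 * \<alpha>\<^sup>2)"
      by (simp only: ker_root_square flip: norm_power)
    moreover have "c / 2 * (2 * (b\<^sup>2 + 1)) = c * (b\<^sup>2 + 1)" by simp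
    ultimately have "c / 2 * (1 + b)\<^sup>2 \<le> (norm (ker_root \<alpha> b))\<^sup>2"
      by linarith
    then have "(sqrt (c / 2) * (1 + b))\<^sup>2 \<le> (norm (ker_root \<alpha> b))\<^sup>2"
      using c by (simp add: power_mult_distrib)
    then show ?thesis by (rule power2_le_imp_le) simp
  qed
  then show ?thesis using that[of "sqrt (c / 2)"] c by simp
qed

lemma ker_root_has_field_derivative:
  assumes "Re \<alpha> > 0"
  shows "((\<lambda>\<alpha>. ker_root \<alpha> b) has_field_derivative 4 * \<alpha> / ker_root \<alpha> b) (at \<alpha>)"
proof -
  have "((\<lambda>\<alpha>. (of_real b)\<^sup>2 + 4 * \<alpha>\<^sup>2) has_field_derivative 8 * \<alpha>) (at \<alpha>)"
    by (auto intro!: derivative_eq_intros)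
  from has_field_derivative_csqrt'[OF this ker_radicand_not_nonpos[OF assms]] show ?thesis
    by (simp add: ker_root_def)
qed

lemma ker_root_has_vector_derivative:
  assumes "Re \<alpha> > 0"
  shows "(ker_root \<alpha> has_vector_derivative of_real b / ker_root \<alpha> b) (at b)"
proof -
  have "((\<lambda>z. csqrt (z\<^sup>2 + 4 * \<alpha>\<^sup>2)) has_field_derivative of_real b / ker_root \<alpha> b) (at (of_real b))"
  proof -
    have "((\<lambda>z. z\<^sup>2 + 4 * \<alpha>\<^sup>2) has_field_derivative 2 * of_real b) (at (of_real b))"
      by (auto intro!: derivative_eq_intros)
    from has_field_derivative_csqrt'[OF this ker_radicand_not_nonpos[OF assms]] show ?thesis
      by (simp add: ker_root_def)
  qed
  from has_vector_derivative_real_field[OF this] show ?thesis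
    by (simp add: ker_root_def [abs_def])
qed

lemma ker_root_continuous:
  assumes "Re \<alpha> > 0"
  shows "continuous_on A (ker_root \<alpha>)"
proof (rule continuous_at_imp_continuous_on, rule ballI)
  show "isCont (ker_root \<alpha>) b" for b
    using ker_root_has_vector_derivative[OF assms] by (rule has_vector_derivative_continuous)
qed

lemma has_field_derivative_inverse_power:
  fixes f :: "'a :: real_normed_field \<Rightarrow> 'a"
  assumes "(f has_field_derivative f') (at x)" "f x \<noteq> 0"
  shows "((\<lambda>x. c / f x ^ Suc m) has_field_derivative - (of_nat (Suc m) * c * f' / f x ^ Suc (Suc m))) (at x)"
  by (rule DERIV_cong[OF DERIV_divide[OF DERIV_const DERIV_power_Suc[OF assms(1)]]])
     (use assms(2) in \<open>auto simp: divide_simps\<close>)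

text \<open>The case n = 0 is the integral of interest after scaling. The odd powers are kept
  because differentiation in \<alpha> sends index n to a multiple of \<alpha> times index n + 1, so
  all derivatives stay in the family.\<close>

definition bessel_G :: "nat \<Rightarrow> complex \<Rightarrow> complex \<Rightarrow> complex" where
  "bessel_G n \<nu> \<alpha> = integral {0<..} (\<lambda>b. bessel_cyl (- 1) \<nu> (of_real b) / ker_root \<alpha> b ^ (2 * n + 1))"

lemma bessel_G_integrand_dominated:
  assumes "Re \<alpha>0 > 0"
  obtains M where "M > 0" "\<And>\<nu> \<alpha> b. norm \<nu> \<le> R \<Longrightarrow> \<sigma> \<le> Re \<nu> \<Longrightarrow> \<alpha> \<in> ball \<alpha>0 (Re \<alpha>0 / 2) \<Longrightarrow> 0 < b \<Longrightarrow>
    norm (bessel_cyl (- 1) \<nu> (of_real b) / ker_root \<alpha> b ^ (2 * n + 1)) \<le> M * bessel_dom \<sigma> b"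
proof -
  obtain M where M: "M > 0" "\<And>\<nu> b. norm \<nu> \<le> R \<Longrightarrow> \<sigma> \<le> Re \<nu> \<Longrightarrow> 0 < b \<Longrightarrow>
    norm (bessel_cyl (- 1) \<nu> (of_real b)) / (1 + b) \<le> M * bessel_dom \<sigma> b"
    using bessel_J_dominated by blast
  obtain c where c: "c > 0"
    "\<And>\<alpha> b. \<alpha> \<in> ball \<alpha>0 (Re \<alpha>0 / 2) \<Longrightarrow> 0 < b \<Longrightarrow> c * (1 + b) \<le> norm (ker_root \<alpha> b)"
    using ker_root_lower_bound[OF assms] by blast
  have "norm (bessel_cyl (- 1) \<nu> (of_real b) / ker_root \<alpha> b ^ (2 * n + 1)) \<le>
      (M / c ^ (2 * n + 1)) * bessel_dom \<sigma> b"
    if \<nu>: "norm \<nu> \<le> R" "\<sigma> \<le> Re \<nu>" and \<alpha>: "\<alpha> \<in> ball \<alpha>0 (Re \<alpha>0 / 2)" and b: "0 < b" for \<nu> \<alpha> b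
  proof -
    \<comment> \<open>As 1 + b is at least 1, the higher power is weakened to the first, so that one
      majorant serves every \<open>n\<close>.\<close>
    have "c ^ (2 * n + 1) * (1 + b) \<le> c ^ (2 * n + 1) * (1 + b) ^ (2 * n + 1)"
      using b c(1) power_increasing[of 1 "2 * n + 1" "1 + b"] by (intro mult_left_mono) auto
    also have "\<dots> \<le> norm (ker_root \<alpha> b) ^ (2 * n + 1)"
      using power_mono[OF c(2)[OF \<alpha> b], of "2 * n + 1"] b c(1) by (simp only: power_mult_distrib) simp
    finally have k: "c ^ (2 * n + 1) * (1 + b) \<le> norm (ker_root \<alpha> b) ^ (2 * n + 1)" .
    have pos: "0 < c ^ (2 * n + 1) * (1 + b)" using c(1) b by simp
    have "norm (bessel_cyl (- 1) \<nu> (of_real b) / ker_root \<alpha> b ^ (2 * n + 1)) \<le>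
        norm (bessel_cyl (- 1) \<nu> (of_real b)) / (c ^ (2 * n + 1) * (1 + b))"
      unfolding norm_divide norm_power
      by (rule divide_left_mono[OF k norm_ge_zero mult_pos_pos[OF less_le_trans[OF pos k] pos]])
    also have "\<dots> = norm (bessel_cyl (- 1) \<nu> (of_real b)) / (1 + b) / c ^ (2 * n + 1)"
      by (simp add: mult.commute)
    also have "\<dots> \<le> M * bessel_dom \<sigma> b / c ^ (2 * n + 1)"
      using M(2)[OF \<nu> b] c(1) by (intro divide_right_mono) auto
    finally show ?thesis by simp
  qed
  then show ?thesis using that[of "M / c ^ (2 * n + 1)"] M(1) c(1) by simp
qed

lemma bessel_G_integrand_continuous:
  assumes "Re \<alpha> > 0"
  shows "continuous_on {0<..} (\<lambda>b. bessel_cyl (- 1) \<nu> (of_real b) / ker_root \<alpha> b ^ (2 * n + 1))"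
proof (rule continuous_on_divide)
  show "continuous_on {0<..} (\<lambda>b. ker_root \<alpha> b ^ (2 * n + 1))"
    using ker_root_continuous[OF assms] by (rule continuous_on_power)
qed (use ker_root_nonzero[OF assms] in \<open>auto intro: continuous_on_bessel_J\<close>)

lemma bessel_G_absolutely_integrable:
  assumes "Re \<nu> > - 1" "Re \<alpha> > 0"
  shows "(\<lambda>b. bessel_cyl (- 1) \<nu> (of_real b) / ker_root \<alpha> b ^ (2 * n + 1)) absolutely_integrable_on {0<..}"
proof -
  obtain M where "M > 0" and M: "\<And>\<nu>' \<alpha>' b. norm \<nu>' \<le> norm \<nu> \<Longrightarrow> Re \<nu> \<le> Re \<nu>' \<Longrightarrow> \<alpha>' \<in> ball \<alpha> (Re \<alpha> / 2) \<Longrightarrow> 0 < b \<Longrightarrow>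
    norm (bessel_cyl (- 1) \<nu>' (of_real b) / ker_root \<alpha>' b ^ (2 * n + 1)) \<le> M * bessel_dom (Re \<nu>) b"
    using bessel_G_integrand_dominated[OF assms(2), of "norm \<nu>" "Re \<nu>" n] by blast
  show ?thesis
    using bessel_G_integrand_continuous[OF assms(2)]
      integrable_on_mult_right[OF bessel_dom_integrable[OF assms(1)], of M]
    by (rule absolutely_integrable_continuous_bounded) (rule M, use assms in auto)
qed

lemma bessel_G_has_field_derivative:
  assumes "Re \<nu> > - 1" "Re \<alpha> > 0"
  shows "(bessel_G n \<nu> has_field_derivative - (4 * of_nat (2 * n + 1) * \<alpha> * bessel_G (Suc n) \<nu> \<alpha>)) (at \<alpha>)"
proof -
  obtain M where "M > 0" and M: "\<And>\<nu>' \<alpha>' b. norm \<nu>' \<le> norm \<nu> \<Longrightarrow> Re \<nu> \<le> Re \<nu>' \<Longrightarrow> \<alpha>' \<in> ball \<alpha> (Re \<alpha> / 2) \<Longrightarrow> 0 < b \<Longrightarrow>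
    norm (bessel_cyl (- 1) \<nu>' (of_real b) / ker_root \<alpha>' b ^ (2 * n + 1)) \<le> M * bessel_dom (Re \<nu>) b"
    using bessel_G_integrand_dominated[OF assms(2), of "norm \<nu>" "Re \<nu>" n] by blast
  have Re: "Re w > 0" if "w \<in> ball \<alpha> (Re \<alpha> / 2)" for w
    using that abs_Re_le_cmod[of "\<alpha> - w"] assms(2) by (auto simp: dist_norm)
  define f' where "f' w b = - (4 * of_nat (2 * n + 1) * w) *
      (bessel_cyl (- 1) \<nu> (of_real b) / ker_root w b ^ (2 * Suc n + 1))" for w b
  have "(bessel_G n \<nu> has_field_derivative integral {0<..} (f' \<alpha>)) (at \<alpha>)"
    unfolding bessel_G_def [abs_def]
  proof (rule has_field_derivative_integral_dominated[where r = "Re \<alpha> / 2" and g = "\<lambda>b. M * bessel_dom (Re \<nu>) b"])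
    show "((\<lambda>w. bessel_cyl (- 1) \<nu> (of_real b) / ker_root w b ^ (2 * n + 1)) has_field_derivative f' w b) (at w)"
      if w: "w \<in> ball \<alpha> (Re \<alpha> / 2)" and b: "b > 0" for w b
    proof -
      have nz: "ker_root w b \<noteq> 0" using ker_root_nonzero[OF Re[OF w]] .
      show ?thesis
        unfolding Suc_eq_plus1 [symmetric]
        by (rule DERIV_cong[OF has_field_derivative_inverse_power[OF ker_root_has_field_derivative[OF Re[OF w]] nz]])
           (use nz in \<open>simp add: f'_def\<close>)
    qed
    show "continuous_on {0<..} (\<lambda>b. bessel_cyl (- 1) \<nu> (of_real b) / ker_root w b ^ (2 * n + 1))"
      if "w \<in> ball \<alpha> (Re \<alpha> / 2)" for w
      using bessel_G_integrand_continuous[OF Re[OF that]] .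
    show "(\<lambda>b. M * bessel_dom (Re \<nu>) b) integrable_on {0<..}"
      by (intro integrable_on_mult_right bessel_dom_integrable assms)
    show "norm (bessel_cyl (- 1) \<nu> (of_real b) / ker_root w b ^ (2 * n + 1)) \<le> M * bessel_dom (Re \<nu>) b"
      if "w \<in> ball \<alpha> (Re \<alpha> / 2)" "b > 0" for w b
      using M that by simp
  qed (use assms in auto)
  also have "integral {0<..} (f' \<alpha>) = - (4 * of_nat (2 * n + 1) * \<alpha> * bessel_G (Suc n) \<nu> \<alpha>)"
    unfolding f'_def bessel_G_def by (subst integral_mult_right) simp
  finally show ?thesis .
qed

lemma bessel_G_order_holomorphic:
  assumes "Re \<alpha> > 0"
  shows "(\<lambda>\<nu>. bessel_G n \<nu> \<alpha>) holomorphic_on {\<nu>. Re \<nu> > - 1}"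
proof -
  have "\<exists>D. ((\<lambda>\<nu>. bessel_G n \<nu> \<alpha>) has_field_derivative D) (at \<nu>)" if \<nu>: "Re \<nu> > - 1" for \<nu>
  proof -
    \<comment> \<open>Half the distance to the line Re = -1: the disc around \<nu> stays in Re at
      least \<sigma> with \<sigma> > -1, where one integrable majorant works.\<close>
    define r where "r = (Re \<nu> + 1) / 2"
    define \<sigma> where "\<sigma> = Re \<nu> - r"
    have r: "r > 0" "\<sigma> > - 1" using \<nu> by (auto simp: r_def \<sigma>_def field_simps)
    obtain M where "M > 0" and M: "\<And>\<nu>' \<alpha>' b. norm \<nu>' \<le> norm \<nu> + r \<Longrightarrow> \<sigma> \<le> Re \<nu>' \<Longrightarrow> \<alpha>' \<in> ball \<alpha> (Re \<alpha> / 2) \<Longrightarrow> 0 < b \<Longrightarrow>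
      norm (bessel_cyl (- 1) \<nu>' (of_real b) / ker_root \<alpha>' b ^ (2 * n + 1)) \<le> M * bessel_dom \<sigma> b"
      using bessel_G_integrand_dominated[OF assms, of "norm \<nu> + r" \<sigma> n] by blast
    have "((\<lambda>\<nu>. bessel_G n \<nu> \<alpha>) has_field_derivative integral {0<..}
        (\<lambda>b. deriv (\<lambda>\<nu>. bessel_cyl (- 1) \<nu> (of_real b)) \<nu> / ker_root \<alpha> b ^ (2 * n + 1))) (at \<nu>)"
      unfolding bessel_G_def
    proof (rule has_field_derivative_integral_dominated[where r = r and g = "\<lambda>b. M * bessel_dom \<sigma> b"])
      show "((\<lambda>\<nu>. bessel_cyl (- 1) \<nu> (of_real b) / ker_root \<alpha> b ^ (2 * n + 1)) has_field_derivative
          deriv (\<lambda>\<nu>. bessel_cyl (- 1) \<nu> (of_real b)) w / ker_root \<alpha> b ^ (2 * n + 1)) (at w)"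
        if "b > 0" for w b
      proof -
        have "(\<lambda>\<nu>. bessel_cyl (- 1) \<nu> (of_real b)) holomorphic_on UNIV"
          using that by (intro holomorphic_bessel_cyl_order) auto
        from DERIV_cdivide[OF holomorphic_derivI[OF this open_UNIV, of w]] show ?thesis by simp
      qed
      show "continuous_on {0<..} (\<lambda>b. bessel_cyl (- 1) w (of_real b) / ker_root \<alpha> b ^ (2 * n + 1))" for w
        using bessel_G_integrand_continuous[OF assms] .
      show "(\<lambda>b. M * bessel_dom \<sigma> b) integrable_on {0<..}"
        by (intro integrable_on_mult_right bessel_dom_integrable r)
      show "norm (bessel_cyl (- 1) w (of_real b) / ker_root \<alpha> b ^ (2 * n + 1)) \<le> M * bessel_dom \<sigma> b"
        if "w \<in> ball \<nu> r" "b > 0" for w b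
      proof (rule M)
        show "norm w \<le> norm \<nu> + r"
          using that norm_triangle_ineq2[of w \<nu>] by (simp add: dist_norm norm_minus_commute)
        show "\<sigma> \<le> Re w"
          using that abs_Re_le_cmod[of "\<nu> - w"] by (simp add: dist_norm \<sigma>_def)
      qed (use that assms in auto)
    qed (use r in auto)
    then show ?thesis by blast
  qed
  moreover have "open {\<nu>. Re \<nu> > - 1}" by (rule open_halfspace_Re_gt)
  ultimately show ?thesis by (auto simp: holomorphic_on_open)
qed

subsection \<open>The differential equation of the integral\<close>

text \<open>Up to a constant, this product majorises the boundary term in the integration by parts
  behind the differential equation.\<close>

lemma bessel_dom_mult_tendsto_0:
  assumes "\<sigma> > - 1"
  shows "((\<lambda>b. bessel_dom \<sigma> b * (b / (1 + b))) \<longlongrightarrow> 0) (at_right 0)"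
    and "((\<lambda>b. bessel_dom \<sigma> b * (b / (1 + b))) \<longlongrightarrow> 0) at_top"
proof -
  show "((\<lambda>b. bessel_dom \<sigma> b * (b / (1 + b))) \<longlongrightarrow> 0) (at_right 0)"
  proof (rule Lim_null_comparison)
    have "\<forall>\<^sub>F b in at_right 0. b > 0 \<and> b < (1 :: real)"
      by (rule eventually_at_right_real [THEN eventually_mono]) auto
    then show "\<forall>\<^sub>F b in at_right 0. norm (bessel_dom \<sigma> b * (b / (1 + b))) \<le> b powr (\<sigma> + 1)"
    proof eventually_elim
      case (elim b)
      have "bessel_dom \<sigma> b * (b / (1 + b)) \<le> bessel_dom \<sigma> b * (b / 1)"
        using elim by (intro mult_left_mono divide_left_mono) auto
      also have "\<dots> = b powr (\<sigma> + 1)"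
        using elim by (simp add: bessel_dom_def powr_add)
      finally show ?case using elim by simp
    qed
    show "((\<lambda>b. b powr (\<sigma> + 1)) \<longlongrightarrow> 0) (at_right 0)"
    proof (rule tendsto_zero_powrI)
      show "\<forall>\<^sub>F x in at_right 0. 0 \<le> (x :: real)"
        by (rule eventually_at_right_less [THEN eventually_mono]) auto
    qed (use assms in \<open>auto intro!: tendsto_eq_intros\<close>)
  qed
  show "((\<lambda>b. bessel_dom \<sigma> b * (b / (1 + b))) \<longlongrightarrow> 0) at_top"
  proof (rule Lim_null_comparison)
    show "\<forall>\<^sub>F b in at_top. norm (bessel_dom \<sigma> b * (b / (1 + b))) \<le> b powr (- 3 / 2)"
      using eventually_gt_at_top[of 1]
    proof eventually_elim
      case (elim b)
      have "bessel_dom \<sigma> b * (b / (1 + b)) \<le> bessel_dom \<sigma> b * 1"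
        using elim by (intro mult_left_mono) auto
      then show ?case using elim by (simp add: bessel_dom_def)
    qed
    show "((\<lambda>b :: real. b powr (- 3 / 2)) \<longlongrightarrow> 0) at_top"
      by (rule tendsto_neg_powr) (auto intro: filterlim_ident)
  qed
qed

lemma has_vector_derivative_power_of_inverse_root:
  assumes "Re \<alpha> > 0"
  shows "((\<lambda>b. inverse (ker_root \<alpha> b) ^ m) has_vector_derivative
      - (of_nat m * of_real b * inverse (ker_root \<alpha> b) ^ (m + 2))) (at b)"
proof (cases m)
  case (Suc k)
  have nz: "ker_root \<alpha> b \<noteq> 0" using ker_root_nonzero[OF assms] .
  have "((\<lambda>z. 1 / z ^ Suc k) has_field_derivative - (of_nat (Suc k) * 1 * 1 / ker_root \<alpha> b ^ Suc (Suc k)))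
      (at (ker_root \<alpha> b))"
    using nz by (intro has_field_derivative_inverse_power) auto
  note D = field_vector_diff_chain_at[OF ker_root_has_vector_derivative[OF assms] this, unfolded o_def]
  have "(\<lambda>b. 1 / ker_root \<alpha> b ^ Suc k) = (\<lambda>b. inverse (ker_root \<alpha> b) ^ m)"
    unfolding Suc by (simp add: power_inverse divide_inverse)
  moreover have "of_real b / ker_root \<alpha> b * - (of_nat (Suc k) * 1 * 1 / ker_root \<alpha> b ^ Suc (Suc k)) =
      - (of_nat m * of_real b * inverse (ker_root \<alpha> b) ^ (m + 2))"
    unfolding Suc using nz by (simp add: power_inverse field_simps)
  ultimately show ?thesis using D by simp
qed auto

text \<open>The equation \<theta>(\<theta>^2 - \<nu>^2)G = 4\<alpha>^2(\<theta> + 1)G divided by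
  4\<alpha>^2, with the derivatives of G expressed through the higher indices by \<theta>G_n = -4(2n
  + 1)\<alpha>^2 G_(n+1).\<close>

lemma bessel_G_ode:
  assumes \<nu>: "Re \<nu> > - 1" and \<alpha>: "Re \<alpha> > 0"
  shows "bessel_G 0 \<nu> \<alpha> + (4 - \<nu>\<^sup>2 - 4 * \<alpha>\<^sup>2) * bessel_G 1 \<nu> \<alpha> - 72 * \<alpha>\<^sup>2 * bessel_G 2 \<nu> \<alpha>
      + 240 * \<alpha> ^ 4 * bessel_G 3 \<nu> \<alpha> = 0"
proof -
  define A where "A = 4 * \<alpha>\<^sup>2"
  define t where "t b = inverse (ker_root \<alpha> b)" for b
  define J where "J b = bessel_cyl (- 1) \<nu> (of_real b)" for b
  define K where "K b = bessel_cyl (- 1) (\<nu> + 1) (of_real b)" for b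
  \<comment> \<open>Up to sign, the boundary term of Lagrange's identity for Bessel's operator b^2
    D^2 + b D + b^2 - \<nu>^2 tested against t^3, with J' replaced through K and b^2 t^2 by 1 - A
    t^2. The integrand \<open>R\<close> is J times the adjoint operator applied to t^3.\<close>
  define P where "P b = J b * (of_real b * (3 * A * t b ^ 5 - (2 + \<nu>) * t b ^ 3)) +
      K b * (of_real b * of_real b * t b ^ 3)" for b
  define R where "R b = J b * t b + (4 - \<nu>\<^sup>2 - A) * (J b * t b ^ 3) - 18 * A * (J b * t b ^ 5)
      + 15 * A\<^sup>2 * (J b * t b ^ 7)" for b
  have tm: "((\<lambda>b. t b ^ m) has_vector_derivative - (of_nat m * of_real b * t b ^ (m + 2))) (at b)" for m b
    unfolding t_def by (rule has_vector_derivative_power_of_inverse_root[OF \<alpha>])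
  have bd: "((\<lambda>b. complex_of_real b) has_vector_derivative 1) (at b)" for b
    using has_vector_derivative_of_real[OF DERIV_ident] by simp
  have der: "(P has_vector_derivative R b) (at b)" if b: "b > 0" for b
  proof -
    define D1 D2 where "D1 = \<nu> / of_real b * J b - K b" and "D2 = J b - (\<nu> + 1) / of_real b * K b"
    have J': "(J has_vector_derivative D1) (at b)" "(K has_vector_derivative D2) (at b)"
      unfolding J_def [abs_def] K_def [abs_def] D1_def D2_def
      using has_vector_derivative_bessel_J[OF b, of \<nu>] by simp_all
    \<comment> \<open>The derivative formulas are cleared of division by b, so that the identity for
      P' is a polynomial consequence of \<open>e1\<close>, \<open>e2\<close> and
      \<open>e3\<close>.\<close>
    have e1: "of_real b * D1 = \<nu> * J b - of_real b * K b"
      and e2: "of_real b * D2 = of_real b * J b - (\<nu> + 1) * K b"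
      using b by (simp_all add: D1_def D2_def field_simps)
    have e3: "A * (t b)\<^sup>2 = 1 - (of_real b)\<^sup>2 * (t b)\<^sup>2"
    proof -
      have "ker_root \<alpha> b \<noteq> 0" using ker_root_nonzero[OF \<alpha>] .
      then have "(ker_root \<alpha> b)\<^sup>2 * (t b)\<^sup>2 = 1" by (simp add: t_def flip: power_mult_distrib)
      then show ?thesis unfolding ker_root_square A_def by (simp add: algebra_simps)
    qed
    have "(P has_vector_derivative
        (J b * (of_real b * (3 * A * - (of_nat 5 * of_real b * t b ^ (5 + 2)) -
            (2 + \<nu>) * - (of_nat 3 * of_real b * t b ^ (3 + 2))) + 1 * (3 * A * t b ^ 5 - (2 + \<nu>) * t b ^ 3)) +
          D1 * (of_real b * (3 * A * t b ^ 5 - (2 + \<nu>) * t b ^ 3))) +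
        (K b * (of_real b * of_real b * - (of_nat 3 * of_real b * t b ^ (3 + 2)) +
            (of_real b * 1 + 1 * of_real b) * t b ^ 3) +
          D2 * (of_real b * of_real b * t b ^ 3))) (at b)"
      unfolding P_def [abs_def]
      by (intro has_vector_derivative_add has_vector_derivative_diff has_vector_derivative_mult J' bd tm
            has_vector_derivative_mult_right)
    moreover have "(J b * (of_real b * (3 * A * - (of_nat 5 * of_real b * t b ^ (5 + 2)) -
            (2 + \<nu>) * - (of_nat 3 * of_real b * t b ^ (3 + 2))) + 1 * (3 * A * t b ^ 5 - (2 + \<nu>) * t b ^ 3)) +
          D1 * (of_real b * (3 * A * t b ^ 5 - (2 + \<nu>) * t b ^ 3))) +
        (K b * (of_real b * of_real b * - (of_nat 3 * of_real b * t b ^ (3 + 2)) +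
            (of_real b * 1 + 1 * of_real b) * t b ^ 3) +
          D2 * (of_real b * of_real b * t b ^ 3)) = R b"
    proof -
      define x where "x = complex_of_real b"
      have "t b ^ 3 = t b * (t b)\<^sup>2" "t b ^ 5 = t b * (t b)\<^sup>2 * (t b)\<^sup>2" "t b ^ 7 = t b * (t b)\<^sup>2 * (t b)\<^sup>2 * (t b)\<^sup>2"
        by (simp_all add: power_numeral_reduce)
      show ?thesis
        using e1 e2 e3 unfolding R_def x_def [symmetric] by simp algebra
    qed
    ultimately show ?thesis by simp
  qed
  have conv: "J b * t b ^ (2 * n + 1) = bessel_cyl (- 1) \<nu> (of_real b) / ker_root \<alpha> b ^ (2 * n + 1)" for b n
    by (simp add: J_def t_def divide_inverse power_inverse)
  have int: "(\<lambda>b. J b * t b ^ (2 * n + 1)) absolutely_integrable_on {0<..}"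
    and G: "integral {0<..} (\<lambda>b. J b * t b ^ (2 * n + 1)) = bessel_G n \<nu> \<alpha>" for n
    unfolding conv bessel_G_def using bessel_G_absolutely_integrable[OF \<nu> \<alpha>] by auto
  note int0 = int[of 0, simplified] and int1 = int[of 1, simplified]
    and int2 = int[of 2, simplified] and int3 = int[of 3, simplified]
  note G0 = G[of 0, simplified] and G1 = G[of 1, simplified] and G2 = G[of 2, simplified] and G3 = G[of 3, simplified]
  have intR: "R absolutely_integrable_on {0<..}"
    unfolding R_def [abs_def]
    by (intro set_integral_add(1) set_integral_diff(1) set_integrable_mult_right int0 int1 int2 int3)
  have lim: "(P \<longlongrightarrow> 0) (at_right 0)" "(P \<longlongrightarrow> 0) at_top"
  proof -
    obtain M where M: "M > 0" "\<And>\<nu>' b. norm \<nu>' \<le> norm \<nu> + 1 \<Longrightarrow> Re \<nu> \<le> Re \<nu>' \<Longrightarrow> 0 < b \<Longrightarrow>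
      norm (bessel_cyl (- 1) \<nu>' (of_real b)) / (1 + b) \<le> M * bessel_dom (Re \<nu>) b"
      using bessel_J_dominated[of "norm \<nu> + 1" "Re \<nu>"] by blast
    obtain c where c: "c > 0"
      "\<And>\<alpha>' b. \<alpha>' \<in> ball \<alpha> (Re \<alpha> / 2) \<Longrightarrow> 0 < b \<Longrightarrow> c * (1 + b) \<le> norm (ker_root \<alpha>' b)"
      using ker_root_lower_bound[OF \<alpha>] by blast
    define C where "C = norm (3 * A) / c ^ 5 + norm (2 + \<nu>) / c ^ 3 + 1 / c ^ 3"
    have bound: "norm (P b) \<le> (C * M) * (bessel_dom (Re \<nu>) b * (b / (1 + b)))" if b: "b > 0" for b
    proof -
      define N where "N = M * bessel_dom (Re \<nu>) b * (1 + b)"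
      have "N \<ge> 0" using M(1) b by (simp add: N_def)
      have JN: "norm (J b) \<le> N"
        using M(2)[of \<nu> b] b by (simp add: N_def J_def pos_divide_le_eq)
      have KN: "norm (K b) \<le> N"
        using M(2)[of "\<nu> + 1" b] b norm_triangle_ineq[of \<nu> 1] by (simp add: N_def K_def pos_divide_le_eq)
      have t1: "norm (t b) \<le> 1 / (c * (1 + b))"
        unfolding t_def norm_inverse unfolding inverse_eq_divide
        by (rule divide_left_mono) (use c b \<alpha> ker_root_nonzero[OF \<alpha>, of b] in auto)
      have t3: "norm (t b ^ 3) \<le> 1 / c ^ 3 * (1 / (1 + b) ^ 3)"
        using power_mono[OF t1 norm_ge_zero, of 3] by (simp add: norm_power power_divide power_mult_distrib)
      \<comment> \<open>The fifth power is weakened to the third so that all parts of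
        \<open>P\<close> share one decay rate.\<close>
      have t5: "norm (t b ^ 5) \<le> 1 / c ^ 5 * (1 / (1 + b) ^ 3)"
      proof -
        have "norm (t b ^ 5) \<le> 1 / c ^ 5 * (1 / (1 + b) ^ 5)"
          using power_mono[OF t1 norm_ge_zero, of 5] by (simp add: norm_power power_divide power_mult_distrib)
        also have "\<dots> \<le> 1 / c ^ 5 * (1 / (1 + b) ^ 3)"
          using b c(1) by (intro mult_left_mono divide_left_mono power_increasing) auto
        finally show ?thesis .
      qed
      have "norm (P b) \<le> N * (b * (norm (3 * A) * (1 / c ^ 5 * (1 / (1 + b) ^ 3)) +
          norm (2 + \<nu>) * (1 / c ^ 3 * (1 / (1 + b) ^ 3)))) + N * (b * (1 + b) * (1 / c ^ 3 * (1 / (1 + b) ^ 3)))"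
      proof -
        have "norm (3 * A * t b ^ 5 - (2 + \<nu>) * t b ^ 3) \<le> norm (3 * A) * (1 / c ^ 5 * (1 / (1 + b) ^ 3)) +
          norm (2 + \<nu>) * (1 / c ^ 3 * (1 / (1 + b) ^ 3))"
          using norm_triangle_ineq4[of "3 * A * t b ^ 5" "(2 + \<nu>) * t b ^ 3"]
            mult_left_mono[OF t5, of "norm (3 * A)"] mult_left_mono[OF t3, of "norm (2 + \<nu>)"]
          unfolding norm_mult [of "3 * A" "t b ^ 5"] norm_mult [of "2 + \<nu>" "t b ^ 3"] by simp
        then have 1: "norm (J b * (of_real b * (3 * A * t b ^ 5 - (2 + \<nu>) * t b ^ 3))) \<le>
            N * (b * (norm (3 * A) * (1 / c ^ 5 * (1 / (1 + b) ^ 3)) + norm (2 + \<nu>) * (1 / c ^ 3 * (1 / (1 + b) ^ 3))))"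
          unfolding norm_mult [of "J b"] norm_mult [of "of_real b"]
          using JN b \<open>N \<ge> 0\<close> by (intro mult_mono) auto
        have 2: "norm (K b * (of_real b * of_real b * t b ^ 3)) \<le> N * (b * (1 + b) * (1 / c ^ 3 * (1 / (1 + b) ^ 3)))"
          unfolding norm_mult [of "K b"] norm_mult [of "of_real b * of_real b"] norm_mult [of "of_real b" "of_real b"]
          using KN b \<open>N \<ge> 0\<close> t3 by (intro mult_mono) auto
        show ?thesis unfolding P_def using 1 2 norm_triangle_le add_mono by blast
      qed
      also have "\<dots> \<le> N * (b * (1 + b) * (norm (3 * A) * (1 / c ^ 5 * (1 / (1 + b) ^ 3)) +
          norm (2 + \<nu>) * (1 / c ^ 3 * (1 / (1 + b) ^ 3)))) + N * (b * (1 + b) * (1 / c ^ 3 * (1 / (1 + b) ^ 3)))"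
        using \<open>N \<ge> 0\<close> b c(1) by (intro add_mono mult_left_mono mult_right_mono) auto
      also have "\<dots> = N * (b * (1 + b)) * C * (1 / (1 + b) ^ 3)"
        by (simp only: C_def divide_inverse algebra_simps mult_1_left)
      also have "\<dots> = (C * M) * (bessel_dom (Re \<nu>) b * (b / (1 + b)))"
        using b by (simp add: N_def power3_eq_cube divide_simps)
      finally show ?thesis .
    qed
    have *: "(P \<longlongrightarrow> 0) F"
      if "((\<lambda>b. bessel_dom (Re \<nu>) b * (b / (1 + b))) \<longlongrightarrow> 0) F" "\<forall>\<^sub>F b in F. b > 0" for F
    proof (rule Lim_null_comparison)
      show "\<forall>\<^sub>F b in F. norm (P b) \<le> (C * M) * (bessel_dom (Re \<nu>) b * (b / (1 + b)))"
        using that(2) by eventually_elim (rule bound)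
      show "((\<lambda>b. (C * M) * (bessel_dom (Re \<nu>) b * (b / (1 + b)))) \<longlongrightarrow> 0) F"
        using tendsto_mult_left[OF that(1), of "C * M"] by simp
    qed
    show "(P \<longlongrightarrow> 0) (at_right 0)"
      by (rule *[OF bessel_dom_mult_tendsto_0(1)[OF \<nu>] eventually_at_right_less])
    show "(P \<longlongrightarrow> 0) at_top"
      by (rule *[OF bessel_dom_mult_tendsto_0(2)[OF \<nu>] eventually_gt_at_top])
  qed
  have "integral {0<..} R = 0 - 0"
    by (rule integral_FTC_positive_reals[OF der intR lim])
  moreover have "integral {0<..} R = bessel_G 0 \<nu> \<alpha> + (4 - \<nu>\<^sup>2 - A) * bessel_G 1 \<nu> \<alpha> - 18 * A * bessel_G 2 \<nu> \<alpha>
      + 15 * A\<^sup>2 * bessel_G 3 \<nu> \<alpha>"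
    unfolding R_def [abs_def]
    using int0 int1 int2 int3
    by (simp add: integral_add integral_diff integrable_add integrable_diff integrable_on_mult_right
        set_lebesgue_integral_eq_integral(1) G0 G1 G2 G3)
  ultimately show ?thesis by (simp add: A_def power2_eq_square power4_eq_xxxx algebra_simps)
qed

subsection \<open>The symmetric square of the modified Bessel equation\<close>

text \<open>
  The quantity below is \<open>g\<^sub>0 w'' - g\<^sub>1 w' + g\<^sub>2 w - 4(\<alpha>\<^sup>2 + m)g\<^sub>0 w\<close> for \<open>w = y\<^sub>a y\<^sub>b\<close>, the dash being
  \<open>\<alpha> d/d\<alpha>\<close>: the invariant bilinear form on solutions of the symmetric square equation.
\<close>

lemma symmetric_square_invariant:
  fixes g0 g1 g2 ya za yb zb :: "complex \<Rightarrow> complex"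
  assumes g0: "\<And>\<alpha>. Re \<alpha> > 0 \<Longrightarrow> (g0 has_field_derivative g1 \<alpha> / \<alpha>) (at \<alpha>)"
    and g1: "\<And>\<alpha>. Re \<alpha> > 0 \<Longrightarrow> (g1 has_field_derivative g2 \<alpha> / \<alpha>) (at \<alpha>)"
    and g2: "\<And>\<alpha>. Re \<alpha> > 0 \<Longrightarrow>
      (g2 has_field_derivative (4 * (\<alpha>\<^sup>2 + m) * g1 \<alpha> + 4 * \<alpha>\<^sup>2 * g0 \<alpha>) / \<alpha>) (at \<alpha>)"
    and ya: "\<And>\<alpha>. Re \<alpha> > 0 \<Longrightarrow> (ya has_field_derivative za \<alpha> / \<alpha>) (at \<alpha>)"
    and za: "\<And>\<alpha>. Re \<alpha> > 0 \<Longrightarrow> (za has_field_derivative (\<alpha>\<^sup>2 + m) * ya \<alpha> / \<alpha>) (at \<alpha>)"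
    and yb: "\<And>\<alpha>. Re \<alpha> > 0 \<Longrightarrow> (yb has_field_derivative zb \<alpha> / \<alpha>) (at \<alpha>)"
    and zb: "\<And>\<alpha>. Re \<alpha> > 0 \<Longrightarrow> (zb has_field_derivative (\<alpha>\<^sup>2 + m) * yb \<alpha> / \<alpha>) (at \<alpha>)"
  obtains c where "\<And>\<alpha>. Re \<alpha> > 0 \<Longrightarrow>
    g0 \<alpha> * (2 * (za \<alpha> * zb \<alpha>) - 2 * ((\<alpha>\<^sup>2 + m) * (ya \<alpha> * yb \<alpha>))) + g2 \<alpha> * (ya \<alpha> * yb \<alpha>)
      - g1 \<alpha> * (za \<alpha> * yb \<alpha> + ya \<alpha> * zb \<alpha>) = c"
proof -
  define F where "F \<alpha> = g0 \<alpha> * (2 * (za \<alpha> * zb \<alpha>) - 2 * ((\<alpha>\<^sup>2 + m) * (ya \<alpha> * yb \<alpha>))) + g2 \<alpha> * (ya \<alpha> * yb \<alpha>)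
      - g1 \<alpha> * (za \<alpha> * yb \<alpha> + ya \<alpha> * zb \<alpha>)" for \<alpha>
  have "(F has_field_derivative 0) (at \<alpha>)" if \<alpha>: "Re \<alpha> > 0" for \<alpha>
  proof -
    have nz: "\<alpha> \<noteq> 0" using \<alpha> by auto
    have p: "((\<lambda>\<alpha>. \<alpha>\<^sup>2 + m) has_field_derivative 2 * \<alpha>) (at \<alpha>)"
      by (auto intro!: derivative_eq_intros)
    note D = g0[OF \<alpha>] g1[OF \<alpha>] g2[OF \<alpha>] ya[OF \<alpha>] za[OF \<alpha>] yb[OF \<alpha>] zb[OF \<alpha>]
    show ?thesis
      unfolding F_def [abs_def]
      by (rule DERIV_cong, rule DERIV_diff DERIV_add, (rule D p DERIV_diff DERIV_add DERIV_cmult DERIV_mult)+)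
         (use nz in \<open>simp add: field_simps power2_eq_square\<close>)
  qed
  then have "\<exists>c. \<forall>x\<in>{\<alpha>. Re \<alpha> > 0}. F x = c"
    by (intro has_field_derivative_zero_constant convex_halfspace_Re_gt)
       (auto intro: has_field_derivative_at_within)
  then show ?thesis using that unfolding F_def by auto
qed

lemma wronskian_constant:
  fixes ya za yb zb :: "complex \<Rightarrow> complex"
  assumes ya: "\<And>\<alpha>. Re \<alpha> > 0 \<Longrightarrow> (ya has_field_derivative za \<alpha> / \<alpha>) (at \<alpha>)"
    and za: "\<And>\<alpha>. Re \<alpha> > 0 \<Longrightarrow> (za has_field_derivative (\<alpha>\<^sup>2 + m) * ya \<alpha> / \<alpha>) (at \<alpha>)"
    and yb: "\<And>\<alpha>. Re \<alpha> > 0 \<Longrightarrow> (yb has_field_derivative zb \<alpha> / \<alpha>) (at \<alpha>)"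
    and zb: "\<And>\<alpha>. Re \<alpha> > 0 \<Longrightarrow> (zb has_field_derivative (\<alpha>\<^sup>2 + m) * yb \<alpha> / \<alpha>) (at \<alpha>)"
  obtains W where "\<And>\<alpha>. Re \<alpha> > 0 \<Longrightarrow> ya \<alpha> * zb \<alpha> - za \<alpha> * yb \<alpha> = W"
proof -
  have "((\<lambda>\<alpha>. ya \<alpha> * zb \<alpha> - za \<alpha> * yb \<alpha>) has_field_derivative 0) (at \<alpha>)" if \<alpha>: "Re \<alpha> > 0" for \<alpha>
    by (rule DERIV_cong[OF DERIV_diff[OF DERIV_mult[OF ya[OF \<alpha>] zb[OF \<alpha>]] DERIV_mult[OF za[OF \<alpha>] yb[OF \<alpha>]]]])
       (simp add: divide_simps)
  then have "\<exists>c. \<forall>x\<in>{\<alpha>. Re \<alpha> > 0}. ya x * zb x - za x * yb x = c"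
    by (intro has_field_derivative_zero_constant convex_halfspace_Re_gt)
       (auto intro: has_field_derivative_at_within)
  then show ?thesis using that by auto
qed

text \<open>The Euler derivative \<open>\<alpha> dI\<^bsub>\<mu>\<^esub>/d\<alpha>\<close>.\<close>

definition bessel_I_theta :: "complex \<Rightarrow> complex \<Rightarrow> complex" where
  "bessel_I_theta \<mu> \<alpha> = \<mu> * bessel_cyl 1 \<mu> \<alpha> + \<alpha> * bessel_cyl 1 (\<mu> + 1) \<alpha>"

lemma bessel_I_theta_derivatives:
  assumes "Re \<alpha> > 0"
  shows "(bessel_cyl 1 \<mu> has_field_derivative bessel_I_theta \<mu> \<alpha> / \<alpha>) (at \<alpha>)"
    and "(bessel_I_theta \<mu> has_field_derivative (\<alpha>\<^sup>2 + \<mu>\<^sup>2) * bessel_cyl 1 \<mu> \<alpha> / \<alpha>) (at \<alpha>)"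
proof -
  have \<alpha>: "\<alpha> \<notin> \<real>\<^sub>\<le>\<^sub>0" "\<alpha> \<noteq> 0" using assms by (auto simp: complex_nonpos_Reals_iff)
  note D1 = has_field_derivative_bessel_cyl[OF \<alpha>(1), of 1 \<mu>]
  note D2 = has_field_derivative_bessel_cyl_plus_1[OF \<alpha>(1), of 1 \<mu>]
  show "(bessel_cyl 1 \<mu> has_field_derivative bessel_I_theta \<mu> \<alpha> / \<alpha>) (at \<alpha>)"
    by (rule DERIV_cong[OF D1]) (use \<alpha>(2) in \<open>simp add: bessel_I_theta_def field_simps\<close>)
  show "(bessel_I_theta \<mu> has_field_derivative (\<alpha>\<^sup>2 + \<mu>\<^sup>2) * bessel_cyl 1 \<mu> \<alpha> / \<alpha>) (at \<alpha>)"
    unfolding bessel_I_theta_def [abs_def]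
    by (rule DERIV_cong[OF DERIV_add[OF DERIV_cmult[OF D1] DERIV_mult[OF DERIV_ident D2]]])
       (use \<alpha>(2) in \<open>simp add: field_simps power2_eq_square\<close>)
qed

text \<open>The Wronskian with respect to \<theta> is constant, so its value is read off at the
  origin, where only the leading coefficients survive.\<close>

lemma bessel_I_wronskian:
  assumes "Re \<alpha> > 0"
  shows "bessel_cyl 1 \<mu> \<alpha> * bessel_I_theta (- \<mu>) \<alpha> - bessel_I_theta \<mu> \<alpha> * bessel_cyl 1 (- \<mu>) \<alpha> =
    - 2 * \<mu> * rGamma (\<mu> + 1) * rGamma (1 - \<mu>)"
proof -
  obtain W where W: "\<And>\<alpha>. Re \<alpha> > 0 \<Longrightarrow>
      bessel_cyl 1 \<mu> \<alpha> * bessel_I_theta (- \<mu>) \<alpha> - bessel_I_theta \<mu> \<alpha> * bessel_cyl 1 (- \<mu>) \<alpha> = W"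
    using wronskian_constant[of "bessel_cyl 1 \<mu>" "bessel_I_theta \<mu>" "\<mu>\<^sup>2" "bessel_cyl 1 (- \<mu>)" "bessel_I_theta (- \<mu>)"]
      bessel_I_theta_derivatives[of _ \<mu>] bessel_I_theta_derivatives[of _ "- \<mu>"]
    by (metis power2_minus)
  \<comment> \<open>The same Wronskian after the powers with exponents \<mu> and -\<mu> have
    cancelled. It is entire, so evaluation at 0, outside the half-plane, is legitimate by
    continuity.\<close>
  define V where "V \<alpha> = bessel_E \<mu> ((\<alpha> / 2)\<^sup>2) * (- \<mu> * bessel_E (- \<mu>) ((\<alpha> / 2)\<^sup>2) + \<alpha>\<^sup>2 / 2 * bessel_E (- \<mu> + 1) ((\<alpha> / 2)\<^sup>2)) -
      (\<mu> * bessel_E \<mu> ((\<alpha> / 2)\<^sup>2) + \<alpha>\<^sup>2 / 2 * bessel_E (\<mu> + 1) ((\<alpha> / 2)\<^sup>2)) * bessel_E (- \<mu>) ((\<alpha> / 2)\<^sup>2)" for \<alpha>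
  have VW: "V \<alpha> = W" if \<alpha>: "Re \<alpha> > 0" for \<alpha>
  proof -
    have nz: "\<alpha> \<noteq> 0" using \<alpha> by auto
    define u where "u = (\<alpha> / 2) powr \<mu>"
    have u: "u \<noteq> 0" "(\<alpha> / 2) powr (- \<mu>) = inverse u" using nz by (auto simp: u_def powr_minus)
    show ?thesis
      unfolding W[OF \<alpha>, symmetric] V_def bessel_I_theta_def bessel_cyl_def half_powr_plus_1[OF nz] u u_def [symmetric]
      using u(1) by (simp add: field_simps power2_eq_square)
  qed
  have "isCont V 0"
  proof -
    have "V holomorphic_on UNIV" unfolding V_def [abs_def] by (intro holomorphic_intros) auto
    then show ?thesis using holomorphic_on_imp_continuous_on continuous_on_eq_continuous_at open_UNIV by blast
  qed
  then have "((\<lambda>x. V (of_real x)) \<longlongrightarrow> V 0) (at_right 0)"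
    by (intro isCont_tendsto_compose[of 0 V]) (auto intro!: tendsto_eq_intros)
  moreover have "\<forall>\<^sub>F x in at_right 0. V (complex_of_real x) = W"
    by (rule eventually_mono[OF eventually_at_right_less]) (simp add: VW)
  then have "((\<lambda>x. V (complex_of_real x)) \<longlongrightarrow> W) (at_right 0)"
    by (rule tendsto_eventually)
  ultimately have "V 0 = W"
    using tendsto_unique trivial_limit_at_right_real by blast
  then show ?thesis using W[OF assms] by (simp add: V_def mult_ac)
qed

text \<open>The three invariants are linear in G and its first two Euler derivatives. One quadratic
  combination of them eliminates the derivatives and leaves 2W^2 G, where the Wronskian W is nonzero
  for noninteger \<mu>.\<close>

lemma bessel_G_representation:
  assumes \<mu>: "\<mu> \<notin> \<int>" "Re \<mu> > - 1 / 2"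
  obtains A B C where "\<And>\<alpha>. Re \<alpha> > 0 \<Longrightarrow> bessel_G 0 (2 * \<mu>) \<alpha> =
    A * (bessel_cyl 1 \<mu> \<alpha>)\<^sup>2 + B * (bessel_cyl 1 \<mu> \<alpha> * bessel_cyl 1 (- \<mu>) \<alpha>) + C * (bessel_cyl 1 (- \<mu>) \<alpha>)\<^sup>2"
proof -
  define \<nu> where "\<nu> = 2 * \<mu>"
  have \<nu>: "Re \<nu> > - 1" using \<mu> by (simp add: \<nu>_def)
  define W where "W = - 2 * \<mu> * rGamma (\<mu> + 1) * rGamma (1 - \<mu>)"
  have W: "W \<noteq> 0"
  proof -
    have "\<mu> + 1 \<notin> \<int>\<^sub>\<le>\<^sub>0" "1 - \<mu> \<notin> \<int>\<^sub>\<le>\<^sub>0" "\<mu> \<noteq> 0"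
      using \<mu>(1) nonpos_Ints_Int by (metis Ints_1 Ints_diff add_diff_cancel_right', metis Ints_1 Ints_diff diff_diff_eq2 add_diff_cancel_left', auto)
    then show ?thesis by (simp add: W_def rGamma_eq_zero_iff)
  qed
  define g0 where "g0 = bessel_G 0 \<nu>"
  \<comment> \<open>\<open>g1\<close> and \<open>g2\<close> are \<theta>G and \<theta>^2 G, written
    through the higher indices.\<close>
  define g1 where "g1 \<alpha> = - 4 * \<alpha>\<^sup>2 * bessel_G 1 \<nu> \<alpha>" for \<alpha>
  define g2 where "g2 \<alpha> = - 8 * \<alpha>\<^sup>2 * bessel_G 1 \<nu> \<alpha> + 48 * \<alpha> ^ 4 * bessel_G 2 \<nu> \<alpha>" for \<alpha>
  define y1 z1 y2 z2 where "y1 = bessel_cyl 1 \<mu>" and "z1 = bessel_I_theta \<mu>"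
    and "y2 = bessel_cyl 1 (- \<mu>)" and "z2 = bessel_I_theta (- \<mu>)"
  have G': "(bessel_G 0 \<nu> has_field_derivative - (4 * \<alpha> * bessel_G 1 \<nu> \<alpha>)) (at \<alpha>)"
    "(bessel_G 1 \<nu> has_field_derivative - (12 * \<alpha> * bessel_G 2 \<nu> \<alpha>)) (at \<alpha>)"
    "(bessel_G 2 \<nu> has_field_derivative - (20 * \<alpha> * bessel_G 3 \<nu> \<alpha>)) (at \<alpha>)" if "Re \<alpha> > 0" for \<alpha>
    using bessel_G_has_field_derivative[OF \<nu> that, of 0] bessel_G_has_field_derivative[OF \<nu> that, of 1]
      bessel_G_has_field_derivative[OF \<nu> that, of 2]
    by (simp_all add: numeral_2_eq_2 numeral_3_eq_3)
  have g0': "(g0 has_field_derivative g1 \<alpha> / \<alpha>) (at \<alpha>)" if "Re \<alpha> > 0" for \<alpha>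
    unfolding g0_def using that
    by (intro DERIV_cong[OF G'(1)]) (auto simp: g1_def field_simps power2_eq_square)
  have g1': "(g1 has_field_derivative g2 \<alpha> / \<alpha>) (at \<alpha>)" if "Re \<alpha> > 0" for \<alpha>
  proof -
    have "\<alpha> \<noteq> 0" using that by auto
    have "((\<lambda>\<alpha>. - 4 * \<alpha>\<^sup>2) has_field_derivative - 8 * \<alpha>) (at \<alpha>)"
      by (auto intro!: derivative_eq_intros)
    from DERIV_mult[OF this G'(2)[OF that]] show ?thesis
      unfolding g1_def [abs_def]
      by (rule DERIV_cong) (use \<open>\<alpha> \<noteq> 0\<close> in \<open>simp add: g2_def field_simps power2_eq_square power4_eq_xxxx\<close>)
  qed
  have g2': "(g2 has_field_derivative (4 * (\<alpha>\<^sup>2 + \<mu>\<^sup>2) * g1 \<alpha> + 4 * \<alpha>\<^sup>2 * g0 \<alpha>) / \<alpha>) (at \<alpha>)" if "Re \<alpha> > 0" for \<alpha>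
  proof -
    have "\<alpha> \<noteq> 0" using that by auto
    have 1: "((\<lambda>\<alpha>. - 8 * \<alpha>\<^sup>2) has_field_derivative - 16 * \<alpha>) (at \<alpha>)"
      by (auto intro!: derivative_eq_intros)
    have 2: "((\<lambda>\<alpha>. 48 * \<alpha> ^ 4) has_field_derivative 192 * \<alpha> ^ 3) (at \<alpha>)"
      by (auto intro!: derivative_eq_intros)
    have \<mu>2: "\<mu>\<^sup>2 = \<nu>\<^sup>2 / 4" by (simp add: \<nu>_def power_mult_distrib)
    have ode: "bessel_G 0 \<nu> \<alpha> = - (4 - \<nu>\<^sup>2 - 4 * \<alpha>\<^sup>2) * bessel_G 1 \<nu> \<alpha> + 72 * \<alpha>\<^sup>2 * bessel_G 2 \<nu> \<alpha>
      - 240 * \<alpha> ^ 4 * bessel_G 3 \<nu> \<alpha>"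
      using bessel_G_ode[OF \<nu> that] by (simp add: algebra_simps eq_neg_iff_add_eq_0)
    from DERIV_add[OF DERIV_mult[OF 1 G'(2)[OF that]] DERIV_mult[OF 2 G'(3)[OF that]]] show ?thesis
      unfolding g2_def [abs_def] g0_def g1_def ode \<mu>2
      by (rule DERIV_cong)
         (use \<open>\<alpha> \<noteq> 0\<close> in \<open>simp add: field_simps power2_eq_square power3_eq_cube power4_eq_xxxx\<close>)
  qed
  have y: "(y1 has_field_derivative z1 \<alpha> / \<alpha>) (at \<alpha>)" "(z1 has_field_derivative (\<alpha>\<^sup>2 + \<mu>\<^sup>2) * y1 \<alpha> / \<alpha>) (at \<alpha>)"
      "(y2 has_field_derivative z2 \<alpha> / \<alpha>) (at \<alpha>)" "(z2 has_field_derivative (\<alpha>\<^sup>2 + \<mu>\<^sup>2) * y2 \<alpha> / \<alpha>) (at \<alpha>)"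
    if "Re \<alpha> > 0" for \<alpha>
    using bessel_I_theta_derivatives[OF that, of \<mu>] bessel_I_theta_derivatives[OF that, of "- \<mu>"]
    by (simp_all add: y1_def y2_def z1_def z2_def)
  obtain c11 where c11: "\<And>\<alpha>. Re \<alpha> > 0 \<Longrightarrow>
    g0 \<alpha> * (2 * (z1 \<alpha> * z1 \<alpha>) - 2 * ((\<alpha>\<^sup>2 + \<mu>\<^sup>2) * (y1 \<alpha> * y1 \<alpha>))) + g2 \<alpha> * (y1 \<alpha> * y1 \<alpha>)
      - g1 \<alpha> * (z1 \<alpha> * y1 \<alpha> + y1 \<alpha> * z1 \<alpha>) = c11"
    by (rule symmetric_square_invariant[OF g0' g1' g2' y(1,2) y(1,2)]) blast+
  obtain c12 where c12: "\<And>\<alpha>. Re \<alpha> > 0 \<Longrightarrow>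
    g0 \<alpha> * (2 * (z1 \<alpha> * z2 \<alpha>) - 2 * ((\<alpha>\<^sup>2 + \<mu>\<^sup>2) * (y1 \<alpha> * y2 \<alpha>))) + g2 \<alpha> * (y1 \<alpha> * y2 \<alpha>)
      - g1 \<alpha> * (z1 \<alpha> * y2 \<alpha> + y1 \<alpha> * z2 \<alpha>) = c12"
    by (rule symmetric_square_invariant[OF g0' g1' g2' y(1,2) y(3,4)]) blast+
  obtain c22 where c22: "\<And>\<alpha>. Re \<alpha> > 0 \<Longrightarrow>
    g0 \<alpha> * (2 * (z2 \<alpha> * z2 \<alpha>) - 2 * ((\<alpha>\<^sup>2 + \<mu>\<^sup>2) * (y2 \<alpha> * y2 \<alpha>))) + g2 \<alpha> * (y2 \<alpha> * y2 \<alpha>)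
      - g1 \<alpha> * (z2 \<alpha> * y2 \<alpha> + y2 \<alpha> * z2 \<alpha>) = c22"
    by (rule symmetric_square_invariant[OF g0' g1' g2' y(3,4) y(3,4)]) blast+
  have "g0 \<alpha> = c22 / (2 * W\<^sup>2) * (y1 \<alpha>)\<^sup>2 + - c12 / W\<^sup>2 * (y1 \<alpha> * y2 \<alpha>) + c11 / (2 * W\<^sup>2) * (y2 \<alpha>)\<^sup>2"
    if "Re \<alpha> > 0" for \<alpha>
  proof -
    have w: "y1 \<alpha> * z2 \<alpha> - z1 \<alpha> * y2 \<alpha> = W"
      using bessel_I_wronskian[OF that, of \<mu>] by (simp add: W_def y1_def y2_def z1_def z2_def)
    \<comment> \<open>A polynomial identity: the coefficients of \<open>g1\<close> and
      \<open>g2\<close> cancel, and that of \<open>g0\<close> is twice the squared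
      Wronskian.\<close>
    have "2 * W\<^sup>2 * g0 \<alpha> = c22 * (y1 \<alpha>)\<^sup>2 - 2 * c12 * (y1 \<alpha> * y2 \<alpha>) + c11 * (y2 \<alpha>)\<^sup>2"
      unfolding w [symmetric] c11[OF that, symmetric] c12[OF that, symmetric] c22[OF that, symmetric]
      by algebra
    then show ?thesis using W by (simp add: field_simps)
  qed
  then show ?thesis
    using that unfolding g0_def y1_def y2_def \<nu>_def by blast
qed

subsection \<open>Laplace transforms\<close>

text \<open>Absolute convergence of the Laplace transform on the open right half-plane. Asking for
  every \<epsilon> > 0 makes the class closed under multiplication by b, hence the transform
  differentiable repeatedly.\<close>

definition laplace_ok :: "(real \<Rightarrow> complex) \<Rightarrow> bool" where
  "laplace_ok f \<longleftrightarrow> continuous_on {0<..} f \<and>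
     (\<forall>\<epsilon>>0. (\<lambda>b. exp (- (\<epsilon> * b)) * norm (f b)) integrable_on {0<..})"

lemma laplace_okI:
  assumes "continuous_on {0<..} f" "h integrable_on {0<..}" "\<And>b. b > 0 \<Longrightarrow> norm (f b) \<le> h b"
  shows "laplace_ok f"
proof -
  have "(\<lambda>b. exp (- (\<epsilon> * b)) * norm (f b)) integrable_on {0<..}" if "\<epsilon> > 0" for \<epsilon>
  proof -
    have "(\<lambda>b. complex_of_real (exp (- (\<epsilon> * b))) * f b) absolutely_integrable_on {0<..}"
    proof (rule absolutely_integrable_continuous_bounded[OF _ assms(2)])
      show "continuous_on {0<..} (\<lambda>b. complex_of_real (exp (- (\<epsilon> * b))) * f b)"
        by (intro continuous_intros assms)
      show "norm (complex_of_real (exp (- (\<epsilon> * b))) * f b) \<le> h b" if "b > 0" for b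
        using mult_right_mono[of "exp (- (\<epsilon> * b))" 1 "norm (f b)"] that \<open>\<epsilon> > 0\<close> assms(3)[OF that]
        by (simp add: norm_mult)
    qed
    then show ?thesis
      by (simp add: absolutely_integrable_on_def norm_mult)
  qed
  then show ?thesis using assms(1) by (simp add: laplace_ok_def)
qed

lemma laplace_ok_integrable:
  assumes "laplace_ok f" "Re s > 0"
  shows "(\<lambda>b. exp (- (s * of_real b)) * f b) absolutely_integrable_on {0<..}"
proof (rule absolutely_integrable_continuous_bounded)
  show "continuous_on {0<..} (\<lambda>b. exp (- (s * of_real b)) * f b)"
    using assms(1) by (intro continuous_intros) (auto simp: laplace_ok_def)
  show "(\<lambda>b. exp (- (Re s * b)) * norm (f b)) integrable_on {0<..}"
    using assms by (auto simp: laplace_ok_def)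
qed (simp add: norm_mult)

lemma laplace_ok_times:
  assumes "laplace_ok f"
  shows "laplace_ok (\<lambda>b. of_real b * f b)"
proof -
  have "(\<lambda>b. exp (- (\<epsilon> * b)) * norm (of_real b * f b)) integrable_on {0<..}" if \<epsilon>: "\<epsilon> > 0" for \<epsilon>
  proof -
    have "(\<lambda>b. complex_of_real (exp (- (\<epsilon> * b))) * (of_real b * f b)) absolutely_integrable_on {0<..}"
    proof (rule absolutely_integrable_continuous_bounded)
      show "continuous_on {0<..} (\<lambda>b. complex_of_real (exp (- (\<epsilon> * b))) * (of_real b * f b))"
        using assms by (intro continuous_intros) (auto simp: laplace_ok_def)
      show "(\<lambda>b. 2 / \<epsilon> * (exp (- (\<epsilon> / 2 * b)) * norm (f b))) integrable_on {0<..}"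
        using assms half_gt_zero[OF \<epsilon>] unfolding laplace_ok_def by (intro integrable_on_mult_right) blast
      show "norm (complex_of_real (exp (- (\<epsilon> * b))) * (of_real b * f b)) \<le>
          2 / \<epsilon> * (exp (- (\<epsilon> / 2 * b)) * norm (f b))" if b: "b > 0" for b
      proof -
        \<comment> \<open>Half of the exponential decay is spent on absorbing the factor b.\<close>
        have "\<epsilon> / 2 * b \<le> exp (\<epsilon> / 2 * b)"
          using exp_ge_add_one_self[of "\<epsilon> / 2 * b"] by linarith
        then have "b \<le> 2 / \<epsilon> * exp (\<epsilon> / 2 * b)"
          using \<epsilon> by (simp add: field_simps)
        then have "exp (- (\<epsilon> * b)) * b \<le> exp (- (\<epsilon> * b)) * (2 / \<epsilon> * exp (\<epsilon> / 2 * b))"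
          by (intro mult_left_mono) auto
        also have "exp (- (\<epsilon> * b)) * (2 / \<epsilon> * exp (\<epsilon> / 2 * b)) = 2 / \<epsilon> * exp (- (\<epsilon> * b) + \<epsilon> / 2 * b)"
          unfolding exp_add by simp
        also have "- (\<epsilon> * b) + \<epsilon> / 2 * b = - (\<epsilon> / 2 * b)" by simp
        finally have "exp (- (\<epsilon> * b)) * b * norm (f b) \<le> 2 / \<epsilon> * exp (- (\<epsilon> / 2 * b)) * norm (f b)"
          by (intro mult_right_mono) auto
        then show ?thesis using b by (simp add: norm_mult mult.assoc)
      qed
    qed
    then show ?thesis by (simp add: absolutely_integrable_on_def norm_mult)
  qed
  moreover have "continuous_on {0<..} (\<lambda>b. of_real b * f b)"
    using assms by (intro continuous_intros) (auto simp: laplace_ok_def)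
  ultimately show ?thesis by (simp add: laplace_ok_def)
qed

lemma laplace_has_field_derivative:
  assumes f: "laplace_ok f" and s: "Re s > 0"
  shows "((\<lambda>s. integral {0<..} (\<lambda>b. exp (- (s * of_real b)) * f b)) has_field_derivative
    - integral {0<..} (\<lambda>b. exp (- (s * of_real b)) * (of_real b * f b))) (at s)"
proof -
  have Re: "Re w > Re s / 2" if "w \<in> ball s (Re s / 2)" for w
    using that abs_Re_le_cmod[of "s - w"] s by (auto simp: dist_norm)
  have "((\<lambda>s. integral {0<..} (\<lambda>b. exp (- (s * of_real b)) * f b)) has_field_derivative
    integral {0<..} (\<lambda>b. - (exp (- (s * of_real b)) * (of_real b * f b)))) (at s)"
  proof (rule has_field_derivative_integral_dominated[where r = "Re s / 2" and
        g = "\<lambda>b. exp (- (Re s / 2 * b)) * norm (f b)"])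
    show "((\<lambda>w. exp (- (w * of_real b)) * f b) has_field_derivative - (exp (- (w * of_real b)) * (of_real b * f b))) (at w)"
      for w b
      by (auto intro!: derivative_eq_intros)
    show "continuous_on {0<..} (\<lambda>b. exp (- (w * of_real b)) * f b)" for w
      using f by (intro continuous_intros) (auto simp: laplace_ok_def)
    show "(\<lambda>b. exp (- (Re s / 2 * b)) * norm (f b)) integrable_on {0<..}"
      using f half_gt_zero[OF s] unfolding laplace_ok_def by blast
    show "norm (exp (- (w * of_real b)) * f b) \<le> exp (- (Re s / 2 * b)) * norm (f b)"
      if "w \<in> ball s (Re s / 2)" "b > 0" for w b
    proof -
      have "exp (- (Re w * b)) \<le> exp (- (Re s / 2 * b))"
        using mult_right_mono[of "Re s / 2" "Re w" b] Re[OF that(1)] that(2) by simp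
      then show ?thesis by (simp add: norm_mult mult_right_mono)
    qed
  qed (use s in auto)
  then show ?thesis by simp
qed

text \<open>For \<nu> > 0 the small-argument power bounds J on the whole half-line, since it exceeds
  b^(-1/2) beyond 1; this form survives rescaling b and dominates limits. The second form gives
  integrability of J(b)/b.\<close>

lemma bessel_J_bound_real_order:
  assumes "\<nu> > 0"
  obtains M where "M > 0" "\<And>b. b > 0 \<Longrightarrow> norm (bessel_cyl (- 1) (of_real \<nu>) (of_real b)) \<le> M * b powr \<nu>"
    "\<And>b. b > 0 \<Longrightarrow> norm (bessel_cyl (- 1) (of_real \<nu>) (of_real b)) \<le> M * b * bessel_dom (\<nu> - 1) b"
proof -
  obtain M where M: "M > 0"
    "\<And>\<nu>' b. norm \<nu>' \<le> \<nu> \<Longrightarrow> 0 < b \<Longrightarrow> b \<le> 1 \<Longrightarrow> norm (bessel_cyl (- 1) \<nu>' (of_real b)) \<le> M * b powr Re \<nu>'"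
    "\<And>\<nu>' b. norm \<nu>' \<le> \<nu> \<Longrightarrow> 1 \<le> b \<Longrightarrow> norm (bessel_cyl (- 1) \<nu>' (of_real b)) \<le> M * b powr (- 1 / 2)"
    using bessel_J_bound by blast
  show ?thesis
  proof (rule that[of M])
    fix b :: real assume b: "b > 0"
    show "norm (bessel_cyl (- 1) (of_real \<nu>) (of_real b)) \<le> M * b powr \<nu>"
    proof (cases "b \<le> 1")
      case True
      then show ?thesis using M(2)[of "of_real \<nu>" b] assms b by simp
    next
      case False
      then have "b powr (- 1 / 2) \<le> b powr \<nu>" using assms by (intro powr_mono) auto
      then show ?thesis using M(3)[of "of_real \<nu>" b] assms False M(1)
        by (auto intro: order_trans mult_left_mono)
    qed
    show "norm (bessel_cyl (- 1) (of_real \<nu>) (of_real b)) \<le> M * b * bessel_dom (\<nu> - 1) b"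
    proof (cases "b \<le> 1")
      case True
      then show ?thesis using M(2)[of "of_real \<nu>" b] assms b by (simp add: bessel_dom_def powr_diff)
    next
      case False
      have "b * b powr (- 3 / 2) = b powr (1 + (- 3 / 2))" using b by (subst powr_add) simp
      then show ?thesis using M(3)[of "of_real \<nu>" b] assms False by (simp add: bessel_dom_def mult.assoc)
    qed
  qed (use M in auto)
qed

lemma one_plus_mult_bessel_dom_tendsto_0:
  assumes "\<sigma> > 0"
  shows "((\<lambda>b. (1 + b) * bessel_dom \<sigma> b) \<longlongrightarrow> 0) (at_right 0)"
    and "((\<lambda>b. (1 + b) * bessel_dom \<sigma> b) \<longlongrightarrow> 0) at_top"
proof -
  show "((\<lambda>b. (1 + b) * bessel_dom \<sigma> b) \<longlongrightarrow> 0) (at_right 0)"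
  proof (rule Lim_transform_eventually)
    have "((\<lambda>b. b powr \<sigma>) \<longlongrightarrow> 0) (at_right (0::real))"
    proof (rule tendsto_zero_powrI)
      show "\<forall>\<^sub>F x in at_right 0. 0 \<le> (x :: real)"
        by (rule eventually_at_right_less [THEN eventually_mono]) auto
    qed (use assms in \<open>auto intro!: tendsto_eq_intros\<close>)
    from tendsto_mult[OF tendsto_add[OF tendsto_const tendsto_ident_at] this, of 1]
    show "((\<lambda>b. (1 + b) * b powr \<sigma>) \<longlongrightarrow> 0) (at_right 0)"
      by simp
    have "\<forall>\<^sub>F b in at_right 0. b > 0 \<and> b < (1 :: real)"
      by (rule eventually_at_right_real [THEN eventually_mono]) auto
    then show "\<forall>\<^sub>F b in at_right 0. (1 + b) * b powr \<sigma> = (1 + b) * bessel_dom \<sigma> b"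
      by eventually_elim (simp add: bessel_dom_def)
  qed
  show "((\<lambda>b. (1 + b) * bessel_dom \<sigma> b) \<longlongrightarrow> 0) at_top"
  proof (rule Lim_null_comparison)
    show "\<forall>\<^sub>F b in at_top. norm ((1 + b) * bessel_dom \<sigma> b) \<le> 2 * b powr (- 1 / 2)"
      using eventually_gt_at_top[of 1]
    proof eventually_elim
      case (elim b)
      have "b * b powr (- 3 / 2) = b powr (1 + (- 3 / 2))" using elim by (subst powr_add) simp
      moreover have "(1 + b) * b powr (- 3 / 2) \<le> (2 * b) * b powr (- 3 / 2)"
        using elim by (intro mult_right_mono) auto
      ultimately show ?case using elim by (simp add: bessel_dom_def abs_mult mult.assoc)
    qed
    show "((\<lambda>b :: real. 2 * b powr (- 1 / 2)) \<longlongrightarrow> 0) at_top"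
      using tendsto_mult_left[OF tendsto_neg_powr[OF _ filterlim_ident], of "- 1 / 2" 2] by simp
  qed
qed

text \<open>
  With \<open>s = sinh t\<close> this equation for the Laplace transform of \<open>J\<^bsub>\<nu>\<^esub>(b)/b\<close> becomes \<open>L'' = \<nu>\<^sup>2 L\<close>, whose
  decaying solution is \<open>exp(-\<nu>t)/\<nu>\<close>.
\<close>

lemma bessel_J_over_b_laplace_ode:
  fixes \<nu> s :: real
  assumes \<nu>: "\<nu> > 0" and s: "s > 0"
  defines "f \<equiv> \<lambda>b. bessel_cyl (- 1) (of_real \<nu>) (of_real b) / of_real b"
  shows "(1 + (of_real s)\<^sup>2) * integral {0<..} (\<lambda>b. exp (- (of_real s * of_real b)) * (of_real b * (of_real b * f b)))
    - of_real s * integral {0<..} (\<lambda>b. exp (- (of_real s * of_real b)) * (of_real b * f b))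
    - (of_real \<nu>)\<^sup>2 * integral {0<..} (\<lambda>b. exp (- (of_real s * of_real b)) * f b) = 0"
    and "laplace_ok f"
proof -
  obtain M where "M > 0" "\<And>b. b > 0 \<Longrightarrow> norm (bessel_cyl (- 1) (of_real \<nu>) (of_real b)) \<le> M * b powr \<nu>"
    and M: "\<And>b. b > 0 \<Longrightarrow> norm (bessel_cyl (- 1) (of_real \<nu>) (of_real b)) \<le> M * b * bessel_dom (\<nu> - 1) b"
    using bessel_J_bound_real_order[OF \<nu>] by blast
  show ok: "laplace_ok f"
  proof (rule laplace_okI)
    show "continuous_on {0<..} f"
      unfolding f_def by (intro continuous_intros) auto
    show "(\<lambda>b. M * bessel_dom (\<nu> - 1) b) integrable_on {0<..}"
      using \<nu> by (intro integrable_on_mult_right bessel_dom_integrable) auto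
    show "norm (f b) \<le> M * bessel_dom (\<nu> - 1) b" if "b > 0" for b
      using M[OF that] that by (simp add: f_def norm_divide field_simps)
  qed
  define J where "J b = bessel_cyl (- 1) (of_real \<nu>) (of_real b)" for b
  define K where "K b = bessel_cyl (- 1) (of_real \<nu> + 1) (of_real b)" for b
  define E where "E b = exp (- (complex_of_real s * of_real b))" for b
  \<comment> \<open>Equal to -b E (J' + s J): minus the boundary term of Lagrange's identity for (b
    J')' + (b - \<nu>^2/b) J = 0 tested against the exponential.\<close>
  define P where "P b = E b * (of_real b * K b - (of_real \<nu> + of_real s * of_real b) * J b)" for b
  define R where "R b = (1 + (of_real s)\<^sup>2) * (E b * (of_real b * (of_real b * f b)))
      - of_real s * (E b * (of_real b * f b)) - (of_real \<nu>)\<^sup>2 * (E b * f b)" for b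
  have der: "(P has_vector_derivative R b) (at b)" if b: "b > 0" for b
  proof -
    define D1 D2 where "D1 = of_real \<nu> / of_real b * J b - K b" and "D2 = J b - (of_real \<nu> + 1) / of_real b * K b"
    have J': "(J has_vector_derivative D1) (at b)" "(K has_vector_derivative D2) (at b)"
      unfolding J_def [abs_def] K_def [abs_def] D1_def D2_def
      using has_vector_derivative_bessel_J[OF b, of "of_real \<nu>"] by simp_all
    have E': "(E has_vector_derivative - of_real s * E b) (at b)"
      unfolding E_def [abs_def]
      by (rule has_vector_derivative_real_field) (auto intro!: derivative_eq_intros)
    have bd: "((\<lambda>b. complex_of_real b) has_vector_derivative 1) (at b)"
      using has_vector_derivative_of_real[OF DERIV_ident] by simp
    have lin: "((\<lambda>b. of_real \<nu> + of_real s * complex_of_real b) has_vector_derivative (0 + of_real s * 1)) (at b)"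
      by (intro has_vector_derivative_add has_vector_derivative_const has_vector_derivative_mult_right bd)
    have "(P has_vector_derivative (E b * ((of_real b * D2 + 1 * K b) -
        ((of_real \<nu> + of_real s * of_real b) * D1 + (0 + of_real s * 1) * J b)) +
        (- of_real s * E b) * (of_real b * K b - (of_real \<nu> + of_real s * of_real b) * J b))) (at b)"
      unfolding P_def [abs_def]
      by (intro has_vector_derivative_mult has_vector_derivative_diff E' J' bd lin)
    moreover have "(E b * ((of_real b * D2 + 1 * K b) -
        ((of_real \<nu> + of_real s * of_real b) * D1 + (0 + of_real s * 1) * J b)) +
        (- of_real s * E b) * (of_real b * K b - (of_real \<nu> + of_real s * of_real b) * J b)) = R b"
      using b unfolding R_def f_def J_def [symmetric] D1_def D2_def
      by (simp add: field_simps power2_eq_square)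
    ultimately show ?thesis by simp
  qed
  have int: "(\<lambda>b. E b * f b) absolutely_integrable_on {0<..}"
    "(\<lambda>b. E b * (of_real b * f b)) absolutely_integrable_on {0<..}"
    "(\<lambda>b. E b * (of_real b * (of_real b * f b))) absolutely_integrable_on {0<..}"
    unfolding E_def using ok s by (auto intro!: laplace_ok_integrable laplace_ok_times)
  have intR: "R absolutely_integrable_on {0<..}"
    unfolding R_def [abs_def] by (intro set_integral_diff(1) set_integrable_mult_right int)
  obtain N where N: "N > 0" "\<And>\<nu>' b. norm \<nu>' \<le> \<nu> + 1 \<Longrightarrow> \<nu> \<le> Re \<nu>' \<Longrightarrow> 0 < b \<Longrightarrow>
      norm (bessel_cyl (- 1) \<nu>' (of_real b)) / (1 + b) \<le> N * bessel_dom \<nu> b"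
    using bessel_J_dominated[of "\<nu> + 1" \<nu>] by blast
  \<comment> \<open>The fraction comes from exp(-sb) b being at most 1/s, applied to the terms b and
    s b in \<open>P\<close>.\<close>
  define C where "C = (\<nu> + (s + 1) / s) * N"
  have bound: "norm (P b) \<le> C * ((1 + b) * bessel_dom \<nu> b)" if b: "b > 0" for b
  proof -
    have JN: "norm (J b) \<le> N * bessel_dom \<nu> b * (1 + b)"
      using N(2)[of "of_real \<nu>" b] b \<nu> by (simp add: J_def pos_divide_le_eq)
    have KN: "norm (K b) \<le> N * bessel_dom \<nu> b * (1 + b)"
      using N(2)[of "of_real \<nu> + 1" b] b \<nu> norm_triangle_ineq[of "complex_of_real \<nu>" 1] by (simp add: K_def pos_divide_le_eq)
    have "exp (- (s * b)) * \<nu> \<le> 1 * \<nu>" using s b \<nu> by (intro mult_right_mono) auto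
    moreover have "exp (- (s * b)) * b \<le> 1 / s"
    proof -
      have "s * b \<le> exp (s * b)" using exp_ge_add_one_self[of "s * b"] by linarith
      then show ?thesis using s by (simp add: exp_minus field_simps)
    qed
    then have "exp (- (s * b)) * b * (s + 1) \<le> 1 / s * (s + 1)"
      using s by (intro mult_right_mono) auto
    ultimately have e: "exp (- (s * b)) * (b + (\<nu> + s * b)) \<le> \<nu> + (s + 1) / s"
      by (simp add: algebra_simps)
    have "norm (P b) \<le> exp (- (s * b)) * (b * norm (K b) + (\<nu> + s * b) * norm (J b))"
    proof -
      have "norm (complex_of_real \<nu> + of_real s * of_real b) = \<nu> + s * b"
        using \<nu> s b by (metis abs_of_pos add_pos_pos mult_pos_pos norm_of_real of_real_add of_real_mult)
      then have "norm (of_real b * K b - (of_real \<nu> + of_real s * of_real b) * J b) \<le>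
          b * norm (K b) + (\<nu> + s * b) * norm (J b)"
        using norm_triangle_ineq4[of "of_real b * K b" "(of_real \<nu> + of_real s * of_real b) * J b"] b
        by (simp add: norm_mult)
      moreover have "norm (E b) = exp (- (s * b))" by (simp add: E_def)
      ultimately show ?thesis unfolding P_def norm_mult by (simp add: mult_left_mono)
    qed
    also have "\<dots> \<le> exp (- (s * b)) * (b * (N * bessel_dom \<nu> b * (1 + b)) + (\<nu> + s * b) * (N * bessel_dom \<nu> b * (1 + b)))"
      using JN KN b \<nu> s by (intro mult_left_mono add_mono) auto
    also have "\<dots> = (exp (- (s * b)) * (b + (\<nu> + s * b))) * (N * bessel_dom \<nu> b * (1 + b))"
      by (simp add: algebra_simps)
    also have "\<dots> \<le> (\<nu> + (s + 1) / s) * (N * bessel_dom \<nu> b * (1 + b))"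
      using e N(1) b by (intro mult_right_mono) auto
    also have "\<dots> = C * ((1 + b) * bessel_dom \<nu> b)" by (simp add: C_def mult_ac)
    finally show ?thesis .
  qed
  have *: "(P \<longlongrightarrow> 0) F"
    if "((\<lambda>b. (1 + b) * bessel_dom \<nu> b) \<longlongrightarrow> 0) F" "\<forall>\<^sub>F b in F. b > 0" for F
  proof (rule Lim_null_comparison)
    show "\<forall>\<^sub>F b in F. norm (P b) \<le> C * ((1 + b) * bessel_dom \<nu> b)"
      using that(2) by eventually_elim (rule bound)
    show "((\<lambda>b. C * ((1 + b) * bessel_dom \<nu> b)) \<longlongrightarrow> 0) F"
      using tendsto_mult_left[OF that(1), of C] by simp
  qed
  have lim: "(P \<longlongrightarrow> 0) (at_right 0)" "(P \<longlongrightarrow> 0) at_top"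
    by (rule *[OF one_plus_mult_bessel_dom_tendsto_0(1)[OF \<nu>] eventually_at_right_less])
       (rule *[OF one_plus_mult_bessel_dom_tendsto_0(2)[OF \<nu>] eventually_gt_at_top])
  have "integral {0<..} R = 0 - 0"
    by (rule integral_FTC_positive_reals[OF der intR lim])
  moreover have "integral {0<..} R =
      (1 + (of_real s)\<^sup>2) * integral {0<..} (\<lambda>b. E b * (of_real b * (of_real b * f b)))
      - of_real s * integral {0<..} (\<lambda>b. E b * (of_real b * f b)) - (of_real \<nu>)\<^sup>2 * integral {0<..} (\<lambda>b. E b * f b)"
    unfolding R_def [abs_def] using int
    by (simp add: integral_diff integrable_diff integrable_on_mult_right set_lebesgue_integral_eq_integral(1))
  ultimately show "(1 + (of_real s)\<^sup>2) * integral {0<..} (\<lambda>b. exp (- (of_real s * of_real b)) * (of_real b * (of_real b * f b)))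
    - of_real s * integral {0<..} (\<lambda>b. exp (- (of_real s * of_real b)) * (of_real b * f b))
    - (of_real \<nu>)\<^sup>2 * integral {0<..} (\<lambda>b. exp (- (of_real s * of_real b)) * f b) = 0"
    by (simp add: E_def)
qed

lemma constant_on_positive_reals:
  fixes f :: "real \<Rightarrow> complex"
  assumes "\<And>s. s > 0 \<Longrightarrow> (f has_vector_derivative 0) (at s)"
  obtains c where "\<And>s. s > 0 \<Longrightarrow> f s = c"
proof -
  have "\<exists>c. \<forall>s\<in>{0<..}. f s = c"
    by (rule has_derivative_zero_constant)
       (use assms in \<open>auto simp: has_vector_derivative_def intro: has_derivative_at_withinI\<close>)
  then show ?thesis using that by auto
qed

lemma bessel_J_real_order_argument:
  assumes "b > 0"
  shows "bessel_cyl (- 1) (of_real \<nu>) (of_real b) =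
    of_real ((b / 2) powr \<nu>) * bessel_E (of_real \<nu>) (of_real (- ((b / 2)\<^sup>2)))"
  using powr_of_real[of "b / 2" \<nu>] assms by (simp add: bessel_cyl_def)

lemma bessel_J_small_argument_limit:
  fixes t :: "nat \<Rightarrow> real"
  assumes t: "\<And>n. t n > 0" "t \<longlonglongrightarrow> 0" and x: "x > 0"
  shows "(\<lambda>n. of_real (t n powr - \<nu>) * bessel_cyl (- 1) (of_real \<nu>) (of_real (t n * x)))
    \<longlonglongrightarrow> of_real ((x / 2) powr \<nu>) * rGamma (of_real \<nu> + 1)"
proof -
  have "(\<lambda>n. bessel_E (of_real \<nu>) (of_real (- ((t n * x / 2)\<^sup>2)))) \<longlonglongrightarrow> bessel_E (of_real \<nu>) 0"
  proof (rule isCont_tendsto_compose[of 0 "bessel_E (of_real \<nu>)"])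
    show "isCont (bessel_E (of_real \<nu>)) 0"
      using has_field_derivative_bessel_E by (rule DERIV_isCont)
    show "(\<lambda>n. of_real (- ((t n * x / 2)\<^sup>2))) \<longlonglongrightarrow> (0 :: complex)"
      using t(2) by (auto intro!: tendsto_eq_intros)
  qed
  then have "(\<lambda>n. of_real ((x / 2) powr \<nu>) * bessel_E (of_real \<nu>) (of_real (- ((t n * x / 2)\<^sup>2))))
      \<longlonglongrightarrow> of_real ((x / 2) powr \<nu>) * rGamma (of_real \<nu> + 1)"
    unfolding bessel_E_0 by (rule tendsto_mult_left)
  moreover have "of_real (t n powr - \<nu>) * bessel_cyl (- 1) (of_real \<nu>) (of_real (t n * x)) =
      of_real ((x / 2) powr \<nu>) * bessel_E (of_real \<nu>) (of_real (- ((t n * x / 2)\<^sup>2)))" for n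
  proof -
    have "t n * x > 0" using t(1) x by simp
    moreover have "t n powr - \<nu> * (t n * x / 2) powr \<nu> = (x / 2) powr \<nu>"
      using t(1)[of n] x powr_mult[of "t n" "x / 2" \<nu>] by (simp add: powr_minus field_simps)
    ultimately show ?thesis
      unfolding bessel_J_real_order_argument[OF \<open>t n * x > 0\<close>] mult.assoc [symmetric] of_real_mult [symmetric]
      by simp
  qed
  ultimately show ?thesis by simp
qed

text \<open>The transform L of J(b)/b is pinned down on s > 0: boundedness excludes the growing
  solution, so L(s) r(s)^\<nu> is a constant d. The behaviour as s tends to infinity gives d =
  1/\<nu>, and s tending to 0 recovers the integral, since r tends to 1.\<close>

lemma weber_integral:
  fixes \<nu> :: real
  assumes \<nu>: "\<nu> > 0"
  shows "(\<lambda>b. bessel_cyl (- 1) (of_real \<nu>) (of_real b) / of_real b) absolutely_integrable_on {0<..}"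
    and "integral {0<..} (\<lambda>b. bessel_cyl (- 1) (of_real \<nu>) (of_real b) / of_real b) = 1 / of_real \<nu>"
proof -
  define f where "f b = bessel_cyl (- 1) (of_real \<nu>) (of_real b) / of_real b" for b
  have ok: "laplace_ok f"
    unfolding f_def [abs_def] by (rule bessel_J_over_b_laplace_ode(2)[OF \<nu> zero_less_one])
  obtain M where M: "M > 0" "\<And>b. b > 0 \<Longrightarrow> norm (bessel_cyl (- 1) (of_real \<nu>) (of_real b)) \<le> M * b powr \<nu>"
    "\<And>b. b > 0 \<Longrightarrow> norm (bessel_cyl (- 1) (of_real \<nu>) (of_real b)) \<le> M * b * bessel_dom (\<nu> - 1) b"
    using bessel_J_bound_real_order[OF \<nu>] by blast
  have fint: "f absolutely_integrable_on {0<..}"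
  proof (rule absolutely_integrable_continuous_bounded)
    show "continuous_on {0<..} f" using ok by (simp add: laplace_ok_def)
    show "(\<lambda>b. M * bessel_dom (\<nu> - 1) b) integrable_on {0<..}"
      using \<nu> by (intro integrable_on_mult_right bessel_dom_integrable) auto
    show "norm (f b) \<le> M * bessel_dom (\<nu> - 1) b" if "b > 0" for b
      using M(3)[OF that] that by (simp add: f_def norm_divide field_simps)
  qed
  then show "(\<lambda>b. bessel_cyl (- 1) (of_real \<nu>) (of_real b) / of_real b) absolutely_integrable_on {0<..}"
    by (simp add: f_def [abs_def])
  have nfint: "(\<lambda>b. norm (f b)) integrable_on {0<..}"
    using fint by (simp add: absolutely_integrable_on_def)
  define L where "L s = integral {0<..} (\<lambda>b. exp (- (complex_of_real s * of_real b)) * f b)" for s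
  define L1 where "L1 s = integral {0<..} (\<lambda>b. exp (- (complex_of_real s * of_real b)) * (of_real b * f b))" for s
  define L2 where "L2 s = integral {0<..} (\<lambda>b. exp (- (complex_of_real s * of_real b)) * (of_real b * (of_real b * f b)))" for s
  have L': "(L has_vector_derivative - L1 s) (at s)" and L1': "(L1 has_vector_derivative - L2 s) (at s)"
    if "s > 0" for s
    using has_vector_derivative_real_field[OF laplace_has_field_derivative[OF ok, of "of_real s"]]
      has_vector_derivative_real_field[OF laplace_has_field_derivative[OF laplace_ok_times[OF ok], of "of_real s"]] that
    by (simp_all add: L_def [abs_def] L1_def [abs_def] L2_def)
  have ode: "(1 + (of_real s)\<^sup>2) * L2 s - of_real s * L1 s - (of_real \<nu>)\<^sup>2 * L s = 0" if "s > 0" for s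
    using bessel_J_over_b_laplace_ode(1)[OF \<nu> that] by (simp add: L_def L1_def L2_def f_def)
  define rt where "rt s = sqrt (1 + s\<^sup>2)" for s
  \<comment> \<open>With s = sinh t this is exp t, and \<open>rt\<close> is ds/dt.\<close>
  define r where "r s = s + rt s" for s
  have rt_pos: "rt s > 0" for s by (simp add: rt_def add_pos_nonneg)
  have rt_sq: "(rt s)\<^sup>2 = 1 + s\<^sup>2" for s by (simp add: rt_def)
  have r_pos: "r s > 0" if "s > 0" for s using rt_pos[of s] that by (simp add: r_def)
  have rt': "(rt has_real_derivative s / rt s) (at s)" for s
    unfolding rt_def [abs_def] using add_pos_nonneg[of 1 "s\<^sup>2"]
    by (auto intro!: derivative_eq_intros simp: field_simps)
  have r': "(r has_real_derivative r s / rt s) (at s)" for s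
    unfolding r_def [abs_def]
    by (rule DERIV_cong[OF DERIV_add[OF DERIV_ident rt']]) (use rt_pos[of s] in \<open>simp add: field_simps\<close>)
  have rp: "((\<lambda>s. complex_of_real (r s powr e)) has_vector_derivative of_real (e * r s powr e / rt s)) (at s)"
    if "s > 0" for s e
  proof -
    have "((\<lambda>s. r s powr e) has_real_derivative e * r s powr (e - 1) * (r s / rt s)) (at s)"
      by (rule DERIV_chain2[OF has_real_derivative_powr[OF r_pos[OF that]] r'])
    moreover have "e * r s powr (e - 1) * (r s / rt s) = e * r s powr e / rt s"
      using r_pos[OF that] by (simp add: powr_diff)
    ultimately have "((\<lambda>s. r s powr e) has_real_derivative e * r s powr e / rt s) (at s)"
      by (simp only:)
    then show ?thesis by (rule has_vector_derivative_of_real)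
  qed
  \<comment> \<open>\<nu>L + dL/dt in the variable t, because L' = -L1. It solves dX/dt = \<nu>X,
    which factors the second-order equation.\<close>
  define X where "X s = of_real \<nu> * L s - of_real (rt s) * L1 s" for s
  have X': "(X has_vector_derivative of_real \<nu> / of_real (rt s) * X s) (at s)" if s: "s > 0" for s
  proof -
    have nz: "complex_of_real (rt s) \<noteq> 0" using rt_pos[of s] by simp
    have "(X has_vector_derivative of_real \<nu> * (- L1 s) - (of_real (rt s) * (- L2 s) + of_real (s / rt s) * L1 s)) (at s)"
      unfolding X_def [abs_def]
      by (intro has_vector_derivative_diff has_vector_derivative_mult_right has_vector_derivative_mult
            has_vector_derivative_of_real L' L1' rt' s)
    moreover have "of_real \<nu> * (- L1 s) - (of_real (rt s) * (- L2 s) + of_real (s / rt s) * L1 s) =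
        of_real \<nu> / of_real (rt s) * X s"
    proof -
      have "(of_real (rt s))\<^sup>2 * L2 s = of_real s * L1 s + (of_real \<nu>)\<^sup>2 * L s"
        using ode[OF s] rt_sq[of s] by (simp add: algebra_simps flip: of_real_power)
      then show ?thesis using nz by (simp add: X_def field_simps power2_eq_square)
    qed
    ultimately show ?thesis by simp
  qed
  have "((\<lambda>s. X s * of_real (r s powr - \<nu>)) has_vector_derivative 0) (at s)" if s: "s > 0" for s
    by (rule has_vector_derivative_eq_rhs[OF has_vector_derivative_mult[OF X'[OF s] rp[OF s]]])
       (use rt_pos[of s] in \<open>simp add: field_simps\<close>)
  then obtain c where c: "\<And>s. s > 0 \<Longrightarrow> X s * of_real (r s powr - \<nu>) = c"
    using constant_on_positive_reals[of "\<lambda>s. X s * of_real (r s powr - \<nu>)"] by blast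
  define I0 where "I0 = integral {0<..} (\<lambda>b. norm (f b))"
  have Lb: "norm (L s) \<le> I0" if s: "s > 0" for s
    unfolding L_def I0_def
  proof (rule integral_norm_bound_integral)
    show "(\<lambda>b. exp (- (complex_of_real s * of_real b)) * f b) integrable_on {0<..}"
      using laplace_ok_integrable[OF ok, of "of_real s"] s set_lebesgue_integral_eq_integral(1) by simp
    show "norm (exp (- (complex_of_real s * of_real b)) * f b) \<le> norm (f b)" if "b \<in> {0<..}" for b
      using that s mult_right_mono[of "exp (- (s * b))" 1 "norm (f b)"] by (simp add: norm_mult)
  qed (rule nfint)
  have L1b: "norm (L1 s) \<le> 1 / s * I0" if s: "s > 0" for s
  proof -
    have "norm (L1 s) \<le> integral {0<..} (\<lambda>b. 1 / s * norm (f b))"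
      unfolding L1_def
    proof (rule integral_norm_bound_integral)
      show "(\<lambda>b. exp (- (complex_of_real s * of_real b)) * (of_real b * f b)) integrable_on {0<..}"
        using laplace_ok_integrable[OF laplace_ok_times[OF ok], of "of_real s"] s set_lebesgue_integral_eq_integral(1) by simp
      show "(\<lambda>b. 1 / s * norm (f b)) integrable_on {0<..}" using nfint by (rule integrable_on_mult_right)
      show "norm (exp (- (complex_of_real s * of_real b)) * (of_real b * f b)) \<le> 1 / s * norm (f b)"
        if "b \<in> {0<..}" for b
      proof -
        have "s * b \<le> exp (s * b)" using exp_ge_add_one_self[of "s * b"] by linarith
        then have "exp (- (s * b)) * b \<le> 1 / s" using s by (simp add: exp_minus field_simps)
        then have "exp (- (s * b)) * b * norm (f b) \<le> 1 / s * norm (f b)"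
          by (rule mult_right_mono) simp
        then show ?thesis using that by (simp add: norm_mult mult.assoc)
      qed
    qed
    then show ?thesis by (simp add: I0_def)
  qed
  \<comment> \<open>\<open>X\<close> stays bounded: L is at most I0, L1 at most I0/s, and
    \<open>rt s\<close> at most 2s. The constant value of this product must therefore be 0.\<close>
  have "((\<lambda>s. X s * of_real (r s powr - \<nu>)) \<longlongrightarrow> 0) at_top"
  proof (rule Lim_null_comparison)
    show "\<forall>\<^sub>F s in at_top. norm (X s * of_real (r s powr - \<nu>)) \<le> (\<nu> * I0 + 2 * I0) * r s powr - \<nu>"
      using eventually_ge_at_top[of 1]
    proof eventually_elim
      case (elim s)
      have "1 \<le> s\<^sup>2" using elim by (rule one_le_power)
      then have "1 + s\<^sup>2 \<le> (2 * s)\<^sup>2" by (simp add: power_mult_distrib)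
      then have "rt s \<le> 2 * s" unfolding rt_def
        using elim by (intro real_le_lsqrt) auto
      then have "rt s * norm (L1 s) \<le> 2 * s * (1 / s * I0)"
        using elim rt_pos[of s] by (intro mult_mono L1b) auto
      moreover have "\<nu> * norm (L s) \<le> \<nu> * I0"
        using \<nu> elim by (intro mult_left_mono Lb) auto
      moreover have "norm (X s) \<le> \<nu> * norm (L s) + rt s * norm (L1 s)"
        unfolding X_def using norm_triangle_ineq4[of "of_real \<nu> * L s" "of_real (rt s) * L1 s"] \<nu> rt_pos[of s]
        by (simp add: norm_mult)
      ultimately have "norm (X s) \<le> \<nu> * I0 + 2 * s * (1 / s * I0)" by linarith
      then have "norm (X s) \<le> \<nu> * I0 + 2 * I0" using elim by simp
      then show ?case by (simp add: norm_mult mult_right_mono)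
    qed
    have "filterlim r at_top at_top"
    proof (rule filterlim_at_top_mono[OF filterlim_ident])
      show "\<forall>\<^sub>F s in at_top. s \<le> r s"
        using rt_pos by (auto simp: r_def less_imp_le)
    qed
    then have "((\<lambda>s. r s powr - \<nu>) \<longlongrightarrow> 0) at_top"
      using \<nu> by (intro tendsto_neg_powr) auto
    then show "((\<lambda>s. (\<nu> * I0 + 2 * I0) * r s powr - \<nu>) \<longlongrightarrow> 0) at_top"
      by (rule tendsto_mult_right_zero)
  qed
  moreover have "((\<lambda>s. X s * of_real (r s powr - \<nu>)) \<longlongrightarrow> c) at_top"
    by (rule tendsto_eventually, rule eventually_mono[OF eventually_gt_at_top[of 0]]) (simp add: c)
  ultimately have "c = 0" using tendsto_unique trivial_limit_at_top_linorder by blast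
  then have X0: "X s = 0" if "s > 0" for s
    using c[OF that] r_pos[OF that] by simp
  have "((\<lambda>s. L s * of_real (r s powr \<nu>)) has_vector_derivative 0) (at s)" if s: "s > 0" for s
    by (rule has_vector_derivative_eq_rhs[OF has_vector_derivative_mult[OF L'[OF s] rp[OF s]]])
       (use rt_pos[of s] X0[OF s] in \<open>simp add: X_def field_simps\<close>)
  then obtain d where d: "\<And>s. s > 0 \<Longrightarrow> L s * of_real (r s powr \<nu>) = d"
    using constant_on_positive_reals[of "\<lambda>s. L s * of_real (r s powr \<nu>)"] by blast

  have "d = 1 / of_real \<nu>"
  proof -
    define t :: "nat \<Rightarrow> real" where "t n = 1 / real (Suc n)" for n
    have t: "t n > 0" "t \<longlonglongrightarrow> 0" for n
      unfolding t_def using LIMSEQ_inverse_real_of_nat by (auto simp: inverse_eq_divide)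
    define h where "h x = complex_of_real x powr (of_real \<nu> - 1) / of_real (exp x)" for x
    have h: "h absolutely_integrable_on {0<..}" "(h has_integral Gamma (of_real \<nu>)) {0<..}"
      unfolding h_def [abs_def] using \<nu>
      by (auto intro!: absolutely_integrable_Gamma_integral' Gamma_integral_complex')
    have nh: "norm (h x) = exp (- x) * x powr \<nu> / x" if "x > 0" for x
      using that powr_of_real[of x "\<nu> - 1"]
      by (simp add: h_def norm_divide norm_mult exp_minus powr_diff divide_simps)
    \<comment> \<open>The transform at s = 1/t after substituting b = t x and normalising by
      t^(-\<nu>). Its limit is the Gamma integrand times 2^(-\<nu>)/Gamma(\<nu> + 1), and that
      integrand also dominates.\<close>
    define F where "F n x = of_real (t n powr - \<nu>) * (exp (- of_real x) * (bessel_cyl (- 1) (of_real \<nu>) (of_real (t n * x)) / of_real x))" for n x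
    have FL: "F n absolutely_integrable_on {0<..}" "integral {0<..} (F n) = of_real (t n powr - \<nu>) * L (1 / t n)" for n
    proof -
      define s where "s = 1 / t n"
      have s: "s > 0" using t(1)[of n] by (simp add: s_def)
      define g where "g b = exp (- (complex_of_real s * of_real b)) * f b" for b
      have g: "g absolutely_integrable_on {0<..}"
        unfolding g_def [abs_def] using s by (intro laplace_ok_integrable ok) auto
      note sc = has_integral_scale_positive_reals[OF g t(1)[of n]]
      have eq: "F n x = of_real (t n powr - \<nu>) * (of_real (t n) * g (t n * x))" for x
        using t(1)[of n] by (simp add: F_def g_def f_def s_def)
      show "F n absolutely_integrable_on {0<..}"
        unfolding eq [abs_def] by (intro set_integrable_mult_right sc(1))
      have "integral {0<..} (F n) = of_real (t n powr - \<nu>) * (of_real (t n) * integral {0<..} (\<lambda>x. g (t n * x)))"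
        unfolding eq [abs_def] by simp
      also have "of_real (t n) * integral {0<..} (\<lambda>x. g (t n * x)) = L (1 / t n)"
      proof -
        have "L (1 / t n) = integral {0<..} g" by (simp only: L_def g_def [abs_def] s_def)
        then show ?thesis unfolding sc(2) using t(1)[of n] by simp
      qed
      finally show "integral {0<..} (F n) = of_real (t n powr - \<nu>) * L (1 / t n)" .
    qed
    have "(\<lambda>n. integral {0<..} (F n)) \<longlonglongrightarrow> integral {0<..} (\<lambda>x. of_real (2 powr - \<nu>) * rGamma (of_real \<nu> + 1) * h x)"
    proof (rule dominated_convergence)
      show "F n integrable_on {0<..}" for n using FL(1) set_lebesgue_integral_eq_integral(1) by blast
      show "(\<lambda>x. M * norm (h x)) integrable_on {0<..}"
        using h(1) by (intro integrable_on_mult_right) (simp add: absolutely_integrable_on_def)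
      show "norm (F n x) \<le> M * norm (h x)" if "x \<in> {0<..}" for n x
      proof -
        have x: "x > 0" using that by simp
        have "norm (bessel_cyl (- 1) (of_real \<nu>) (of_real (t n * x))) \<le> M * (t n powr \<nu> * x powr \<nu>)"
          using M(2)[of "t n * x"] t(1)[of n] x by (simp add: powr_mult)
        then have "t n powr - \<nu> * (exp (- x) * (norm (bessel_cyl (- 1) (of_real \<nu>) (of_real (t n * x))) / x)) \<le>
            t n powr - \<nu> * (exp (- x) * (M * (t n powr \<nu> * x powr \<nu>) / x))"
          using x by (intro mult_left_mono divide_right_mono) auto
        also have "\<dots> = M * (exp (- x) * x powr \<nu> / x)"
          using t(1)[of n] by (simp add: powr_minus field_simps)
        finally show ?thesis unfolding nh[OF x] using x
          by (simp add: F_def norm_mult norm_divide)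
      qed
      show "(\<lambda>n. F n x) \<longlonglongrightarrow> of_real (2 powr - \<nu>) * rGamma (of_real \<nu> + 1) * h x" if "x \<in> {0<..}" for x
      proof -
        have x: "x > 0" using that by simp
        have "(\<lambda>n. (of_real (t n powr - \<nu>) * bessel_cyl (- 1) (of_real \<nu>) (of_real (t n * x))) * (exp (- of_real x) / of_real x))
          \<longlonglongrightarrow> (of_real ((x / 2) powr \<nu>) * rGamma (of_real \<nu> + 1)) * (exp (- of_real x) / of_real x)"
          by (intro tendsto_mult_right bessel_J_small_argument_limit t x)
        moreover have "(of_real ((x / 2) powr \<nu>) * rGamma (of_real \<nu> + 1)) * (exp (- of_real x) / of_real x) =
            of_real (2 powr - \<nu>) * rGamma (of_real \<nu> + 1) * h x"
        proof -
          have "h x = of_real (x powr \<nu> / x / exp x)"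
            using x powr_of_real[of x "\<nu> - 1"] by (simp add: h_def powr_diff)
          moreover have "(x / 2) powr \<nu> = 2 powr - \<nu> * x powr \<nu>"
            using x by (simp add: powr_divide powr_minus field_simps)
          moreover have "exp (- complex_of_real x) = of_real (1 / exp x)"
            by (simp add: exp_minus inverse_eq_divide exp_of_real)
          ultimately show ?thesis by (simp add: mult_ac)
        qed
        ultimately show ?thesis by (simp add: F_def mult_ac)
      qed
    qed
    moreover have "integral {0<..} (\<lambda>x. of_real (2 powr - \<nu>) * rGamma (of_real \<nu> + 1) * h x) =
        of_real (2 powr - \<nu>) / of_real \<nu>"
    proof -
      have "of_real \<nu> * rGamma (of_real \<nu> + 1) = (rGamma (of_real \<nu>) :: complex)"
        by (rule rGamma_plus1)
      moreover have "rGamma (of_real \<nu>) * Gamma (of_real \<nu>) = (1 :: complex)"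
        using Gamma_real_pos[OF \<nu>] by (simp add: rGamma_inverse_Gamma Gamma_complex_of_real)
      ultimately have "of_real \<nu> * (rGamma (of_real \<nu> + 1) * Gamma (of_real \<nu>)) = (1 :: complex)"
        by (metis mult.assoc)
      then have "rGamma (of_real \<nu> + 1) * Gamma (of_real \<nu>) = (1 / of_real \<nu> :: complex)"
        using \<nu> by (simp add: field_simps)
      then show ?thesis using integral_unique[OF h(2)] by (simp add: mult.assoc)
    qed
    ultimately have lim: "(\<lambda>n. of_real (t n powr - \<nu>) * L (1 / t n)) \<longlonglongrightarrow> of_real (2 powr - \<nu>) / of_real \<nu>"
      by (simp add: FL(2))
    \<comment> \<open>r(1/t) behaves like 2/t, and this 2^\<nu> cancels the 2^(-\<nu>) in the limit
      of the transform.\<close>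
    have "(\<lambda>n. t n * r (1 / t n)) \<longlonglongrightarrow> 1 + sqrt (0\<^sup>2 + 1)"
    proof -
      have eq: "t n * r (1 / t n) = 1 + sqrt ((t n)\<^sup>2 + 1)" for n
      proof -
        have "t n * sqrt (1 + (1 / t n)\<^sup>2) = sqrt ((t n)\<^sup>2 * (1 + (1 / t n)\<^sup>2))"
          using t(1)[of n] by (simp add: real_sqrt_mult)
        also have "(t n)\<^sup>2 * (1 + (1 / t n)\<^sup>2) = (t n)\<^sup>2 + 1"
          using t(1)[of n] by (simp add: field_simps)
        finally show ?thesis using t(1)[of n] by (simp add: r_def rt_def distrib_left)
      qed
      show ?thesis unfolding eq by (intro tendsto_intros t(2))
    qed
    then have "(\<lambda>n. (t n * r (1 / t n)) powr \<nu>) \<longlonglongrightarrow> (1 + sqrt (0\<^sup>2 + 1)) powr \<nu>"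
      by (intro tendsto_powr tendsto_const) auto
    then have "(\<lambda>n. complex_of_real ((t n * r (1 / t n)) powr \<nu>)) \<longlonglongrightarrow> of_real (2 powr \<nu>)"
      by (intro tendsto_of_real) simp
    from tendsto_mult[OF lim this]
    have "(\<lambda>n. of_real (t n powr - \<nu>) * L (1 / t n) * of_real ((t n * r (1 / t n)) powr \<nu>)) \<longlonglongrightarrow>
      of_real (2 powr - \<nu>) / of_real \<nu> * of_real (2 powr \<nu>)" .
    moreover have "of_real (t n powr - \<nu>) * L (1 / t n) * of_real ((t n * r (1 / t n)) powr \<nu>) = d" for n
    proof -
      have "(t n * r (1 / t n)) powr \<nu> = t n powr \<nu> * r (1 / t n) powr \<nu>"
        by (rule powr_mult)
      moreover have "complex_of_real (t n powr - \<nu>) * of_real (t n powr \<nu>) = 1"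
        using t(1)[of n] by (simp add: powr_minus)
      moreover have "L (1 / t n) * of_real (r (1 / t n) powr \<nu>) = d"
        using t(1)[of n] by (intro d) simp
      moreover have "of_real (t n powr - \<nu>) * L (1 / t n) * of_real (t n powr \<nu> * r (1 / t n) powr \<nu>) =
          (complex_of_real (t n powr - \<nu>) * of_real (t n powr \<nu>)) * (L (1 / t n) * of_real (r (1 / t n) powr \<nu>))"
        by (simp add: mult_ac)
      ultimately show ?thesis by (simp only: mult_1_left)
    qed
    moreover have "of_real (2 powr - \<nu>) / of_real \<nu> * of_real (2 powr \<nu>) = (1 / of_real \<nu> :: complex)"
      by (simp add: powr_minus)
    ultimately show ?thesis by (simp only: LIMSEQ_const_iff)
  qed
  moreover have "integral {0<..} f = d"
  proof -
    define t :: "nat \<Rightarrow> real" where "t n = 1 / real (Suc n)" for n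
    have t: "t n > 0" "t \<longlonglongrightarrow> 0" for n
      unfolding t_def using LIMSEQ_inverse_real_of_nat by (auto simp: inverse_eq_divide)
    have "(\<lambda>n. integral {0<..} (\<lambda>b. exp (- (complex_of_real (t n) * of_real b)) * f b)) \<longlonglongrightarrow> integral {0<..} f"
    proof (rule dominated_convergence[OF _ nfint])
      show "(\<lambda>b. exp (- (complex_of_real (t n) * of_real b)) * f b) integrable_on {0<..}" for n
        using laplace_ok_integrable[OF ok, of "of_real (t n)"] t(1)[of n] set_lebesgue_integral_eq_integral(1) by simp
      show "norm (exp (- (complex_of_real (t n) * of_real b)) * f b) \<le> norm (f b)" if "b \<in> {0<..}" for n b
        using that t(1)[of n] mult_right_mono[of "exp (- (t n * b))" 1 "norm (f b)"] by (simp add: norm_mult)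
      show "(\<lambda>n. exp (- (complex_of_real (t n) * of_real b)) * f b) \<longlonglongrightarrow> f b" for b
        using t(2) by (auto intro!: tendsto_eq_intros)
    qed
    then have "(\<lambda>n. L (t n)) \<longlonglongrightarrow> integral {0<..} f" by (simp add: L_def)
    moreover have "(\<lambda>n. r (t n)) \<longlonglongrightarrow> 0 + sqrt (1 + 0\<^sup>2)"
      unfolding r_def rt_def using t(2) by (intro tendsto_intros)
    then have "(\<lambda>n. complex_of_real (r (t n) powr \<nu>)) \<longlonglongrightarrow> of_real ((0 + sqrt (1 + 0\<^sup>2)) powr \<nu>)"
      by (intro tendsto_of_real tendsto_powr tendsto_const) auto
    ultimately have "(\<lambda>n. L (t n) * of_real (r (t n) powr \<nu>)) \<longlonglongrightarrow> integral {0<..} f * of_real ((0 + sqrt (1 + 0\<^sup>2)) powr \<nu>)"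
      by (rule tendsto_mult)
    then show ?thesis using d[OF t(1)] by (simp add: LIMSEQ_const_iff)
  qed
  ultimately show "integral {0<..} (\<lambda>b. bessel_cyl (- 1) (of_real \<nu>) (of_real b) / of_real b) = 1 / of_real \<nu>"
    by (simp add: f_def [abs_def])
qed

subsection \<open>Behaviour at the origin\<close>

text \<open>The substitution t = s^2/(1 + s^2) maps the half-line onto (0, 1) and carries the
  integrand to half of the Beta integrand.\<close>

lemma integral_powr_times_one_plus_square:
  fixes \<nu> :: real
  assumes \<nu>: "0 < \<nu>" "\<nu> < 1"
  shows "(\<lambda>s. s powr \<nu> / sqrt (1 + s\<^sup>2) ^ 3) absolutely_integrable_on {0<..}"
    and "integral {0<..} (\<lambda>s. s powr \<nu> / sqrt (1 + s\<^sup>2) ^ 3) = Beta ((\<nu> + 1) / 2) (1 - \<nu> / 2) / 2"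
proof -
  define a b where "a = (\<nu> + 1) / 2" and "b = 1 - \<nu> / 2"
  define f where "f t = t powr (a - 1) * (1 - t) powr (b - 1)" for t :: real
  define g where "g s = s\<^sup>2 / (1 + s\<^sup>2)" for s :: real
  define g' where "g' s = 2 * s / (1 + s\<^sup>2)\<^sup>2" for s :: real
  have ab: "a > 0" "b > 0" using \<nu> by (auto simp: a_def b_def)
  have pos: "1 + s\<^sup>2 > 0" for s :: real by (simp add: add_pos_nonneg)
  have "(f has_integral Beta a b) {0<..<1}"
    using has_integral_Beta_real[OF ab] unfolding f_def [abs_def] by (simp add: has_integral_Icc_iff_Ioo)
  then have f: "f absolutely_integrable_on {0<..<1}" "integral {0<..<1} f = Beta a b"
    by (auto intro!: nonnegative_absolutely_integrable_1 simp: f_def has_integral_iff)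
  have im: "g ` {0<..} = {0<..<1}"
  proof (intro subset_antisym subsetI)
    fix y :: real assume "y \<in> {0<..<1}"
    then have y: "0 < y" "y < 1" by auto
    have "(sqrt (y / (1 - y)))\<^sup>2 = y / (1 - y)" using y by simp
    then have "g (sqrt (y / (1 - y))) = y" using y by (simp add: g_def field_simps)
    then show "y \<in> g ` {0<..}" using y by (intro image_eqI[of _ _ "sqrt (y / (1 - y))"]) auto
  next
    fix y :: real assume "y \<in> g ` {0<..}"
    then show "y \<in> {0<..<1}" using pos by (auto simp: g_def divide_simps)
  qed
  have inj: "inj_on g {0<..}"
  proof (rule inj_onI)
    fix s t :: real assume st: "s \<in> {0<..}" "t \<in> {0<..}" and "g s = g t"
    then have "s\<^sup>2 * (1 + t\<^sup>2) = t\<^sup>2 * (1 + s\<^sup>2)"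
      using pos[of s] pos[of t] by (simp add: g_def frac_eq_eq)
    then have "s\<^sup>2 = t\<^sup>2" by (simp add: algebra_simps)
    then show "s = t" using st by (simp add: power2_eq_iff_nonneg)
  qed
  have der: "(g has_field_derivative g' s) (at s within {0<..})" for s
  proof -
    have "(g has_field_derivative (2 * s * (1 + s\<^sup>2) - s\<^sup>2 * (2 * s)) / ((1 + s\<^sup>2) * (1 + s\<^sup>2))) (at s within {0<..})"
      unfolding g_def [abs_def] using pos[of s] by (auto intro!: derivative_eq_intros)
    also have "(2 * s * (1 + s\<^sup>2) - s\<^sup>2 * (2 * s)) / ((1 + s\<^sup>2) * (1 + s\<^sup>2)) = g' s"
      by (simp add: g'_def power2_eq_square algebra_simps)
    finally show ?thesis .
  qed
  have cv: "(\<lambda>s. \<bar>g' s\<bar> * f (g s)) absolutely_integrable_on {0<..} \<and>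
      integral {0<..} (\<lambda>s. \<bar>g' s\<bar> * f (g s)) = Beta a b"
    using has_absolute_integral_change_of_variables_1'[OF _ der inj, of f "Beta a b"] f by (simp add: im)
  have eq: "\<bar>g' s\<bar> * f (g s) = 2 * (s powr \<nu> / sqrt (1 + s\<^sup>2) ^ 3)" if s: "s > 0" for s
  proof -
    define q where "q = 1 + s\<^sup>2"
    have q: "q > 0" using pos by (simp add: q_def)
    have "1 - g s = 1 / q" using q by (simp add: g_def q_def field_simps)
    moreover have "g s powr (a - 1) = s powr (\<nu> - 1) * q powr ((1 - \<nu>) / 2)"
    proof -
      have "g s powr (a - 1) = (s\<^sup>2) powr (a - 1) / q powr (a - 1)"
        using s q by (simp add: g_def q_def powr_divide)
      also have "(s\<^sup>2) powr (a - 1) = (s powr 2) powr (a - 1)"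
        using s by simp
      also have "\<dots> = s powr (2 * (a - 1))" by (rule powr_powr)
      also have "2 * (a - 1) = \<nu> - 1" by (simp add: a_def)
      also have "s powr (\<nu> - 1) / q powr (a - 1) = s powr (\<nu> - 1) * q powr ((1 - \<nu>) / 2)"
      proof -
        have "(1 - \<nu>) / 2 = - (a - 1)" by (simp add: a_def field_simps)
        then show ?thesis by (simp only: powr_minus_divide) simp
      qed
      finally show ?thesis .
    qed
    moreover have "(1 / q) powr (b - 1) = q powr (\<nu> / 2)"
      using q powr_minus_divide[of q "\<nu> / 2"] by (simp add: b_def powr_divide)
    ultimately have "f (g s) = s powr (\<nu> - 1) * (q powr ((1 - \<nu>) / 2) * q powr (\<nu> / 2))"
      by (simp add: f_def mult.assoc)
    also have "q powr ((1 - \<nu>) / 2) * q powr (\<nu> / 2) = sqrt q"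
    proof -
      have "(1 - \<nu>) / 2 + \<nu> / 2 = 1 / 2" by (simp add: field_simps)
      then have "q powr ((1 - \<nu>) / 2) * q powr (\<nu> / 2) = q powr (1 / 2)"
        by (simp only: powr_add [symmetric])
      then show ?thesis using q by (simp add: powr_half_sqrt)
    qed
    also have "s powr (\<nu> - 1) = s powr \<nu> / s" using s by (simp add: powr_diff)
    finally have fg: "f (g s) = s powr \<nu> / s * sqrt q" .
    have gq: "\<bar>g' s\<bar> = 2 * s / q\<^sup>2" using s by (simp add: g'_def q_def)
    have q2: "q\<^sup>2 = sqrt q ^ 3 * sqrt q"
    proof -
      have "x ^ 3 * x = x\<^sup>2 * x\<^sup>2" for x :: real
        by (simp add: power2_eq_square power3_eq_cube)
      then have "sqrt q ^ 3 * sqrt q = (sqrt q)\<^sup>2 * (sqrt q)\<^sup>2" .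
      then show ?thesis using q by (simp add: power2_eq_square [of q])
    qed
    show ?thesis unfolding fg gq q2 q_def [symmetric] using s q by (simp add: field_simps)
  qed
  have "(\<lambda>s. \<bar>g' s\<bar> * f (g s)) absolutely_integrable_on {0<..} \<longleftrightarrow>
      (\<lambda>s. 2 * (s powr \<nu> / sqrt (1 + s\<^sup>2) ^ 3)) absolutely_integrable_on {0<..}"
    by (rule set_integrable_cong) (simp_all add: eq)
  then have 1: "(\<lambda>s. 2 * (s powr \<nu> / sqrt (1 + s\<^sup>2) ^ 3)) absolutely_integrable_on {0<..}"
    using cv by blast
  from set_integrable_mult_right[of "1 / 2", OF this]
  show "(\<lambda>s. s powr \<nu> / sqrt (1 + s\<^sup>2) ^ 3) absolutely_integrable_on {0<..}" by simp
  have "integral {0<..} (\<lambda>s. \<bar>g' s\<bar> * f (g s)) = integral {0<..} (\<lambda>s. 2 * (s powr \<nu> / sqrt (1 + s\<^sup>2) ^ 3))"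
    by (rule integral_cong) (simp add: eq)
  also have "\<dots> = 2 * integral {0<..} (\<lambda>s. s powr \<nu> / sqrt (1 + s\<^sup>2) ^ 3)"
    by (rule integral_mult_right)
  finally show "integral {0<..} (\<lambda>s. s powr \<nu> / sqrt (1 + s\<^sup>2) ^ 3) = Beta ((\<nu> + 1) / 2) (1 - \<nu> / 2) / 2"
    using cv by (simp add: a_def b_def)
qed

text \<open>Integration by parts: s^(\<nu> + 1) (1/sqrt(1 + s^2) - 1/s) vanishes at both ends and
  has derivative \<nu>h + s^\<nu>/(1 + s^2)^(3/2), whose second part is the Beta integral just
  computed.\<close>

lemma integral_powr_times_kernel_difference:
  fixes \<nu> :: real
  assumes \<nu>: "0 < \<nu>" "\<nu> < 1"
  defines "h \<equiv> \<lambda>s. s powr \<nu> * (1 / sqrt (1 + s\<^sup>2) - 1 / s)"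
  shows "h absolutely_integrable_on {0<..}"
    and "integral {0<..} h = - Beta ((\<nu> + 1) / 2) (1 - \<nu> / 2) / (2 * \<nu>)"
proof -
  have pos: "1 + s\<^sup>2 > 0" for s :: real by (simp add: add_pos_nonneg)
  define d where "d s = 1 / s - 1 / sqrt (1 + s\<^sup>2)" for s :: real
  have d0: "d s \<ge> 0" if s: "s > 0" for s
  proof -
    have "s \<le> sqrt (1 + s\<^sup>2)" by (rule real_le_rsqrt) simp
    then show ?thesis using s by (simp add: d_def frac_le)
  qed
  have d1: "d s \<le> 1 / s" for s by (simp add: d_def)
  \<comment> \<open>The difference gains two powers at infinity over 1/s, which is what makes
    \<open>h\<close> integrable there.\<close>
  have d3: "d s \<le> 1 / s ^ 3" if s: "s > 0" for s
  proof -
    define q where "q = sqrt (1 + s\<^sup>2)"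
    have q: "q > 0" "q\<^sup>2 = 1 + s\<^sup>2" "s \<le> q"
      using pos[of s] by (auto simp: q_def intro!: real_le_rsqrt)
    have "(q - s) * (q + s) = 1" using q(2) by (simp add: algebra_simps power2_eq_square)
    then have "q - s = 1 / (q + s)" using q s by (simp add: field_simps)
    then have "d s = 1 / (s * q * (q + s))" using q s by (simp add: d_def q_def [symmetric] divide_simps)
    also have "\<dots> \<le> 1 / (s * s * s)"
      using q s by (intro divide_left_mono mult_mono) auto
    finally show ?thesis by (simp add: power3_eq_cube)
  qed
  have hd: "h s = - (s powr \<nu> * d s)" for s by (simp add: h_def d_def algebra_simps)
  have nh: "norm (complex_of_real (h s)) = s powr \<nu> * d s" if "s > 0" for s
    using d0[OF that] by (simp only: norm_of_real hd abs_minus_cancel) simp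
  have hb: "norm (complex_of_real (h s)) \<le> bessel_dom (\<nu> - 1) s" if s: "s > 0" for s
  proof (cases "s \<le> 1")
    case True
    have "s powr \<nu> * d s \<le> s powr \<nu> * (1 / s)" using d1 by (intro mult_left_mono) auto
    then show ?thesis unfolding nh[OF s] using s True by (simp add: bessel_dom_def powr_diff)
  next
    case False
    have "s powr \<nu> * d s \<le> s powr 1 * (1 / s ^ 3)"
      using d3[OF s] d0[OF s] \<nu> False s by (intro mult_mono powr_mono) auto
    also have "\<dots> = s powr (- 2)"
      using s by (simp add: powr_minus power3_eq_cube power2_eq_square field_simps)
    also have "\<dots> \<le> s powr (- 3 / 2)" using False by (intro powr_mono) auto
    finally show ?thesis unfolding nh[OF s] using False by (simp add: bessel_dom_def)
  qed
  have hc: "(\<lambda>s. complex_of_real (h s)) absolutely_integrable_on {0<..}"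
  proof (rule absolutely_integrable_continuous_bounded)
    show "continuous_on {0<..} (\<lambda>s. complex_of_real (h s))"
      unfolding h_def using pos by (intro continuous_intros) (auto simp: less_imp_neq[symmetric])
    show "bessel_dom (\<nu> - 1) integrable_on {0<..}" using \<nu> by (intro bessel_dom_integrable) auto
  qed (rule hb)
  have "(\<lambda>s. Re (complex_of_real (h s))) absolutely_integrable_on {0<..}"
    using absolutely_integrable_linear[OF hc bounded_linear_Re] by (simp add: o_def)
  then show h: "h absolutely_integrable_on {0<..}" by simp
  define F where "F s = s powr (\<nu> + 1) * (1 / sqrt (1 + s\<^sup>2) - 1 / s)" for s :: real
  define F' where "F' s = \<nu> * h s + s powr \<nu> / sqrt (1 + s\<^sup>2) ^ 3" for s :: real
  note B = integral_powr_times_one_plus_square[OF \<nu>]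
  have F'int: "F' absolutely_integrable_on {0<..}"
    unfolding F'_def [abs_def] by (intro set_integral_add(1) set_integrable_mult_right h B(1))
  have der: "((\<lambda>s. complex_of_real (F s)) has_vector_derivative complex_of_real (F' s)) (at s)" if s: "s > 0" for s
  proof (rule has_vector_derivative_of_real)
    define q where "q = sqrt (1 + s\<^sup>2)"
    have q: "q > 0" "q\<^sup>2 = 1 + s\<^sup>2" using pos[of s] by (auto simp: q_def)
    have dq: "((\<lambda>s. sqrt (1 + s\<^sup>2)) has_real_derivative s / sqrt (1 + s\<^sup>2)) (at s)"
      using pos[of s] by (auto intro!: derivative_eq_intros simp: field_simps)
    have "sqrt (1 + s\<^sup>2) \<noteq> 0" "s \<noteq> 0" using pos[of s] s by auto
    note DERIV_diff[OF DERIV_divide[OF DERIV_const dq this(1)] DERIV_divide[OF DERIV_const DERIV_ident this(2)]]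
    then have "((\<lambda>s. 1 / sqrt (1 + s\<^sup>2) - 1 / s) has_real_derivative
        (0 * q - 1 * (s / q)) / (q * q) - (0 * s - 1 * 1) / (s * s)) (at s)"
      unfolding q_def .
    from DERIV_mult[OF has_real_derivative_powr[OF s, of "\<nu> + 1"] this]
    have "(F has_real_derivative ((\<nu> + 1) * s powr (\<nu> + 1 - 1) * (1 / q - 1 / s) +
       ((0 * q - 1 * (s / q)) / (q * q) - (0 * s - 1 * 1) / (s * s)) * s powr (\<nu> + 1))) (at s)"
      by (simp add: F_def [abs_def] q_def)
    moreover have "(\<nu> + 1) * s powr (\<nu> + 1 - 1) * (1 / q - 1 / s) +
       ((0 * q - 1 * (s / q)) / (q * q) - (0 * s - 1 * 1) / (s * s)) * s powr (\<nu> + 1) = F' s"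
    proof -
      have p: "s powr (\<nu> + 1) = s powr \<nu> * s" using s by (simp add: powr_add)
      have s2: "s * s = q * q - 1" using q(2) by (simp add: power2_eq_square)
      have "(\<nu> + 1) * s powr \<nu> * (1 / q - 1 / s) + (- (s / q) / (q * q) + 1 / (s * s)) * (s powr \<nu> * s) =
          s powr \<nu> * ((\<nu> + 1) * (1 / q - 1 / s) - (s * s) / q ^ 3 + 1 / s)"
        using s q by (simp add: field_simps power3_eq_cube)
      also have "\<dots> = s powr \<nu> * (\<nu> * (1 / q - 1 / s) + 1 / q ^ 3)"
        unfolding s2 using s q by (simp add: field_simps power3_eq_cube)
      also have "\<dots> = F' s" by (simp add: F'_def h_def q_def algebra_simps)
      finally show ?thesis by (simp add: p)
    qed
    ultimately show "(F has_real_derivative F' s) (at s)" by simp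
  qed
  have FF: "F s = - (s powr (\<nu> + 1) * d s)" for s by (simp add: F_def d_def algebra_simps)
  have nF: "norm (complex_of_real (F s)) = s powr (\<nu> + 1) * d s" if "s > 0" for s
    using d0[OF that] by (simp only: norm_of_real FF abs_minus_cancel) simp
  have lim0: "((\<lambda>s. complex_of_real (F s)) \<longlongrightarrow> 0) (at_right 0)"
  proof (rule Lim_null_comparison)
    show "\<forall>\<^sub>F s in at_right 0. norm (complex_of_real (F s)) \<le> s powr \<nu>"
      using eventually_at_right_less[of "0 :: real"]
    proof eventually_elim
      case (elim s)
      have "s powr (\<nu> + 1) * d s \<le> s powr (\<nu> + 1) * (1 / s)" using d1 by (intro mult_left_mono) auto
      then show ?case unfolding nF[OF elim] using elim by (simp add: powr_add)
    qed
    show "((\<lambda>s. s powr \<nu>) \<longlongrightarrow> 0) (at_right 0)"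
    proof (rule tendsto_zero_powrI)
      show "\<forall>\<^sub>F x in at_right 0. 0 \<le> (x :: real)"
        by (rule eventually_at_right_less [THEN eventually_mono]) auto
    qed (use \<nu> in \<open>auto intro!: tendsto_eq_intros\<close>)
  qed
  have liminf: "((\<lambda>s. complex_of_real (F s)) \<longlongrightarrow> 0) at_top"
  proof (rule Lim_null_comparison)
    show "\<forall>\<^sub>F s in at_top. norm (complex_of_real (F s)) \<le> s powr (- 1)"
      using eventually_gt_at_top[of 1]
    proof eventually_elim
      case (elim s)
      then have s: "s > 0" by simp
      have "s powr (\<nu> + 1) * d s \<le> s powr 2 * (1 / s ^ 3)"
        using d3[OF s] d0[OF s] \<nu> elim by (intro mult_mono powr_mono) auto
      also have "\<dots> = s powr (- 1)"
        using s by (simp add: powr_minus power3_eq_cube power2_eq_square field_simps)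
      finally show ?case unfolding nF[OF s] .
    qed
    show "((\<lambda>s :: real. s powr (- 1)) \<longlongrightarrow> 0) at_top"
      by (rule tendsto_neg_powr) (auto intro: filterlim_ident)
  qed
  have "(\<lambda>s. complex_of_real (F' s)) absolutely_integrable_on {0<..}"
    using absolutely_integrable_linear[OF F'int bounded_linear_of_real[where 'a = complex]] by (simp add: o_def)
  from integral_FTC_positive_reals[OF der this lim0 liminf]
  have "integral {0<..} (\<lambda>s. complex_of_real (F' s)) = 0 - 0" .
  moreover have "integral {0<..} (\<lambda>s. complex_of_real (F' s)) = of_real (integral {0<..} F')"
    using integral_linear[OF set_lebesgue_integral_eq_integral(1)[OF F'int] bounded_linear_of_real[where 'a = complex]]
    by (simp add: o_def)
  moreover have "integral {0<..} F' = \<nu> * integral {0<..} h + Beta ((\<nu> + 1) / 2) (1 - \<nu> / 2) / 2"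
    unfolding F'_def [abs_def] B(2) [symmetric] using h B(1)
    by (simp add: integral_add integrable_on_mult_right set_lebesgue_integral_eq_integral(1))
  ultimately have "complex_of_real (\<nu> * integral {0<..} h + Beta ((\<nu> + 1) / 2) (1 - \<nu> / 2) / 2) = 0"
    by (simp only: diff_self)
  then have "\<nu> * integral {0<..} h + Beta ((\<nu> + 1) / 2) (1 - \<nu> / 2) / 2 = 0"
    by (simp only: of_real_eq_0_iff)
  then show "integral {0<..} h = - Beta ((\<nu> + 1) / 2) (1 - \<nu> / 2) / (2 * \<nu>)"
    using \<nu> by (simp add: field_simps)
qed

text \<open>Subtracting Weber's integral replaces the kernel by 1/sqrt(b^2 + 4x^2) - 1/b. Scaling b
  by 2x extracts x^\<nu>, and J may be replaced by its leading term because the global power bound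
  on J gives an integrable majorant.\<close>

lemma bessel_G_small_argument:
  fixes \<nu> :: real and x :: "nat \<Rightarrow> real"
  assumes \<nu>: "0 < \<nu>" "\<nu> < 1" and x: "\<And>n. x n > 0" "x \<longlonglongrightarrow> 0"
  shows "(\<lambda>n. of_real (x n powr - \<nu>) * (bessel_G 0 (of_real \<nu>) (of_real (x n)) - 1 / of_real \<nu>)) \<longlonglongrightarrow>
    - rGamma (of_real \<nu> + 1) * of_real (Beta ((\<nu> + 1) / 2) (1 - \<nu> / 2) / (2 * \<nu>))"
proof -
  define J where "J b = bessel_cyl (- 1) (of_real \<nu>) (of_real b)" for b
  define k where "k s = 1 / sqrt (1 + s\<^sup>2) - 1 / s" for s :: real
  obtain M where M: "M > 0" "\<And>b. b > 0 \<Longrightarrow> norm (bessel_cyl (- 1) (of_real \<nu>) (of_real b)) \<le> M * b powr \<nu>"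
    "\<And>b. b > 0 \<Longrightarrow> norm (bessel_cyl (- 1) (of_real \<nu>) (of_real b)) \<le> M * b * bessel_dom (\<nu> - 1) b"
    using bessel_J_bound_real_order[OF \<nu>(1)] by blast
  \<comment> \<open>At b = 2x s the root becomes 2x sqrt(1 + s^2).\<close>
  define t where "t n = 2 * x n" for n
  have t: "t n > 0" "t \<longlonglongrightarrow> 0" for n
    using x by (auto simp: t_def [abs_def] intro!: tendsto_eq_intros)
  have tx: "x n powr - \<nu> = 2 powr \<nu> * t n powr - \<nu>" for n
    using x(1)[of n] by (simp add: t_def powr_mult powr_minus field_simps)
  define F where "F n s = of_real (x n powr - \<nu>) * (J (t n * s) * of_real (k s))" for n s
  note h = integral_powr_times_kernel_difference[OF \<nu>, folded k_def]
  have F: "F n absolutely_integrable_on {0<..}"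
    "integral {0<..} (F n) = of_real (x n powr - \<nu>) * (bessel_G 0 (of_real \<nu>) (of_real (x n)) - 1 / of_real \<nu>)" for n
  proof -
    have Re: "Re (complex_of_real \<nu>) > - 1" "Re (complex_of_real (x n)) > 0" using \<nu> x by auto
    define f1 where "f1 b = J b / ker_root (of_real (x n)) b" for b
    define f2 where "f2 b = J b / of_real b" for b
    have f1: "f1 absolutely_integrable_on {0<..}" "integral {0<..} f1 = bessel_G 0 (of_real \<nu>) (of_real (x n))"
      using bessel_G_absolutely_integrable[OF Re, of 0] by (simp_all add: f1_def [abs_def] bessel_G_def J_def)
    have f2: "f2 absolutely_integrable_on {0<..}" "integral {0<..} f2 = 1 / of_real \<nu>"
      using weber_integral[OF \<nu>(1)] by (simp_all add: f2_def [abs_def] J_def)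
    have kr: "ker_root (of_real (x n)) (t n * s) = of_real (t n * sqrt (1 + s\<^sup>2))" if "s > 0" for s
    proof -
      have "(of_real (t n * s))\<^sup>2 + 4 * (complex_of_real (x n))\<^sup>2 = of_real ((t n)\<^sup>2 * (1 + s\<^sup>2))"
        by (simp add: t_def power2_eq_square algebra_simps)
      then have "ker_root (of_real (x n)) (t n * s) = csqrt (of_real ((t n)\<^sup>2 * (1 + s\<^sup>2)))"
        by (simp only: ker_root_def)
      also have "\<dots> = of_real (sqrt ((t n)\<^sup>2 * (1 + s\<^sup>2)))"
        by (subst csqrt_of_real_nonneg) simp_all
      finally show ?thesis using t(1)[of n] by (simp add: real_sqrt_mult)
    qed
    have eq: "F n s = of_real (x n powr - \<nu>) * (of_real (t n) * (f1 (t n * s) - f2 (t n * s)))" if s: "s > 0" for s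
    proof -
      have "sqrt (1 + s\<^sup>2) > 0" by (simp add: add_pos_nonneg)
      then show ?thesis
        unfolding F_def f1_def f2_def kr[OF s] k_def using t(1)[of n] s
        by (simp add: field_simps)
    qed
    note sc1 = has_integral_scale_positive_reals[OF f1(1) t(1)[of n]]
    note sc2 = has_integral_scale_positive_reals[OF f2(1) t(1)[of n]]
    have I: "(\<lambda>s. of_real (x n powr - \<nu>) * (of_real (t n) * (f1 (t n * s) - f2 (t n * s)))) absolutely_integrable_on {0<..}"
      by (intro set_integrable_mult_right set_integral_diff(1) sc1(1) sc2(1))
    have "F n absolutely_integrable_on {0<..} \<longleftrightarrow>
        (\<lambda>s. of_real (x n powr - \<nu>) * (of_real (t n) * (f1 (t n * s) - f2 (t n * s)))) absolutely_integrable_on {0<..}"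
      by (rule set_integrable_cong) (simp_all add: eq)
    then show "F n absolutely_integrable_on {0<..}" using I by blast
    have "integral {0<..} (F n) = integral {0<..} (\<lambda>s. of_real (x n powr - \<nu>) * (of_real (t n) * (f1 (t n * s) - f2 (t n * s))))"
      by (rule integral_cong) (simp add: eq)
    also have "\<dots> = of_real (x n powr - \<nu>) * (of_real (t n) * (integral {0<..} f1 / of_real (t n) - integral {0<..} f2 / of_real (t n)))"
      using sc1 sc2 by (simp add: integral_diff set_lebesgue_integral_eq_integral(1))
    also have "\<dots> = of_real (x n powr - \<nu>) * (bessel_G 0 (of_real \<nu>) (of_real (x n)) - 1 / of_real \<nu>)"
      unfolding f1(2) f2(2) using t(1)[of n] by (simp add: right_diff_distrib)
    finally show "integral {0<..} (F n) = of_real (x n powr - \<nu>) * (bessel_G 0 (of_real \<nu>) (of_real (x n)) - 1 / of_real \<nu>)" .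
  qed
  have "(\<lambda>n. integral {0<..} (F n)) \<longlonglongrightarrow> integral {0<..} (\<lambda>s. rGamma (of_real \<nu> + 1) * of_real (s powr \<nu> * k s))"
  proof (rule dominated_convergence)
    show "F n integrable_on {0<..}" for n using F(1) set_lebesgue_integral_eq_integral(1) by blast
    show "(\<lambda>s. M * 2 powr \<nu> * norm (s powr \<nu> * k s)) integrable_on {0<..}"
      using h(1) unfolding absolutely_integrable_on_def by (intro integrable_on_mult_right) (simp add: k_def)
    show "norm (F n s) \<le> M * 2 powr \<nu> * norm (s powr \<nu> * k s)" if "s \<in> {0<..}" for n s
    proof -
      have s: "s > 0" using that by simp
      have "norm (J (t n * s)) \<le> M * (t n powr \<nu> * s powr \<nu>)"
        using M(2)[of "t n * s"] t(1)[of n] s by (simp add: J_def powr_mult)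
      then have "x n powr - \<nu> * (norm (J (t n * s)) * \<bar>k s\<bar>) \<le> x n powr - \<nu> * (M * (t n powr \<nu> * s powr \<nu>) * \<bar>k s\<bar>)"
        by (intro mult_left_mono mult_right_mono) auto
      also have "\<dots> = M * 2 powr \<nu> * (s powr \<nu> * \<bar>k s\<bar>)"
        unfolding tx using t(1)[of n] by (simp add: powr_minus field_simps)
      finally show ?thesis by (simp add: F_def norm_mult abs_mult)
    qed
    show "(\<lambda>n. F n s) \<longlonglongrightarrow> rGamma (of_real \<nu> + 1) * of_real (s powr \<nu> * k s)" if "s \<in> {0<..}" for s
    proof -
      have s: "s > 0" using that by simp
      have "(\<lambda>n. of_real (2 powr \<nu> * k s) * (of_real (t n powr - \<nu>) * bessel_cyl (- 1) (of_real \<nu>) (of_real (t n * s)))) \<longlonglongrightarrow>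
          of_real (2 powr \<nu> * k s) * (of_real ((s / 2) powr \<nu>) * rGamma (of_real \<nu> + 1))"
        by (intro tendsto_mult_left bessel_J_small_argument_limit t s)
      moreover have "of_real (2 powr \<nu> * k s) * (of_real ((s / 2) powr \<nu>) * rGamma (of_real \<nu> + 1)) =
          rGamma (of_real \<nu> + 1) * (of_real (s powr \<nu> * k s) :: complex)"
        using s by (simp add: powr_divide)
      moreover have "F n s = of_real (2 powr \<nu> * k s) * (of_real (t n powr - \<nu>) * bessel_cyl (- 1) (of_real \<nu>) (of_real (t n * s)))" for n
        unfolding F_def tx J_def by simp
      ultimately show ?thesis by (simp only:)
    qed
  qed
  moreover have "integral {0<..} (\<lambda>s. rGamma (of_real \<nu> + 1) * (of_real (s powr \<nu> * k s) :: complex)) =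
      - rGamma (of_real \<nu> + 1) * of_real (Beta ((\<nu> + 1) / 2) (1 - \<nu> / 2) / (2 * \<nu>))"
  proof -
    have "integral {0<..} (\<lambda>s. complex_of_real (s powr \<nu> * k s)) = of_real (integral {0<..} (\<lambda>s. s powr \<nu> * k s))"
      using integral_linear[OF set_lebesgue_integral_eq_integral(1)[OF h(1)] bounded_linear_of_real[where 'a = complex]]
      by (simp add: o_def k_def)
    also have "integral {0<..} (\<lambda>s. s powr \<nu> * k s) = - Beta ((\<nu> + 1) / 2) (1 - \<nu> / 2) / (2 * \<nu>)"
      using h(2) by (simp add: k_def)
    finally show ?thesis by (subst integral_mult_right) simp
  qed
  ultimately show ?thesis by (simp add: F(2))
qed

subsection \<open>Closed form for positive arguments\<close>

text \<open>The Beta value is a quotient of Gammas over Gamma(3/2) = sqrt(pi)/2, and Legendre's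
  formula at \<mu> + 1/2 removes Gamma(2\<mu> + 1). This identity gives the relation
  \<open>A = - B\<close> below.\<close>

lemma beta_duplication:
  fixes \<mu> :: real
  assumes \<mu>: "0 < \<mu>" "\<mu> < 1 / 2"
  shows "2 powr (2 * \<mu>) * rGamma (2 * \<mu> + 1) * (Beta ((2 * \<mu> + 1) / 2) (1 - 2 * \<mu> / 2) / 2) * rGamma (1 - \<mu>)
    = rGamma (\<mu> + 1)"
proof -
  have pos: "Gamma (\<mu> + 1 / 2) > 0" "Gamma (\<mu> + 1) > 0" "Gamma (2 * \<mu> + 1) > 0" "Gamma (1 - \<mu>) > 0"
    using \<mu> by (auto intro!: Gamma_real_pos)
  have "complex_of_real (\<mu> + 1 / 2) \<notin> \<int>\<^sub>\<le>\<^sub>0" "complex_of_real (\<mu> + 1 / 2) + 1 / 2 \<notin> \<int>\<^sub>\<le>\<^sub>0"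
    using \<mu> by (auto elim!: nonpos_Ints_cases simp: complex_eq_iff)
  from Gamma_legendre_duplication[OF this]
  have "Gamma (complex_of_real (\<mu> + 1 / 2)) * Gamma (complex_of_real (\<mu> + 1)) =
      exp (complex_of_real (- 2 * \<mu> * ln 2)) * of_real (sqrt pi) * Gamma (complex_of_real (2 * \<mu> + 1))"
    by (simp add: algebra_simps)
  then have "complex_of_real (Gamma (\<mu> + 1 / 2) * Gamma (\<mu> + 1)) =
      of_real (exp (- 2 * \<mu> * ln 2) * sqrt pi * Gamma (2 * \<mu> + 1))"
    by (simp only: Gamma_complex_of_real exp_of_real of_real_mult [symmetric])
  then have dup: "Gamma (\<mu> + 1 / 2) * Gamma (\<mu> + 1) = exp (- 2 * \<mu> * ln 2) * sqrt pi * Gamma (2 * \<mu> + 1)"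
    by (simp only: of_real_eq_iff)
  have e: "2 powr (2 * \<mu>) * exp (- 2 * \<mu> * ln 2) = (1 :: real)"
    by (simp add: powr_def flip: exp_add)
  have "(1 / 2 :: real) \<notin> \<int>\<^sub>\<le>\<^sub>0" using nonpos_Ints_nonpos[of "1 / 2 :: real"] by auto
  then have G: "Gamma (3 / 2 :: real) = sqrt pi / 2"
    using Gamma_plus1[of "1 / 2 :: real"] by (simp add: Gamma_one_half_real)
  have s1: "(2 * \<mu> + 1) / 2 + (1 - 2 * \<mu> / 2) = 3 / 2" and s2: "(2 * \<mu> + 1) / 2 = \<mu> + 1 / 2"
    and s3: "1 - 2 * \<mu> / 2 = 1 - \<mu>"
    by (simp_all add: field_simps)
  have B: "Beta ((2 * \<mu> + 1) / 2) (1 - 2 * \<mu> / 2) / 2 = Gamma (\<mu> + 1 / 2) * Gamma (1 - \<mu>) / sqrt pi"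
    unfolding Beta_def s1 G unfolding s2 s3 by simp
  have "2 powr (2 * \<mu>) * (Gamma (\<mu> + 1 / 2) * Gamma (\<mu> + 1)) = sqrt pi * Gamma (2 * \<mu> + 1)"
    unfolding dup using e by (simp add: mult.assoc [symmetric])
  then have "2 powr (2 * \<mu>) * Gamma (\<mu> + 1 / 2) = sqrt pi * Gamma (2 * \<mu> + 1) / Gamma (\<mu> + 1)"
    using pos by (simp add: field_simps)
  then have "2 powr (2 * \<mu>) * Gamma (\<mu> + 1 / 2) / (sqrt pi * Gamma (2 * \<mu> + 1)) = 1 / Gamma (\<mu> + 1)"
    using pos by simp
  moreover have "2 powr (2 * \<mu>) * rGamma (2 * \<mu> + 1) * (Gamma (\<mu> + 1 / 2) * Gamma (1 - \<mu>) / sqrt pi) * rGamma (1 - \<mu>) =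
      2 powr (2 * \<mu>) * Gamma (\<mu> + 1 / 2) / (sqrt pi * Gamma (2 * \<mu> + 1))"
    using pos by (simp add: rGamma_inverse_Gamma field_simps)
  ultimately show ?thesis unfolding B by (simp add: rGamma_inverse_Gamma inverse_eq_divide)
qed

lemma rGamma_plus_1_minus:
  "\<mu> * (rGamma (\<mu> + 1) * rGamma (1 - \<mu>)) = sin (of_real pi * \<mu>) / (of_real pi :: complex)"
  unfolding rGamma_reflection_complex [symmetric] rGamma_plus1 [of \<mu>, symmetric] by (simp add: mult.assoc)

text \<open>Near the origin I_\<mu>^2, I_\<mu> I_(-\<mu>) and I_(-\<mu>)^2 have sizes p, 1 and 1/p
  with p = (x/2)^(2\<mu>) tending to 0, so the three coefficients appear at different orders of the
  expansion of G.\<close>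

lemma bessel_G_closed_form_interval:
  fixes \<mu> :: real
  assumes \<mu>: "0 < \<mu>" "\<mu> < 1 / 2" and \<alpha>: "Re \<alpha> > 0"
  shows "bessel_G 0 (of_real (2 * \<mu>)) \<alpha> * sin (of_real pi * of_real \<mu>) =
    of_real pi / 2 * (bessel_cyl 1 (of_real \<mu>) \<alpha> * (bessel_cyl 1 (- of_real \<mu>) \<alpha> - bessel_cyl 1 (of_real \<mu>) \<alpha>))"
proof -
  define m where "m = complex_of_real \<mu>"
  have m0: "m \<noteq> 0" using \<mu> by (simp add: m_def)
  have "m \<notin> \<int>" using \<mu> by (auto simp: m_def complex_eq_iff elim!: Ints_cases)
  moreover have "Re m > - 1 / 2" using \<mu> by (simp add: m_def)
  ultimately obtain A B C where rep: "\<And>\<alpha>. Re \<alpha> > 0 \<Longrightarrow> bessel_G 0 (2 * m) \<alpha> =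
    A * (bessel_cyl 1 m \<alpha>)\<^sup>2 + B * (bessel_cyl 1 m \<alpha> * bessel_cyl 1 (- m) \<alpha>) + C * (bessel_cyl 1 (- m) \<alpha>)\<^sup>2"
    by (rule bessel_G_representation) blast
  define x :: "nat \<Rightarrow> real" where "x n = 1 / real (Suc n)" for n
  have x: "x n > 0" "x \<longlonglongrightarrow> 0" for n
    unfolding x_def using LIMSEQ_inverse_real_of_nat by (auto simp: inverse_eq_divide)
  define w where "w n = (complex_of_real (x n) / 2)\<^sup>2" for n
  define e1 e2 where "e1 n = bessel_E m (w n)" and "e2 n = bessel_E (- m) (w n)" for n
  define p where "p n = (x n / 2) powr (2 * \<mu>)" for n
  define r1 r2 where "r1 = rGamma (m + 1)" and "r2 = rGamma (1 - m)"
  define g where "g n = bessel_G 0 (2 * m) (of_real (x n))" for n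
  have p: "p n > 0" for n using x(1)[of n] by (simp add: p_def)
  have p0: "(\<lambda>n. complex_of_real (p n)) \<longlonglongrightarrow> 0"
  proof -
    have "(\<lambda>n. x n / 2) \<longlonglongrightarrow> 0" using x(2) by (auto intro!: tendsto_eq_intros)
    then have "p \<longlonglongrightarrow> 0" unfolding p_def using \<mu> x(1)
      by (intro tendsto_zero_powrI[where b = "2 * \<mu>"] tendsto_const always_eventually) (auto intro: less_imp_le)
    then show ?thesis using tendsto_of_real[of p 0] by simp
  qed
  have w0: "w \<longlonglongrightarrow> 0"
  proof -
    have "(\<lambda>n. complex_of_real (x n)) \<longlonglongrightarrow> of_real 0" by (rule tendsto_of_real[OF x(2)])
    then have "(\<lambda>n. (complex_of_real (x n) / 2)\<^sup>2) \<longlonglongrightarrow> (of_real 0 / 2)\<^sup>2"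
      by (rule tendsto_power[OF tendsto_divide[OF _ tendsto_const]]) simp
    then show ?thesis by (simp add: w_def [abs_def])
  qed
  have e1: "e1 \<longlonglongrightarrow> r1" and e2: "e2 \<longlonglongrightarrow> r2"
    using isCont_tendsto_compose[OF DERIV_isCont[OF has_field_derivative_bessel_E[of m 0]] w0]
      isCont_tendsto_compose[OF DERIV_isCont[OF has_field_derivative_bessel_E[of "- m" 0]] w0]
    by (simp_all add: e1_def [abs_def] e2_def [abs_def] r1_def r2_def)
  have r12: "m * (r1 * r2) = sin (of_real pi * m) / of_real pi"
    unfolding r1_def r2_def by (rule rGamma_plus_1_minus)
  have sn: "sin (of_real pi * m) \<noteq> 0"
  proof -
    have "sin (pi * \<mu>) > 0" using \<mu> by (intro sin_gt_zero) auto
    moreover have "sin (of_real pi * m) = of_real (sin (pi * \<mu>))"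
      by (simp only: m_def sin_of_real of_real_mult [symmetric])
    ultimately show ?thesis by simp
  qed
  have r0: "r1 \<noteq> 0" "r2 \<noteq> 0" using r12 sn by auto
  have g_eq: "g n = A * (of_real (p n) * (e1 n)\<^sup>2) + B * (e1 n * e2 n) + C * ((e2 n)\<^sup>2 / of_real (p n))" for n
  proof -
    define u where "u = (complex_of_real (x n) / 2) powr m"
    have nz: "complex_of_real (x n) \<noteq> 0" using x(1)[of n] by simp
    then have u0: "u \<noteq> 0" by (simp add: u_def)
    have um: "(complex_of_real (x n) / 2) powr (- m) = inverse u" using nz by (simp add: u_def powr_minus)
    have "u = of_real ((x n / 2) powr \<mu>)"
      using powr_of_real[of "x n / 2" \<mu>] x(1)[of n] by (simp add: u_def m_def)
    moreover have "((x n / 2) powr \<mu>)\<^sup>2 = p n"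
      by (simp add: p_def power2_eq_square flip: powr_add)
    ultimately have u2: "u\<^sup>2 = of_real (p n)" by (simp flip: of_real_power)
    show ?thesis
      unfolding g_def rep[of "of_real (x n)", simplified, OF x(1)] u2 [symmetric]
      unfolding bessel_cyl_def um u_def [symmetric] e1_def e2_def w_def using u0
      by (simp add: power_mult_distrib field_simps)
  qed
  define L :: complex where "L = - of_real (2 powr (2 * \<mu>)) * (rGamma (of_real (2 * \<mu>) + 1) *
      of_real (Beta ((2 * \<mu> + 1) / 2) (1 - 2 * \<mu> / 2) / (2 * (2 * \<mu>))))"
  have lim: "(\<lambda>n. (g n - 1 / (2 * m)) / of_real (p n)) \<longlonglongrightarrow> L"
  proof -
    have "(\<lambda>n. of_real (2 powr (2 * \<mu>)) * (of_real (x n powr - (2 * \<mu>)) * (bessel_G 0 (of_real (2 * \<mu>)) (of_real (x n)) - 1 / of_real (2 * \<mu>))))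
        \<longlonglongrightarrow> of_real (2 powr (2 * \<mu>)) * (- rGamma (of_real (2 * \<mu>) + 1) * of_real (Beta ((2 * \<mu> + 1) / 2) (1 - 2 * \<mu> / 2) / (2 * (2 * \<mu>))))"
      by (intro tendsto_mult_left bessel_G_small_argument x) (use \<mu> in auto)
    moreover have "of_real (2 powr (2 * \<mu>)) * (of_real (x n powr - (2 * \<mu>)) * (bessel_G 0 (of_real (2 * \<mu>)) (of_real (x n)) - 1 / of_real (2 * \<mu>)))
        = (g n - 1 / (2 * m)) / of_real (p n)" for n
    proof -
      have "2 powr (2 * \<mu>) * x n powr - (2 * \<mu>) = 1 / p n"
        using x(1)[of n] by (simp add: p_def powr_divide powr_minus field_simps)
      then have "complex_of_real (2 powr (2 * \<mu>)) * of_real (x n powr - (2 * \<mu>)) = 1 / of_real (p n)"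
        by (simp only: of_real_mult [symmetric] of_real_divide of_real_1)
      then show ?thesis
        by (simp add: g_def m_def mult.assoc [symmetric])
    qed
    ultimately show ?thesis by (simp add: L_def)
  qed
  have g1: "g \<longlonglongrightarrow> 1 / (2 * m)"
  proof -
    have "(\<lambda>n. (g n - 1 / (2 * m)) / of_real (p n) * of_real (p n) + 1 / (2 * m)) \<longlonglongrightarrow> L * 0 + 1 / (2 * m)"
      by (intro tendsto_intros lim p0)
    then show ?thesis using p by (simp add: less_imp_neq[symmetric])
  qed
  \<comment> \<open>G stays bounded, so p G tends to 0, while the term with 1/p would contribute C
    r2^2 with r2 nonzero.\<close>
  have C0: "C = 0"
  proof -
    have "(\<lambda>n. of_real (p n) * g n) \<longlonglongrightarrow> 0 * (1 / (2 * m))" by (intro tendsto_intros p0 g1)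
    moreover have "(\<lambda>n. A * (of_real (p n) * (of_real (p n) * (e1 n)\<^sup>2)) + B * (of_real (p n) * (e1 n * e2 n)) + C * (e2 n)\<^sup>2)
        \<longlonglongrightarrow> A * (0 * (0 * r1\<^sup>2)) + B * (0 * (r1 * r2)) + C * r2\<^sup>2"
      by (intro tendsto_intros p0 e1 e2)
    moreover have "of_real (p n) * g n = A * (of_real (p n) * (of_real (p n) * (e1 n)\<^sup>2)) + B * (of_real (p n) * (e1 n * e2 n)) + C * (e2 n)\<^sup>2" for n
      unfolding g_eq using p[of n] by (simp add: distrib_left mult_ac)
    ultimately have "0 * (1 / (2 * m)) = A * (0 * (0 * r1\<^sup>2)) + B * (0 * (r1 * r2)) + C * r2\<^sup>2"
      by (simp only: LIMSEQ_unique)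
    then show ?thesis using r0 by simp
  qed
  have B: "B * (r1 * r2) = 1 / (2 * m)"
  proof -
    have "(\<lambda>n. A * (of_real (p n) * (e1 n)\<^sup>2) + B * (e1 n * e2 n)) \<longlonglongrightarrow> A * (0 * r1\<^sup>2) + B * (r1 * r2)"
      by (intro tendsto_intros p0 e1 e2)
    moreover have "g = (\<lambda>n. A * (of_real (p n) * (e1 n)\<^sup>2) + B * (e1 n * e2 n))"
      by (simp add: fun_eq_iff g_eq C0)
    ultimately have "1 / (2 * m) = A * (0 * r1\<^sup>2) + B * (r1 * r2)"
      using LIMSEQ_unique[OF g1] by (simp only:)
    then show ?thesis by simp
  qed
  \<comment> \<open>After division by p the mixed product must not disturb the limit: it depends
    analytically on w = (x/2)^2, and w/p = (x/2)^(2 - 2\<mu>) tends to 0.\<close>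
  have A: "A * r1\<^sup>2 = L"
  proof -
    define h where "h z = bessel_E m z * bessel_E (- m) z" for z
    obtain D where D: "(h has_field_derivative D) (at 0)"
      unfolding h_def [abs_def] using DERIV_mult[OF has_field_derivative_bessel_E has_field_derivative_bessel_E] by blast
    have wn: "w n \<noteq> 0" for n using x(1)[of n] by (simp add: w_def)
    have "filterlim w (at 0) sequentially" using w0 wn by (auto simp: filterlim_at)
    moreover have "((\<lambda>z. (h z - h 0) / (z - 0)) \<longlongrightarrow> D) (at 0)" using D by (simp add: has_field_derivative_iff)
    ultimately have 1: "(\<lambda>n. (h (w n) - h 0) / (w n - 0)) \<longlonglongrightarrow> D" by (rule filterlim_compose[rotated])
    have 2: "(\<lambda>n. w n / of_real (p n)) \<longlonglongrightarrow> 0"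
    proof -
      have "(\<lambda>n. x n / 2) \<longlonglongrightarrow> 0" using x(2) by (auto intro!: tendsto_eq_intros)
      then have "(\<lambda>n. (x n / 2) powr (2 - 2 * \<mu>)) \<longlonglongrightarrow> 0" using \<mu> x(1)
        by (intro tendsto_zero_powrI[where b = "2 - 2 * \<mu>"] tendsto_const always_eventually) (auto intro: less_imp_le)
      then have "(\<lambda>n. complex_of_real ((x n / 2) powr (2 - 2 * \<mu>))) \<longlonglongrightarrow> 0"
        using tendsto_of_real[of "\<lambda>n. (x n / 2) powr (2 - 2 * \<mu>)" 0] by simp
      moreover have "w n / of_real (p n) = of_real ((x n / 2) powr (2 - 2 * \<mu>))" for n
        using x(1)[of n] by (simp add: w_def p_def powr_diff)
      ultimately show ?thesis by simp
    qed
    have "(\<lambda>n. A * (e1 n)\<^sup>2 + B * ((h (w n) - h 0) / (w n - 0) * (w n / of_real (p n)))) \<longlonglongrightarrow> A * r1\<^sup>2 + B * (D * 0)"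
      by (intro tendsto_intros e1 1 2)
    moreover have "A * (e1 n)\<^sup>2 + B * ((h (w n) - h 0) / (w n - 0) * (w n / of_real (p n))) = (g n - 1 / (2 * m)) / of_real (p n)" for n
    proof -
      have "h 0 = r1 * r2" by (simp add: h_def r1_def r2_def)
      then have "B * h 0 = 1 / (2 * m)" using B by simp
      moreover have "h (w n) = e1 n * e2 n" by (simp add: h_def e1_def e2_def)
      ultimately have "g n - 1 / (2 * m) = A * (of_real (p n) * (e1 n)\<^sup>2) + B * (h (w n) - h 0)"
        by (simp add: g_eq C0 right_diff_distrib)
      then show ?thesis using p[of n] wn[of n] by (simp add: add_divide_distrib)
    qed
    ultimately have "(\<lambda>n. (g n - 1 / (2 * m)) / of_real (p n)) \<longlonglongrightarrow> A * r1\<^sup>2 + B * (D * 0)" by simp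
    from LIMSEQ_unique[OF this lim] show ?thesis by simp
  qed
  have "A = - B"
  proof -
    have "complex_of_real (2 powr (2 * \<mu>) * rGamma (2 * \<mu> + 1) * (Beta ((2 * \<mu> + 1) / 2) (1 - 2 * \<mu> / 2) / 2) * rGamma (1 - \<mu>)) =
        of_real (rGamma (\<mu> + 1))"
      unfolding beta_duplication[OF \<mu>] ..
    moreover have "r1 = of_real (rGamma (\<mu> + 1))" "r2 = of_real (rGamma (1 - \<mu>))"
      "rGamma (of_real (2 * \<mu>) + 1) = complex_of_real (rGamma (2 * \<mu> + 1))"
      by (simp_all add: r1_def r2_def m_def flip: rGamma_complex_of_real)
    ultimately have "L * (2 * m) * r2 = - r1"
      using m0 unfolding L_def m_def by (simp add: field_simps)
    then have "A * r1\<^sup>2 * (2 * m) * r2 = - r1" by (simp only: A)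
    then have "A * (r1 * r2) * (2 * m) * r1 = (- 1) * r1" by (simp add: power2_eq_square mult_ac)
    then have "A * (r1 * r2) * (2 * m) = - 1" using r0(1) by (simp only: mult_cancel_right) simp
    moreover have "(- B) * (r1 * r2) * (2 * m) = - 1" using B m0 by (simp add: field_simps)
    ultimately have eq: "A * (r1 * r2 * (2 * m)) = (- B) * (r1 * r2 * (2 * m))" by (simp only: mult.assoc)
    have "r1 * r2 * (2 * m) \<noteq> 0" using r0 m0 by simp
    from mult_right_cancel[THEN iffD1, OF this eq] show ?thesis .
  qed
  moreover have Bs: "B * sin (of_real pi * m) = of_real pi / 2"
  proof -
    have "sin (of_real pi * m) = of_real pi * (m * (r1 * r2))" unfolding r12 by simp
    then have "B * sin (of_real pi * m) = of_real pi * (m * (B * (r1 * r2)))" by simp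
    then show ?thesis unfolding B using m0 by simp
  qed
  ultimately have "bessel_G 0 (2 * m) \<alpha> * sin (of_real pi * m) =
      (B * sin (of_real pi * m)) * (bessel_cyl 1 m \<alpha> * (bessel_cyl 1 (- m) \<alpha> - bessel_cyl 1 m \<alpha>))"
    unfolding rep[OF \<alpha>] C0 by (simp add: power2_eq_square algebra_simps)
  then show ?thesis unfolding Bs by (simp add: m_def)
qed

text \<open>Multiplication by the sine keeps both sides holomorphic in \<nu> at the even integers,
  where the quotient defining K degenerates.\<close>

lemma bessel_G_closed_form:
  assumes \<nu>: "Re \<nu> > - 1" and \<alpha>: "Re \<alpha> > 0"
  shows "bessel_G 0 \<nu> \<alpha> * sin (of_real pi * (\<nu> / 2)) =
    of_real pi / 2 * (bessel_cyl 1 (\<nu> / 2) \<alpha> * (bessel_cyl 1 (- (\<nu> / 2)) \<alpha> - bessel_cyl 1 (\<nu> / 2) \<alpha>))"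
proof -
  define F where "F \<nu> = bessel_G 0 \<nu> \<alpha> * sin (of_real pi * (\<nu> / 2)) -
    of_real pi / 2 * (bessel_cyl 1 (\<nu> / 2) \<alpha> * (bessel_cyl 1 (- (\<nu> / 2)) \<alpha> - bessel_cyl 1 (\<nu> / 2) \<alpha>))" for \<nu>
  have nz: "\<alpha> \<noteq> 0" using \<alpha> by auto
  have hol: "(\<lambda>\<nu>. bessel_cyl 1 (f \<nu>) \<alpha>) holomorphic_on S" if "f holomorphic_on S" for f S
    using holomorphic_on_compose_gen[OF that holomorphic_bessel_cyl_order[OF nz, of 1 UNIV]] by (simp add: o_def)
  have "F \<nu> = 0"
  proof (rule analytic_continuation[of F "{\<nu>. Re \<nu> > - 1}" "complex_of_real ` {0<..<1}" "1 / 2"])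
    show "F holomorphic_on {\<nu>. Re \<nu> > - 1}"
      unfolding F_def [abs_def] by (intro holomorphic_intros bessel_G_order_holomorphic \<alpha> hol) auto
    show "open {\<nu>. Re \<nu> > - 1}" by (rule open_halfspace_Re_gt)
    show "connected {\<nu>. Re \<nu> > - 1}" by (intro convex_connected convex_halfspace_Re_gt)
    show "(1 / 2 :: complex) islimpt complex_of_real ` {0<..<1}"
      unfolding islimpt_sequential
    proof (intro exI conjI allI)
      fix n :: nat
      show "complex_of_real (1 / 2 + 1 / real (n + 3)) \<in> complex_of_real ` {0<..<1} - {1 / 2}"
      proof (intro DiffI imageI)
        show "1 / 2 + 1 / real (n + 3) \<in> {0<..<1}" by (simp add: field_simps)
        have "(1 / 2 :: complex) = of_real (1 / 2)" by simp
        moreover have "1 / 2 + 1 / real (n + 3) \<noteq> 1 / 2" by simp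
        ultimately show "complex_of_real (1 / 2 + 1 / real (n + 3)) \<notin> {1 / 2}"
          by (simp only: singleton_iff of_real_eq_iff not_False_eq_True)
      qed
    next
      have "(\<lambda>n. 1 / 2 + 1 / real (n + 3)) \<longlonglongrightarrow> 1 / 2 + 0"
        by (intro tendsto_intros LIMSEQ_ignore_initial_segment[OF lim_1_over_n])
      then show "(\<lambda>n. complex_of_real (1 / 2 + 1 / real (n + 3))) \<longlonglongrightarrow> 1 / 2"
        using tendsto_of_real[of "\<lambda>n. 1 / 2 + 1 / real (n + 3)" "1 / 2", where ?'a = complex] by simp
    qed
    show "F z = 0" if z: "z \<in> complex_of_real ` {0<..<1}" for z
    proof -
      obtain x where x: "x \<in> {0<..<1}" "z = of_real x" using z by blast
      then show ?thesis using bessel_G_closed_form_interval[of "x / 2" \<alpha>] \<alpha> by (simp add: F_def)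
    qed
  qed (use \<nu> in auto)
  then show ?thesis by (simp add: F_def)
qed

text \<open>Makes the numerator of K vanish at integer order, so that the limit there
  exists.\<close>

lemma bessel_I_minus_int: "m \<in> \<int> \<Longrightarrow> z \<noteq> 0 \<Longrightarrow> bessel_cyl 1 (- m) z = bessel_cyl 1 m z"
proof -
  assume m: "m \<in> \<int>" and z: "z \<noteq> 0"
  have nat: "bessel_cyl 1 (- of_nat n) z = bessel_cyl 1 (of_nat n) z" for n
  proof -
    have 1: "(z / 2) powr (of_nat n) = (z / 2) ^ n" using z by (intro powr_nat') auto
    have 2: "((z / 2)\<^sup>2) ^ n = (z / 2) ^ n * (z / 2) ^ n" by (simp only: power2_eq_square power_mult_distrib)
    have 3: "(z / 2) ^ n \<noteq> 0" using z by simp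
    show ?thesis
      unfolding bessel_cyl_def mult_1_left bessel_E_minus_nat powr_minus 1 2 using 3 by (simp add: field_simps)
  qed
  obtain k where k: "m = of_int k" using m by (elim Ints_cases)
  show ?thesis
  proof (cases "k \<ge> 0")
    case True
    then have "m = of_nat (nat k)" by (simp add: k)
    then show ?thesis using nat by simp
  next
    case False
    then have "- m = of_nat (nat (- k))" by (simp add: k)
    then have "m = - of_nat (nat (- k))" by (simp only: minus_equation_iff [of m])
    then show ?thesis using nat[of "nat (- k)"] by simp
  qed
qed

text \<open>At noninteger order the sine is divided out. At integer order the identity holds at
  nearby orders, and both sides converge: G because it is continuous in the order, K by the
  definition as a limit.\<close>

lemma bessel_G_eq_I_K:
  assumes \<mu>: "Re \<mu> > - 1 / 2" and \<alpha>: "Re \<alpha> > 0"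
  shows "bessel_G 0 (2 * \<mu>) \<alpha> = Bessel_I \<mu> \<alpha> * Bessel_K \<mu> \<alpha>"
proof -
  define N where "N m = bessel_cyl 1 (- m) \<alpha> - bessel_cyl 1 m \<alpha>" for m
  define q where "q m = of_real pi / 2 * N m / sin (of_real pi * m)" for m
  have K: "Bessel_K \<mu> \<alpha> = (if \<mu> \<in> \<int> then Lim (at \<mu>) q else q \<mu>)"
    by (simp add: Bessel_K_def Bessel_I_conv q_def [abs_def] N_def)
  have nz: "\<alpha> \<noteq> 0" using \<alpha> by auto
  have main: "bessel_G 0 (2 * m) \<alpha> = bessel_cyl 1 m \<alpha> * q m" if "Re m > - 1 / 2" "sin (of_real pi * m) \<noteq> 0" for m
    using bessel_G_closed_form[of "2 * m" \<alpha>] that \<alpha> by (simp add: q_def N_def field_simps)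
  have sin0: "sin (of_real pi * m) = 0 \<longleftrightarrow> m \<in> \<int>" for m :: complex
    by (simp add: sin_eq_0 Ints_def image_iff)
  show ?thesis
  proof (cases "\<mu> \<in> \<int>")
    case False
    then show ?thesis using main[of \<mu>] \<mu> by (simp add: K Bessel_I_conv sin0)
  next
    case True
    have hol: "(\<lambda>m. bessel_cyl 1 (f m) \<alpha>) holomorphic_on S" if "f holomorphic_on S" for f S
      using holomorphic_on_compose_gen[OF that holomorphic_bessel_cyl_order[OF nz, of 1 UNIV]] by (simp add: o_def)
    have "N holomorphic_on UNIV" unfolding N_def [abs_def] by (intro holomorphic_intros hol)
    then have N': "(N has_field_derivative deriv N \<mu>) (at \<mu>)" using holomorphic_derivI open_UNIV by blast
    have N0: "N \<mu> = 0" using bessel_I_minus_int[OF True nz] by (simp add: N_def)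
    have S': "((\<lambda>m. sin (of_real pi * m)) has_field_derivative of_real pi * cos (of_real pi * \<mu>)) (at \<mu>)"
      by (auto intro!: derivative_eq_intros)
    have S0: "sin (of_real pi * \<mu>) = 0" using True sin0 by blast
    then have cos0: "cos (of_real pi * \<mu>) \<noteq> 0"
      using sin_cos_squared_add[of "of_real pi * \<mu>"] by auto
    \<comment> \<open>L'Hopital's value: numerator and sine both vanish at \<mu>, so q is the
      quotient of their difference quotients, and the cosine is nonzero where the sine is 0.\<close>
    define l where "l = of_real pi / 2 * (deriv N \<mu> / (of_real pi * cos (of_real pi * \<mu>)))"
    have "((\<lambda>m. of_real pi / 2 * (((N m - N \<mu>) / (m - \<mu>)) / ((sin (of_real pi * m) - sin (of_real pi * \<mu>)) / (m - \<mu>)))) \<longlongrightarrow> l) (at \<mu>)"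
      unfolding l_def using N' S' cos0 by (intro tendsto_intros) (auto simp: has_field_derivative_iff)
    moreover have "\<forall>\<^sub>F m in at \<mu>. of_real pi / 2 * (((N m - N \<mu>) / (m - \<mu>)) / ((sin (of_real pi * m) - sin (of_real pi * \<mu>)) / (m - \<mu>))) = q m"
      unfolding N0 S0 by (auto simp: eventually_at_filter q_def)
    ultimately have ql: "(q \<longlongrightarrow> l) (at \<mu>)" by (rule Lim_transform_eventually)
    then have Kl: "Bessel_K \<mu> \<alpha> = l" using True by (simp add: K tendsto_Lim)
    have "continuous_on UNIV (\<lambda>m. bessel_cyl 1 m \<alpha>)"
      by (rule holomorphic_on_imp_continuous_on[OF holomorphic_bessel_cyl_order[OF nz]])
    then have "isCont (\<lambda>m. bessel_cyl 1 m \<alpha>) \<mu>"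
      by (simp add: continuous_on_eq_continuous_at)
    then have 1: "((\<lambda>m. bessel_cyl 1 m \<alpha> * q m) \<longlongrightarrow> bessel_cyl 1 \<mu> \<alpha> * l) (at \<mu>)"
      using ql by (intro tendsto_mult) (auto simp: isCont_def)
    have opn: "open {m. Re m > - 1 / 2}" by (rule open_halfspace_Re_gt)
    have "(\<lambda>m. bessel_G 0 (2 * m) \<alpha>) holomorphic_on {m. Re m > - 1 / 2}"
    proof -
      have "(\<lambda>m :: complex. 2 * m) holomorphic_on {m. Re m > - 1 / 2}" by (intro holomorphic_intros)
      moreover have "(\<lambda>m. 2 * m) ` {m. Re m > - 1 / 2} \<subseteq> {\<nu>. Re \<nu> > - 1}" by auto
      ultimately show ?thesis
        using holomorphic_on_compose_gen[OF _ bessel_G_order_holomorphic[OF \<alpha>, of 0]] by (fastforce simp: o_def)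
    qed
    then have "isCont (\<lambda>m. bessel_G 0 (2 * m) \<alpha>) \<mu>"
      using holomorphic_on_imp_continuous_on continuous_on_eq_continuous_at[OF opn] \<mu> by blast
    then have 2: "((\<lambda>m. bessel_G 0 (2 * m) \<alpha>) \<longlongrightarrow> bessel_G 0 (2 * \<mu>) \<alpha>) (at \<mu>)" by (simp add: isCont_def)
    have "\<forall>\<^sub>F m in at \<mu>. sin (of_real pi * m) \<noteq> 0"
    proof -
      have "((\<lambda>m. (sin (of_real pi * m) - sin (of_real pi * \<mu>)) / (m - \<mu>)) \<longlongrightarrow> of_real pi * cos (of_real pi * \<mu>)) (at \<mu>)"
        using S' by (simp add: has_field_derivative_iff)
      then have "\<forall>\<^sub>F m in at \<mu>. (sin (of_real pi * m) - sin (of_real pi * \<mu>)) / (m - \<mu>) \<noteq> 0"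
        by (rule tendsto_imp_eventually_ne) (use cos0 in auto)
      then show ?thesis by (rule eventually_mono) (auto simp: S0)
    qed
    moreover have "\<forall>\<^sub>F m in at \<mu>. m \<in> {m. Re m > - 1 / 2}"
      by (rule eventually_at_in_open'[OF opn]) (use \<mu> in simp)
    ultimately have "\<forall>\<^sub>F m in at \<mu>. bessel_G 0 (2 * m) \<alpha> = bessel_cyl 1 m \<alpha> * q m"
      by eventually_elim (auto intro: main)
    from Lim_transform_eventually[OF 2 this]
    have "bessel_G 0 (2 * \<mu>) \<alpha> = bessel_cyl 1 \<mu> \<alpha> * l"
      using 1 by (intro tendsto_unique[of "at \<mu>"]) auto
    then show ?thesis by (simp add: Kl Bessel_I_conv)
  qed
qed

subsection \<open>Divergence for nonreal arguments\<close>

text \<open>Conditional convergence suffices: by the Cauchy criterion for the Henstock-Kurzweil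
  integral, integrals over all sufficiently large intervals differ by less than 1, and the rest of
  the primitive lives on a compact interval.\<close>

lemma integrable_imp_bounded_primitive:
  fixes f :: "real \<Rightarrow> complex"
  assumes f: "f integrable_on {0<..}" and cont: "continuous_on {0<..} f"
  obtains F M where "\<And>x. x > 0 \<Longrightarrow> (F has_vector_derivative f x) (at x)"
    "(F \<longlongrightarrow> 0) (at_right 0)" "\<And>x. x > 0 \<Longrightarrow> norm (F x) \<le> M"
proof -
  define f0 where "f0 x = (if x \<in> {0<..} then f x else 0)" for x
  define F where "F x = integral {0..x} f0" for x
  have int: "f0 integrable_on {a..b}" for a b
    using integrable_altD(1)[OF f, of a b] by (simp add: f0_def [abs_def])
  have F': "(F has_vector_derivative f x) (at x)" if x: "x > 0" for x
  proof -
    have "isCont f x"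
      using cont x continuous_on_eq_continuous_at[of "{0<..}" f] by auto
    moreover have "\<forall>\<^sub>F y in nhds x. f y = f0 y"
      using eventually_nhds_in_open[of "{0<..}" x] x by (auto simp: f0_def elim: eventually_mono)
    ultimately have "isCont f0 x" by (subst (asm) isCont_cong)
    then have "continuous (at x within ({0..x + 1} - {})) f0"
      by (rule continuous_at_imp_continuous_at_within)
    from integral_has_vector_derivative_continuous_at[OF int _ _ this]
    have "(F has_vector_derivative f0 x) (at x within {0..x + 1})"
      using x by (simp add: F_def [abs_def])
    moreover have "at x within {0..x + 1} = at x"
      using x by (intro at_within_interior) (simp add: interior_atLeastAtMost_real)
    ultimately show ?thesis using x by (simp add: f0_def)
  qed
  have contF: "continuous_on {0..b} F" for b
    unfolding F_def [abs_def] using int by (rule indefinite_integral_continuous_1)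
  have lim: "(F \<longlongrightarrow> 0) (at_right 0)"
  proof -
    have "(F \<longlongrightarrow> F 0) (at 0 within {0..1})" using contF[of 1] by (simp add: continuous_on_def)
    then have "(F \<longlongrightarrow> F 0) (at_right 0)"
      using at_within_Icc_at_right[of 0 "1 :: real"] by simp
    then show ?thesis by (simp add: F_def)
  qed
  obtain B where B: "B > 0" "\<And>a b c d. ball 0 B \<subseteq> cbox a b \<and> ball 0 B \<subseteq> cbox c d \<Longrightarrow>
      norm (integral (cbox a b) f0 - integral (cbox c d) f0) < 1"
    using integrable_altD(2)[OF f zero_less_one] unfolding f0_def [abs_def] by blast
  \<comment> \<open>The Cauchy criterion speaks of intervals containing a ball around 0; extending
    by zero to the left adds nothing to the integral.\<close>
  have F_eq: "integral {- B..x} f0 = F x" if "x \<ge> 0" for x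
  proof -
    have "integral {- B..0} f0 = integral {- B..0} (\<lambda>x. 0)"
      by (rule integral_cong) (simp add: f0_def)
    moreover have "integral {- B..0} f0 + integral {0..x} f0 = integral {- B..x} f0"
      using B(1) that int by (intro Henstock_Kurzweil_Integration.integral_combine) auto
    ultimately show ?thesis by (simp add: F_def)
  qed
  have "compact (F ` {0..B})" by (intro compact_continuous_image contF compact_Icc)
  then obtain M where M: "\<And>x. x \<in> {0..B} \<Longrightarrow> norm (F x) \<le> M"
    using compact_imp_bounded bounded_iff by (metis image_eqI)
  have "norm (F x) \<le> M + 1" if x: "x > 0" for x
  proof (cases "x \<le> B")
    case True
    then show ?thesis using M[of x] x by simp
  next
    case False
    have "norm (integral (cbox (- B) x) f0 - integral (cbox (- B) B) f0) < 1"
      by (rule B(2)) (use False B(1) in \<open>auto simp: ball_eq_greaterThanLessThan\<close>)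
    then have "norm (F x - F B) < 1" using F_eq[of x] F_eq[of B] x B(1) by simp
    moreover have "norm (F B) \<le> M" using M B(1) by simp
    ultimately show ?thesis using norm_triangle_sub[of "F x" "F B"] by linarith
  qed
  then show ?thesis using that F' lim by blast
qed

lemma laplace_ok_linear_growth:
  assumes "continuous_on {0<..} f" "\<And>b. b > 0 \<Longrightarrow> norm (f b) \<le> C * (1 + b)"
  shows "laplace_ok f"
proof -
  have "(\<lambda>b. exp (- (\<epsilon> * b))) integrable_on {0<..}" if "\<epsilon> > 0" for \<epsilon> :: real
  proof -
    have "(\<lambda>b. exp (- \<epsilon> * b)) integrable_on {0..}" using that by (rule integrable_on_exp_minus_to_infinity)
    then have "(\<lambda>b. exp (- \<epsilon> * b)) integrable_on {0<..}"
      by (rule integrable_spike_set) (auto intro!: negligible_subset[OF negligible_sing[of "0 :: real"]])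
    then show ?thesis by simp
  qed
  then have one: "laplace_ok (\<lambda>b. 1)" by (simp add: laplace_ok_def)
  have "(\<lambda>b. exp (- (\<epsilon> * b)) * norm (f b)) integrable_on {0<..}" if \<epsilon>: "\<epsilon> > 0" for \<epsilon>
  proof -
    have i1: "(\<lambda>b. exp (- (\<epsilon> * b)) * norm (1 :: complex)) integrable_on {0<..}"
      and i2: "(\<lambda>b. exp (- (\<epsilon> * b)) * norm (of_real b * 1 :: complex)) integrable_on {0<..}"
      using one laplace_ok_times[OF one] \<epsilon> unfolding laplace_ok_def by blast+
    have "(\<lambda>b. of_real (exp (- (\<epsilon> * b))) * f b) absolutely_integrable_on {0<..}"
    proof (rule absolutely_integrable_continuous_bounded)
      show "continuous_on {0<..} (\<lambda>b. of_real (exp (- (\<epsilon> * b))) * f b)" by (intro continuous_intros assms)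
      show "(\<lambda>b. C * (exp (- (\<epsilon> * b)) * norm (1 :: complex) + exp (- (\<epsilon> * b)) * norm (of_real b * 1 :: complex))) integrable_on {0<..}"
        by (intro integrable_on_mult_right integrable_add i1 i2)
      show "norm (of_real (exp (- (\<epsilon> * b))) * f b) \<le> C * (exp (- (\<epsilon> * b)) * norm (1 :: complex) + exp (- (\<epsilon> * b)) * norm (of_real b * 1 :: complex))"
        if b: "b > 0" for b
        using mult_left_mono[OF assms(2)[OF b], of "exp (- (\<epsilon> * b))"] b by (simp add: norm_mult algebra_simps)
    qed
    then show ?thesis by (simp add: absolutely_integrable_on_def norm_mult)
  qed
  then show ?thesis using assms(1) by (simp add: laplace_ok_def)
qed

section \<open>The Laplace transform of J along a ray and its coefficients\<close>

lemma gamma_integral_scaled: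
  fixes p s :: real
  assumes "p > 0" "s > 0"
  shows "(\<lambda>b. complex_of_real (b powr (p - 1)) * exp (- (of_real s * of_real b))) absolutely_integrable_on {0<..}"
    and "integral {0<..} (\<lambda>b. complex_of_real (b powr (p - 1)) * exp (- (of_real s * of_real b))) =
      of_real (Gamma p / s powr p)"
proof -
  define h where "h x = complex_of_real x powr (of_real p - 1) / of_real (exp x)" for x
  have h: "h absolutely_integrable_on {0<..}" "(h has_integral Gamma (of_real p)) {0<..}"
    unfolding h_def [abs_def] using assms
    by (auto intro!: absolutely_integrable_Gamma_integral' Gamma_integral_complex')
  note sc = has_integral_scale_positive_reals[OF h(1) assms(2)]
  have eq: "complex_of_real (b powr (p - 1)) * exp (- (of_real s * of_real b)) = of_real (s powr (1 - p)) * h (s * b)"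
    if b: "b > 0" for b
  proof -
    have h': "h (s * b) = of_real ((s * b) powr (p - 1) * exp (- (s * b)))"
      using powr_of_real[of "s * b" "p - 1"] b assms by (simp add: h_def exp_minus divide_inverse)
    have e: "exp (- (complex_of_real s * of_real b)) = of_real (exp (- (s * b)))"
      by (metis exp_of_real of_real_minus of_real_mult)
    have "s powr (1 - p) * (s * b) powr (p - 1) = b powr (p - 1)"
      using assms b powr_add[of s "1 - p" "p - 1"] by (simp add: powr_mult mult.assoc [symmetric])
    then show ?thesis
      unfolding h' e unfolding of_real_mult [symmetric] mult.assoc [symmetric] by simp
  qed
  have "(\<lambda>b. complex_of_real (b powr (p - 1)) * exp (- (of_real s * of_real b))) absolutely_integrable_on {0<..} \<longleftrightarrow>
      (\<lambda>b. of_real (s powr (1 - p)) * h (s * b)) absolutely_integrable_on {0<..}"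
    by (rule set_integrable_cong) (simp_all add: eq)
  then show "(\<lambda>b. complex_of_real (b powr (p - 1)) * exp (- (of_real s * of_real b))) absolutely_integrable_on {0<..}"
    using set_integrable_mult_right[OF sc(1)] by blast
  have "integral {0<..} (\<lambda>b. complex_of_real (b powr (p - 1)) * exp (- (of_real s * of_real b))) =
      integral {0<..} (\<lambda>b. of_real (s powr (1 - p)) * h (s * b))"
    by (rule integral_cong) (simp add: eq)
  also have "\<dots> = of_real (s powr (1 - p)) * (integral {0<..} h / of_real s)"
    using sc(2) by simp
  also have "integral {0<..} h = of_real (Gamma p)"
    using integral_unique[OF h(2)] by (simp add: Gamma_complex_of_real)
  also have "of_real (s powr (1 - p)) * (of_real (Gamma p) / of_real s) = complex_of_real (Gamma p / s powr p)"
    using assms by (simp add: powr_diff)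
  finally show "integral {0<..} (\<lambda>b. complex_of_real (b powr (p - 1)) * exp (- (of_real s * of_real b))) =
      of_real (Gamma p / s powr p)" .
qed

text \<open>Each step of the recurrence divides by \<nu> + k + 1, which is at least k + 1/2, and the
  product of the numbers 1/(j + 1/2) for j < k is 4^k k!/(2k)!. The series of J is thereby compared
  with the even part of the exponential, giving the exact growth rate |z|.\<close>

lemma rGamma_half_bound:
  fixes \<nu> :: real
  assumes \<nu>: "\<nu> \<ge> - 1 / 2"
  shows "0 < rGamma (\<nu> + real k + 1)"
    and "rGamma (\<nu> + real k + 1) \<le> rGamma (\<nu> + 1) * 4 ^ k * fact k / fact (2 * k)"
proof -
  show pos: "0 < rGamma (\<nu> + real k + 1)" for k
    using Gamma_real_pos[of "\<nu> + real k + 1"] \<nu> by (simp add: rGamma_inverse_Gamma)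
  show "rGamma (\<nu> + real k + 1) \<le> rGamma (\<nu> + 1) * 4 ^ k * fact k / fact (2 * k)"
  proof (induction k)
    case (Suc k)
    have "rGamma (\<nu> + real (Suc k) + 1) = rGamma (\<nu> + real k + 1) / (\<nu> + real k + 1)"
      using rGamma_plus1[of "\<nu> + real k + 1"] \<nu> by (simp add: field_simps)
    also have "\<dots> \<le> (rGamma (\<nu> + 1) * 4 ^ k * fact k / fact (2 * k)) / (real k + 1 / 2)"
      using Suc pos[of k] \<nu> by (intro frac_le) auto
    also have "\<dots> = rGamma (\<nu> + 1) * 4 ^ Suc k * fact (Suc k) / fact (2 * Suc k)"
      by (simp add: divide_simps) (simp add: algebra_simps)
    finally show ?case .
  qed simp
qed

lemma sum_even_exp_terms_le:
  fixes x :: real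
  assumes "x \<ge> 0"
  shows "(\<Sum>k<n. x ^ (2 * k) / fact (2 * k)) \<le> exp x"
proof -
  have "(\<Sum>k<n. x ^ (2 * k) / fact (2 * k)) = (\<Sum>j\<in>(\<lambda>k. 2 * k) ` {..<n}. x ^ j / fact j)"
    by (subst sum.reindex) (auto simp: inj_on_def)
  also have "\<dots> \<le> (\<Sum>j. x ^ j / fact j)"
    using exp_series_scaled[of 1 x] assms by (intro sum_le_suminf) (auto simp: sums_iff)
  also have "\<dots> = exp x" using exp_series_scaled[of 1 x] by (simp add: sums_iff)
  finally show ?thesis .
qed

text \<open>The generalised binomial coefficient (\<nu> + 2k over k): the power-series coefficient
  of J times the Gamma factor from the Laplace transform of b^(\<nu> + 2k).\<close>

definition laplace_coeff :: "real \<Rightarrow> nat \<Rightarrow> real" where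
  "laplace_coeff \<nu> k = rGamma (\<nu> + real k + 1) / fact k * Gamma (\<nu> + 2 * real k + 1)"

text \<open>With d_k the coefficient over 4^k, the sequence k d_k is nondecreasing, so d_k is at
  least d_1/k. This suffices for divergence at the boundary of the disc by comparison with the
  harmonic series.\<close>

lemma laplace_coeff_lower_bound:
  assumes \<nu>: "\<nu> \<ge> - 1 / 2"
  obtains c where "c > 0" "\<And>k. k > 0 \<Longrightarrow> c / real k \<le> laplace_coeff \<nu> k / 4 ^ k"
proof -
  define d where "d k = laplace_coeff \<nu> k / 4 ^ k" for k
  have dpos: "d k > 0" for k
    using rGamma_half_bound(1)[OF \<nu>, of k] Gamma_real_pos[of "\<nu> + 2 * real k + 1"] \<nu>
    by (simp add: d_def laplace_coeff_def)
  have step: "real k * d k \<le> real (Suc k) * d (Suc k)" for k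
  proof -
    have "Gamma (\<nu> + 2 * real (Suc k) + 1) = (\<nu> + 2 * real k + 2) * ((\<nu> + 2 * real k + 1) * Gamma (\<nu> + 2 * real k + 1))"
    proof -
      have "\<nu> + 2 * real k + 1 \<notin> \<int>\<^sub>\<le>\<^sub>0" "\<nu> + 2 * real k + 2 \<notin> \<int>\<^sub>\<le>\<^sub>0"
        using \<nu> nonpos_Ints_nonpos[of "\<nu> + 2 * real k + 1"] nonpos_Ints_nonpos[of "\<nu> + 2 * real k + 2"] by auto
      from Gamma_plus1[OF this(1)] Gamma_plus1[OF this(2)] show ?thesis by (simp add: algebra_simps)
    qed
    moreover have "rGamma (\<nu> + real k + 1) = (\<nu> + real k + 1) * rGamma (\<nu> + real (Suc k) + 1)"
      using rGamma_plus1[of "\<nu> + real k + 1"] by (simp add: algebra_simps)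
    ultimately have "d (Suc k) * (4 * (real k + 1) * (\<nu> + real k + 1)) = d k * ((\<nu> + 2 * real k + 2) * (\<nu> + 2 * real k + 1))"
      by (simp add: d_def laplace_coeff_def divide_simps)
    moreover have "4 * real k * (\<nu> + real k + 1) \<le> (\<nu> + 2 * real k + 2) * (\<nu> + 2 * real k + 1)"
    proof -
      have "(\<nu> + 2 * real k + 2) * (\<nu> + 2 * real k + 1) - 4 * real k * (\<nu> + real k + 1) = 2 * real k + (\<nu> + 1) * (\<nu> + 2)"
        by (simp add: algebra_simps)
      moreover have "0 \<le> (\<nu> + 1) * (\<nu> + 2)" using \<nu> by (intro mult_nonneg_nonneg) auto
      ultimately show ?thesis by linarith
    qed
    then have "d k * (4 * real k * (\<nu> + real k + 1)) \<le> d k * ((\<nu> + 2 * real k + 2) * (\<nu> + 2 * real k + 1))"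
      using dpos[of k] by (intro mult_left_mono) auto
    ultimately have "(real k * d k) * (4 * (\<nu> + real k + 1)) \<le> (real (Suc k) * d (Suc k)) * (4 * (\<nu> + real k + 1))"
      by (simp add: algebra_simps)
    then show ?thesis using \<nu> by (simp add: mult_le_cancel_right)
  qed
  have "d 1 \<le> real k * d k" if "k > 0" for k
    using that
  proof (induction k rule: nat_induct_non_zero)
    case (Suc k)
    then show ?case using step[of k] by linarith
  qed simp
  then show ?thesis
    using that[of "d 1"] dpos[of 1] by (simp add: d_def field_simps)
qed

lemma laplace_coeff_not_bounded:
  assumes \<nu>: "\<nu> \<ge> - 1 / 2"
  shows "\<not> (\<exists>M. \<forall>n. (\<Sum>k<n. laplace_coeff \<nu> k / 4 ^ k) \<le> M)"
proof
  assume "\<exists>M. \<forall>n. (\<Sum>k<n. laplace_coeff \<nu> k / 4 ^ k) \<le> M"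
  then obtain M where M: "\<And>n. (\<Sum>k<n. laplace_coeff \<nu> k / 4 ^ k) \<le> M" by blast
  have pos: "0 \<le> laplace_coeff \<nu> k / 4 ^ k" for k
    using rGamma_half_bound(1)[OF \<nu>, of k] Gamma_real_pos[of "\<nu> + 2 * real k + 1"] \<nu>
    by (simp add: laplace_coeff_def)
  have sm: "summable (\<lambda>k. laplace_coeff \<nu> k / 4 ^ k)"
    by (rule summableI_nonneg_bounded[OF pos M])
  obtain c where c: "c > 0" "\<And>k. k > 0 \<Longrightarrow> c / real k \<le> laplace_coeff \<nu> k / 4 ^ k"
    using laplace_coeff_lower_bound[OF \<nu>] by blast
  have "summable (\<lambda>k. c / real k)"
    by (rule summable_comparison_test'[OF sm, of 1]) (use c in auto)
  then have "summable (\<lambda>k. 1 / c * (c / real k))" by (rule summable_mult)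
  moreover have "(\<lambda>k. 1 / c * (c / real k)) = (\<lambda>k. real k powr (- 1))"
    using c(1) by (simp add: powr_minus inverse_eq_divide)
  ultimately have "summable (\<lambda>k. real k powr (- 1))" by (simp only:)
  then show False unfolding summable_real_powr_iff by simp
qed

text \<open>For b > 0 the principal logarithm is additive in b and z/2, so the power splits off
  b^\<nu> without a branch correction.\<close>

lemma Bessel_J_ray:
  assumes "b > 0" "z \<noteq> 0"
  shows "Bessel_J (of_real \<nu>) (of_real b * z) =
    of_real (b powr \<nu>) * ((z / 2) powr of_real \<nu> * bessel_E (of_real \<nu>) (- ((z / 2)\<^sup>2) * (of_real b)\<^sup>2))"
proof -
  have "(of_real b * z / 2) powr of_real \<nu> = exp (of_real \<nu> * (of_real (ln b) + Ln (z / 2)))"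
    using assms Ln_times_of_real[of b "z / 2"] by (simp add: powr_def Ln_of_real)
  also have "\<dots> = exp (of_real (\<nu> * ln b)) * (z / 2) powr of_real \<nu>"
    using assms by (simp add: powr_def exp_add distrib_left)
  also have "exp (of_real (\<nu> * ln b)) = complex_of_real (b powr \<nu>)"
    using assms unfolding exp_of_real by (simp add: powr_def)
  finally have "(of_real b * z / 2) powr of_real \<nu> = of_real (b powr \<nu>) * (z / 2) powr of_real \<nu>" .
  then show ?thesis
    by (simp add: Bessel_J_conv bessel_cyl_def power_mult_distrib power_divide mult_ac)
qed

text \<open>Termwise integration. For s > |z| every partial sum is dominated by a multiple of
  b^\<nu> exp(-(s - |z|) b), because the partial sums of the series are bounded by a multiple of
  exp(|z| b).\<close>

lemma Bessel_J_ray_laplace: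
  fixes \<nu> s :: real
  assumes \<nu>: "\<nu> \<ge> - 1 / 2" and z: "z \<noteq> 0" and s: "s > norm z"
  shows "(\<lambda>b. exp (- (of_real s * of_real b)) * Bessel_J (of_real \<nu>) (of_real b * z)) absolutely_integrable_on {0<..}"
    and "(\<lambda>k. of_real (laplace_coeff \<nu> k) * (- ((z / 2)\<^sup>2)) ^ k * (1 / (of_real s)\<^sup>2) ^ k) sums
      (of_real (s powr (\<nu> + 1)) * integral {0<..} (\<lambda>b. exp (- (of_real s * of_real b)) * Bessel_J (of_real \<nu>) (of_real b * z))
        / (z / 2) powr of_real \<nu>)"
proof -
  define c where "c = (z / 2) powr complex_of_real \<nu>"
  have c0: "c \<noteq> 0" using z by (simp add: c_def)
  have s0: "s > 0" using s norm_ge_zero[of z] by linarith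
  define \<epsilon> where "\<epsilon> = s - norm z"
  have \<epsilon>: "\<epsilon> > 0" using s by (simp add: \<epsilon>_def)
  define C where "C = rGamma (\<nu> + 1)"
  have C: "C > 0" using rGamma_half_bound(1)[OF \<nu>, of 0] by (simp add: C_def)
  define J where "J b = Bessel_J (of_real \<nu>) (of_real b * z)" for b
  define a where "a k = rGamma (of_real \<nu> + of_nat k + 1) / fact k * (- ((z / 2)\<^sup>2)) ^ k" for k
  define T where "T n b = exp (- (complex_of_real s * of_real b)) * (of_real (b powr \<nu>) * (c * (\<Sum>k<n. a k * of_real (b ^ (2 * k)))))" for n b
  have conv: "(\<lambda>n. T n b) \<longlonglongrightarrow> exp (- (complex_of_real s * of_real b)) * J b" if b: "b > 0" for b
  proof -
    have "(\<lambda>k. a k * of_real (b ^ (2 * k))) sums bessel_E (of_real \<nu>) (- ((z / 2)\<^sup>2) * (of_real b)\<^sup>2)"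
      using bessel_E_sums[of "of_real \<nu>" "- ((z / 2)\<^sup>2) * (of_real b)\<^sup>2"]
      by (simp only: a_def power_mult_distrib power_mult of_real_power mult.assoc)
    then show ?thesis
      unfolding T_def J_def Bessel_J_ray[OF b z] c_def [symmetric] sums_def
      by (intro tendsto_mult_left)
  qed
  have a_norm: "norm (a k) * b ^ (2 * k) \<le> C * ((norm z * b) ^ (2 * k) / fact (2 * k))" if b: "b > 0" for k b
  proof -
    have "norm (rGamma (complex_of_real \<nu> + of_nat k + 1)) = rGamma (\<nu> + real k + 1)"
    proof -
      have "complex_of_real \<nu> + of_nat k + 1 = of_real (\<nu> + real k + 1)" by simp
      then show ?thesis unfolding rGamma_complex_of_real using rGamma_half_bound(1)[OF \<nu>, of k]
        by (simp only: rGamma_complex_of_real norm_of_real)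
    qed
    then have "norm (a k) * b ^ (2 * k) = rGamma (\<nu> + real k + 1) * ((norm z) ^ (2 * k) * b ^ (2 * k) / (4 ^ k * fact k))"
      by (simp add: a_def norm_mult norm_divide norm_power power_mult power_divide)
    also have "\<dots> \<le> (C * 4 ^ k * fact k / fact (2 * k)) * ((norm z) ^ (2 * k) * b ^ (2 * k) / (4 ^ k * fact k))"
      unfolding C_def using b by (intro mult_right_mono rGamma_half_bound(2)[OF \<nu>]) auto
    also have "\<dots> = C * ((norm z * b) ^ (2 * k) / fact (2 * k))"
      by (simp add: power_mult_distrib)
    finally show ?thesis .
  qed
  define h where "h b = norm c * C * norm (complex_of_real (b powr (\<nu> + 1 - 1)) * exp (- (of_real \<epsilon> * of_real b)))" for b
  have gint: "(\<lambda>b. complex_of_real (b powr (\<nu> + 1 - 1)) * exp (- (of_real \<epsilon> * of_real b))) absolutely_integrable_on {0<..}"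
    by (rule gamma_integral_scaled(1)) (use \<nu> \<epsilon> in auto)
  have hint: "h integrable_on {0<..}"
    unfolding h_def [abs_def] using gint by (intro integrable_on_mult_right) (simp add: absolutely_integrable_on_def)
  have bound: "norm (T n b) \<le> h b" if b: "b > 0" for n b
  proof -
    have "norm (\<Sum>k<n. a k * of_real (b ^ (2 * k))) \<le> (\<Sum>k<n. C * ((norm z * b) ^ (2 * k) / fact (2 * k)))"
    proof (rule order_trans[OF norm_sum sum_mono])
      show "norm (a k * of_real (b ^ (2 * k))) \<le> C * ((norm z * b) ^ (2 * k) / fact (2 * k))" for k
        using a_norm[OF b, of k] b by (simp add: norm_mult norm_power)
    qed
    also have "\<dots> = C * (\<Sum>k<n. (norm z * b) ^ (2 * k) / fact (2 * k))" by (simp only: sum_distrib_left)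
    also have "\<dots> \<le> C * exp (norm z * b)"
      using C b by (intro mult_left_mono sum_even_exp_terms_le) auto
    finally have "norm (T n b) \<le> exp (- (s * b)) * (b powr \<nu> * (norm c * (C * exp (norm z * b))))"
      unfolding T_def by (simp add: norm_mult mult_left_mono)
    also have "\<dots> = norm c * C * (b powr \<nu> * exp (- (s * b) + norm z * b))"
      by (simp only: exp_add mult_ac)
    also have "\<dots> = h b"
      by (simp add: h_def \<epsilon>_def norm_mult algebra_simps)
    finally show ?thesis .
  qed
  define t where "t k b = complex_of_real (b powr (\<nu> + 2 * real k + 1 - 1)) * exp (- (of_real s * of_real b))" for k b
  have tint: "t k absolutely_integrable_on {0<..}" "integral {0<..} (t k) = of_real (Gamma (\<nu> + 2 * real k + 1) / s powr (\<nu> + 2 * real k + 1))" for k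
    unfolding t_def [abs_def] using gamma_integral_scaled[of "\<nu> + 2 * real k + 1" s] \<nu> s0 by auto
  have T_eq: "T n b = (\<Sum>k<n. c * a k * t k b)" if b: "b > 0" for n b
  proof -
    have "b powr (\<nu> + 2 * real k + 1 - 1) = b powr \<nu> * b ^ (2 * k)" for k
      using b powr_realpow[of b "2 * k"] by (simp add: powr_add)
    then show ?thesis
      unfolding T_def t_def sum_distrib_left by (intro sum.cong) (auto simp: mult_ac)
  qed
  have sint: "(\<lambda>b. \<Sum>k<n. c * a k * t k b) absolutely_integrable_on {0<..}" for n
    by (intro absolutely_integrable_sum set_integrable_mult_right tint(1)) auto
  have Tint: "T n integrable_on {0<..}" for n
    by (rule integrable_eq[OF set_lebesgue_integral_eq_integral(1)[OF sint[of n]]]) (simp add: T_eq)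
  have bound': "norm (T n b) \<le> h b" if "b \<in> {0<..}" for n b
    using bound that by simp
  have conv': "(\<lambda>n. T n b) \<longlonglongrightarrow> exp (- (complex_of_real s * of_real b)) * J b" if "b \<in> {0<..}" for b
    using conv that by simp
  note DC = dominated_convergence[OF Tint hint bound' conv']
  have "norm (exp (- (complex_of_real s * of_real b)) * J b) \<le> h b" if b: "b > 0" for b
    by (rule LIMSEQ_le_const2[OF tendsto_norm[OF conv[OF b]]]) (use bound[OF b] in auto)
  then show "(\<lambda>b. exp (- (of_real s * of_real b)) * Bessel_J (of_real \<nu>) (of_real b * z)) absolutely_integrable_on {0<..}"
    using DC(1) hint unfolding J_def [symmetric] by (intro absolutely_integrable_integrable_bound[where g = h]) auto
  have IT: "integral {0<..} (T n) = (\<Sum>k<n. c * a k * of_real (Gamma (\<nu> + 2 * real k + 1) / s powr (\<nu> + 2 * real k + 1)))" for n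
  proof -
    have "integral {0<..} (T n) = integral {0<..} (\<lambda>b. \<Sum>k<n. c * a k * t k b)"
      by (rule integral_cong) (simp add: T_eq)
    also have "\<dots> = (\<Sum>k<n. integral {0<..} (\<lambda>b. c * a k * t k b))"
      using tint(1) by (intro integral_sum) (auto intro!: integrable_on_mult_right set_lebesgue_integral_eq_integral(1))
    finally show ?thesis by (simp add: tint(2))
  qed
  have term_eq: "of_real (s powr (\<nu> + 1)) / c * (c * a k * of_real (Gamma (\<nu> + 2 * real k + 1) / s powr (\<nu> + 2 * real k + 1))) =
      of_real (laplace_coeff \<nu> k) * (- ((z / 2)\<^sup>2)) ^ k * (1 / (of_real s)\<^sup>2) ^ k" for k
  proof -
    have "s powr (\<nu> + 2 * real k + 1) = s powr (\<nu> + 1) * s ^ (2 * k)"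
      using s0 powr_realpow[of s "2 * k"] powr_add[of s "\<nu> + 1" "2 * real k"] by (simp add: algebra_simps)
    then have 1: "s powr (\<nu> + 1) * (Gamma (\<nu> + 2 * real k + 1) / s powr (\<nu> + 2 * real k + 1)) = Gamma (\<nu> + 2 * real k + 1) / s ^ (2 * k)"
      using s0 by simp
    have 2: "rGamma (of_real \<nu> + of_nat k + 1) = complex_of_real (rGamma (\<nu> + real k + 1))"
      by (simp flip: rGamma_complex_of_real)
    have "of_real (s powr (\<nu> + 1)) / c * (c * a k * of_real (Gamma (\<nu> + 2 * real k + 1) / s powr (\<nu> + 2 * real k + 1))) =
        a k * of_real (s powr (\<nu> + 1) * (Gamma (\<nu> + 2 * real k + 1) / s powr (\<nu> + 2 * real k + 1)))"
      using c0 by simp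
    also have "\<dots> = a k * of_real (Gamma (\<nu> + 2 * real k + 1) / s ^ (2 * k))" by (simp only: 1)
    also have "\<dots> = of_real (laplace_coeff \<nu> k) * (- ((z / 2)\<^sup>2)) ^ k * (1 / (of_real s)\<^sup>2) ^ k"
      unfolding a_def 2 laplace_coeff_def by (simp add: power_mult power_divide)
    finally show ?thesis .
  qed
  have "(\<lambda>n. of_real (s powr (\<nu> + 1)) / c * integral {0<..} (T n)) \<longlonglongrightarrow>
      of_real (s powr (\<nu> + 1)) / c * integral {0<..} (\<lambda>b. exp (- (complex_of_real s * of_real b)) * J b)"
    using DC(2) by (rule tendsto_mult_left)
  then show "(\<lambda>k. of_real (laplace_coeff \<nu> k) * (- ((z / 2)\<^sup>2)) ^ k * (1 / (of_real s)\<^sup>2) ^ k) sums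
      (of_real (s powr (\<nu> + 1)) * integral {0<..} (\<lambda>b. exp (- (of_real s * of_real b)) * Bessel_J (of_real \<nu>) (of_real b * z))
        / (z / 2) powr of_real \<nu>)"
    unfolding sums_def IT sum_distrib_left term_eq by (simp add: J_def c_def)
qed

text \<open>J is the integrand f times the root q. With a bounded primitive F of f, integration by
  parts turns the transform of q F' into s times the transform of q F minus that of q' F. Both exist
  for Re s > 0, as q grows linearly and q' is bounded.\<close>

lemma Bessel_J_ray_laplace_continuation:
  fixes \<nu> :: real
  assumes \<nu>: "\<nu> \<ge> - 1 / 2" and z: "z \<noteq> 0" and a: "Re a > 0"
    and int: "Bessel_integrand a \<nu> z integrable_on {0<..}"
  obtains H where "H holomorphic_on {s. Re s > 0}"
    "\<And>s. s > norm z \<Longrightarrow> H (of_real s) =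
      integral {0<..} (\<lambda>b. exp (- (of_real s * of_real b)) * Bessel_J (of_real \<nu>) (of_real b * z))"
proof -
  define J where "J b = Bessel_J (of_real \<nu>) (of_real b * z)" for b
  define q where "q = ker_root a"
  have q0: "q b \<noteq> 0" for b using ker_root_nonzero[OF a] by (simp add: q_def)
  define f where "f = Bessel_integrand a \<nu> z"
  have fq: "f b * q b = J b" for b
    using q0[of b] by (simp add: f_def J_def q_def Bessel_integrand_def ker_root_def)
  have q': "(q has_vector_derivative of_real b / q b) (at b)" for b
    unfolding q_def using ker_root_has_vector_derivative[OF a] .
  have qcont: "continuous_on A q" for A unfolding q_def using a by (rule ker_root_continuous)
  have Jcont: "continuous_on {0<..} J"
  proof -
    have "continuous_on {0<..} (\<lambda>b. of_real (b powr \<nu>) * ((z / 2) powr of_real \<nu> * bessel_E (of_real \<nu>) (- ((z / 2)\<^sup>2) * (of_real b)\<^sup>2)))"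
    proof -
      have "continuous_on UNIV (bessel_E (of_real \<nu>))"
        using holomorphic_on_imp_continuous_on[OF holomorphic_on_bessel_E[OF holomorphic_on_ident]] .
      from continuous_on_compose2[OF this, of "{0<..}" "\<lambda>b. - ((z / 2)\<^sup>2) * (of_real b)\<^sup>2"]
      have "continuous_on {0<..} (\<lambda>b. bessel_E (of_real \<nu>) (- ((z / 2)\<^sup>2) * (complex_of_real b)\<^sup>2))"
        by (simp add: continuous_intros)
      then show ?thesis by (intro continuous_intros) auto
    qed
    moreover have "continuous_on {0<..} J = continuous_on {0<..} (\<lambda>b. of_real (b powr \<nu>) * ((z / 2) powr of_real \<nu> * bessel_E (of_real \<nu>) (- ((z / 2)\<^sup>2) * (of_real b)\<^sup>2)))"
      by (rule continuous_on_cong) (auto simp: J_def Bessel_J_ray z)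
    ultimately show ?thesis by simp
  qed
  have fcont: "continuous_on {0<..} f"
  proof -
    have "f = (\<lambda>b. J b / q b)" using fq q0 by (auto simp: fun_eq_iff field_simps)
    then show ?thesis using Jcont qcont q0 by (simp add: continuous_on_divide)
  qed
  obtain F M where F: "\<And>x. x > 0 \<Longrightarrow> (F has_vector_derivative f x) (at x)"
    "(F \<longlongrightarrow> 0) (at_right 0)" "\<And>x. x > 0 \<Longrightarrow> norm (F x) \<le> M"
    using integrable_imp_bounded_primitive[OF int[folded f_def] fcont] by blast
  have M0: "M \<ge> 0" using F(3)[of 1] norm_ge_zero[of "F 1"] by linarith
  have Fcont: "continuous_on {0<..} F"
    by (rule continuous_at_imp_continuous_on) (use F(1) in \<open>blast intro: has_vector_derivative_continuous\<close>)
  have qb: "norm (q b) \<le> b + 2 * norm a" if b: "b > 0" for b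
  proof -
    have "(norm (q b))\<^sup>2 = norm ((of_real b)\<^sup>2 + 4 * a\<^sup>2)"
      by (simp only: q_def ker_root_square flip: norm_power)
    also have "\<dots> \<le> b\<^sup>2 + 4 * (norm a)\<^sup>2"
      using norm_triangle_ineq[of "(complex_of_real b)\<^sup>2" "4 * a\<^sup>2"] by (simp add: norm_mult norm_power)
    also have "\<dots> \<le> (b + 2 * norm a)\<^sup>2"
      using b by (simp add: power2_sum power_mult_distrib)
    finally show ?thesis using b by (intro power2_le_imp_le[of "norm (q b)"]) auto
  qed
  obtain d where d: "d > 0" "\<And>\<alpha> b. \<alpha> \<in> ball a (Re a / 2) \<Longrightarrow> 0 < b \<Longrightarrow> d * (1 + b) \<le> norm (ker_root \<alpha> b)"
    using ker_root_lower_bound[OF a] by blast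
  have q'b: "norm (of_real b / q b) \<le> 1 / d" if b: "b > 0" for b
  proof -
    have "d * b \<le> d * (1 + b)" using d(1) by simp
    also have "\<dots> \<le> norm (q b)" using d(2)[of a b] a b by (simp add: q_def)
    finally show ?thesis using q0[of b] d(1) b by (simp add: norm_divide field_simps)
  qed
  define g1 where "g1 b = q b * F b" for b
  define g2 where "g2 b = of_real b / q b * F b" for b
  have ok1: "laplace_ok g1"
  proof (rule laplace_ok_linear_growth)
    show "continuous_on {0<..} g1" unfolding g1_def by (intro continuous_intros qcont Fcont)
    show "norm (g1 b) \<le> (1 + 2 * norm a) * M * (1 + b)" if b: "b > 0" for b
    proof -
      have "norm (g1 b) \<le> (b + 2 * norm a) * M"
        unfolding g1_def norm_mult using qb[OF b] F(3)[OF b] b by (intro mult_mono) auto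
      also have "\<dots> \<le> ((1 + 2 * norm a) * (1 + b)) * M"
        using b M0 by (intro mult_right_mono) (auto simp: algebra_simps)
      finally show ?thesis by (simp add: mult_ac)
    qed
  qed
  have ok2: "laplace_ok g2"
  proof (rule laplace_ok_linear_growth)
    show "continuous_on {0<..} g2" unfolding g2_def using q0 by (intro continuous_intros qcont Fcont) auto
    show "norm (g2 b) \<le> 1 / d * M * (1 + b)" if b: "b > 0" for b
    proof -
      have "norm (g2 b) \<le> 1 / d * M"
        unfolding g2_def norm_mult using q'b[OF b] F(3)[OF b] d(1) by (intro mult_mono) auto
      also have "\<dots> \<le> 1 / d * M * (1 + b)" using b M0 d(1) by (simp add: distrib_left)
      finally show ?thesis .
    qed
  qed
  define L1 where "L1 s = integral {0<..} (\<lambda>b. exp (- (s * of_real b)) * g1 b)" for s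
  define L2 where "L2 s = integral {0<..} (\<lambda>b. exp (- (s * of_real b)) * g2 b)" for s
  \<comment> \<open>\<open>g1\<close> is q F and \<open>g2\<close> is q' F, since q' = b/q.\<close>
  define H where "H s = s * L1 s - L2 s" for s
  have opn: "open {s. Re s > 0}" by (rule open_halfspace_Re_gt)
  have "L1 holomorphic_on {s. Re s > 0}" "L2 holomorphic_on {s. Re s > 0}"
    unfolding L1_def [abs_def] L2_def [abs_def] holomorphic_on_open[OF opn]
    using laplace_has_field_derivative[OF ok1] laplace_has_field_derivative[OF ok2] by blast+
  then have "H holomorphic_on {s. Re s > 0}" unfolding H_def [abs_def] by (intro holomorphic_intros)
  moreover have "H (of_real s) = integral {0<..} (\<lambda>b. exp (- (of_real s * of_real b)) * Bessel_J (of_real \<nu>) (of_real b * z))"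
    if s: "s > norm z" for s
  proof -
    have s0: "s > 0" using s norm_ge_zero[of z] by linarith
    define E where "E b = exp (- (complex_of_real s * of_real b))" for b
    define P where "P b = E b * (q b * F b)" for b
    define R where "R b = E b * J b + E b * g2 b - of_real s * (E b * g1 b)" for b
    have E': "(E has_vector_derivative - of_real s * E b) (at b)" for b
      unfolding E_def [abs_def]
      by (rule has_vector_derivative_real_field) (auto intro!: derivative_eq_intros)
    have der: "(P has_vector_derivative R b) (at b)" if b: "b > 0" for b
    proof -
      have "(P has_vector_derivative (E b * (q b * f b + of_real b / q b * F b) + (- of_real s * E b) * (q b * F b))) (at b)"
        unfolding P_def [abs_def] by (intro has_vector_derivative_mult E' q' F(1) b)
      moreover have "E b * (q b * f b + of_real b / q b * F b) + (- of_real s * E b) * (q b * F b) = R b"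
        unfolding R_def fq [symmetric] g1_def g2_def by (simp add: algebra_simps)
      ultimately show ?thesis by simp
    qed
    have i0: "(\<lambda>b. E b * J b) absolutely_integrable_on {0<..}"
      unfolding E_def J_def by (rule Bessel_J_ray_laplace(1)[OF \<nu> z s])
    have i1: "(\<lambda>b. E b * g1 b) absolutely_integrable_on {0<..}" and i2: "(\<lambda>b. E b * g2 b) absolutely_integrable_on {0<..}"
      unfolding E_def using laplace_ok_integrable[OF ok1] laplace_ok_integrable[OF ok2] s0 by simp_all
    have intR: "R absolutely_integrable_on {0<..}"
      unfolding R_def [abs_def] by (intro set_integral_add(1) set_integral_diff(1) set_integrable_mult_right i0 i1 i2)
    have lim0: "(P \<longlongrightarrow> 0) (at_right 0)"
    proof -
      have "isCont E 0" "isCont q 0" using E'[of 0] q'[of 0] has_vector_derivative_continuous by blast+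
      then have "(E \<longlongrightarrow> E 0) (at_right 0)" "(q \<longlongrightarrow> q 0) (at_right 0)"
        by (auto simp: isCont_def intro: filterlim_at_split[THEN iffD1, THEN conjunct2])
      from tendsto_mult[OF this(1) tendsto_mult[OF this(2) F(2)]] show ?thesis by (simp add: P_def [abs_def])
    qed
    have liminf: "(P \<longlongrightarrow> 0) at_top"
    proof (rule Lim_null_comparison)
      show "\<forall>\<^sub>F b in at_top. norm (P b) \<le> (2 / s + 2 * norm a) * M * exp (- (s / 2 * b))"
        using eventually_gt_at_top[of 0]
      proof eventually_elim
        case (elim b)
        have "s / 2 * b \<le> exp (s / 2 * b)" using exp_ge_add_one_self[of "s / 2 * b"] by linarith
        then have "b \<le> 2 / s * exp (s / 2 * b)" using s0 by (simp add: field_simps)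
        moreover have "2 * norm a * 1 \<le> 2 * norm a * exp (s / 2 * b)"
          using s0 elim by (intro mult_left_mono) auto
        ultimately have "norm (q b) \<le> (2 / s + 2 * norm a) * exp (s / 2 * b)"
          using qb[OF elim] by (simp add: distrib_right)
        then have "norm (q b) * norm (F b) \<le> ((2 / s + 2 * norm a) * exp (s / 2 * b)) * M"
          using F(3)[OF elim] s0 by (intro mult_mono) auto
        moreover have "norm (P b) = exp (- (s * b)) * (norm (q b) * norm (F b))"
          by (simp add: P_def E_def norm_mult)
        ultimately have "norm (P b) \<le> exp (- (s * b)) * (((2 / s + 2 * norm a) * exp (s / 2 * b)) * M)"
          by (simp add: mult_left_mono)
        also have "\<dots> = (2 / s + 2 * norm a) * M * (exp (- (s * b)) * exp (s / 2 * b))"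
          by (simp only: mult_ac)
        also have "exp (- (s * b)) * exp (s / 2 * b) = exp (- (s / 2 * b))"
          unfolding exp_add [symmetric] by (simp add: field_simps)
        finally show ?case .
      qed
      have "((\<lambda>b. exp (- (s / 2 * b))) \<longlongrightarrow> 0) at_top"
        using s0 by (intro filterlim_compose[OF exp_at_bot] filterlim_uminus_at_top[THEN iffD1]
            filterlim_tendsto_pos_mult_at_top[OF tendsto_const] filterlim_ident) auto
      then show "((\<lambda>b. (2 / s + 2 * norm a) * M * exp (- (s / 2 * b))) \<longlongrightarrow> 0) at_top"
        by (rule tendsto_mult_right_zero)
    qed
    have "integral {0<..} R = 0 - 0" by (rule integral_FTC_positive_reals[OF der intR lim0 liminf])
    moreover have "integral {0<..} R = integral {0<..} (\<lambda>b. E b * J b) + L2 (of_real s) - of_real s * L1 (of_real s)"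
      unfolding R_def [abs_def] L1_def L2_def E_def [symmetric] using i0 i1 i2
      by (simp add: integral_diff integral_add integrable_add integrable_on_mult_right set_lebesgue_integral_eq_integral(1))
    ultimately have "H (of_real s) = integral {0<..} (\<lambda>b. E b * J b)" by (simp add: H_def algebra_simps)
    then show ?thesis by (simp add: E_def J_def)
  qed
  ultimately show ?thesis using that by blast
qed

text \<open>A Pringsheim argument: the normalised transform \<open>K\<close> is regular at
  \<open>s0\<close>, but on the ray through \<open>s0\<close> it equals a series of nonnegative
  terms whose sums at \<open>s0\<close> itself are unbounded.\<close>

lemma Bessel_integrand_not_integrable:
  fixes \<nu> :: real
  assumes \<nu>: "\<nu> \<ge> - 1 / 2" and z: "z \<notin> \<real>" and a: "Re a > 0"
  shows "\<not> Bessel_integrand a \<nu> z integrable_on {0<..}"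
proof
  assume int: "Bessel_integrand a \<nu> z integrable_on {0<..}"
  have z0: "z \<noteq> 0" using z by auto
  obtain H where H: "H holomorphic_on {s. Re s > 0}"
    "\<And>s. s > norm z \<Longrightarrow> H (of_real s) =
      integral {0<..} (\<lambda>b. exp (- (of_real s * of_real b)) * Bessel_J (of_real \<nu>) (of_real b * z))"
    using Bessel_J_ray_laplace_continuation[OF \<nu> z0 a int] by blast
  define c where "c = (z / 2) powr complex_of_real \<nu>"
  define A where "A k = of_real (laplace_coeff \<nu> k) * (- ((z / 2)\<^sup>2)) ^ k" for k
  define Q where "Q X = (\<Sum>k. A k * X ^ k)" for X
  define K where "K s = s powr (of_real \<nu> + 1) * H s / c" for s
  have real_s: "(\<lambda>k. A k * (1 / (of_real s)\<^sup>2) ^ k) sums K (of_real s)" if s: "s > norm z" for s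
  proof -
    have "s \<ge> 0" using s norm_ge_zero[of z] by linarith
    then have "complex_of_real s powr (of_real \<nu> + 1) = of_real (s powr (\<nu> + 1))"
      using powr_of_real[of s "\<nu> + 1"] by simp
    then show ?thesis
      using Bessel_J_ray_laplace(2)[OF \<nu> z0 s] H(2)[OF s] by (simp add: A_def K_def c_def)
  qed
  have summ: "summable (\<lambda>k. A k * X ^ k)" if X: "norm X < 1 / (norm z)\<^sup>2" for X
  proof -
    \<comment> \<open>Convergence is known only at X = 1/s^2 with s real and s > |z|. Such points
      reach every modulus below 1/|z|^2, and a power series converges at all complex points of
      smaller modulus.\<close>
    obtain x where x: "norm X < x" "x < 1 / (norm z)\<^sup>2" using dense[OF X] by blast
    have x0: "x > 0" using x(1) norm_ge_zero[of X] by linarith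
    define s where "s = 1 / sqrt x"
    have s0: "s > 0" using x0 by (simp add: s_def)
    have s2: "1 / s\<^sup>2 = x" using x0 by (simp add: s_def power_divide)
    have "(norm z)\<^sup>2 < s\<^sup>2" using x(2) x0 z0 s0 unfolding s2 [symmetric] by (simp add: field_simps)
    then have "norm z < s" using s0 by (intro power2_less_imp_less[of "norm z" s]) auto
    then have "summable (\<lambda>k. A k * (1 / (of_real s)\<^sup>2) ^ k)" using real_s sums_summable by blast
    moreover have "norm (1 / (complex_of_real s)\<^sup>2) = x" using s2 by (simp add: norm_divide norm_power)
    ultimately show ?thesis using x(1) by (intro powser_inside[of A "1 / (of_real s)\<^sup>2" X]) auto
  qed
  have Qhol: "Q holomorphic_on ball 0 (1 / (norm z)\<^sup>2)"
    unfolding Q_def [abs_def] holomorphic_on_open[OF open_ball]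
  proof
    fix X :: complex assume "X \<in> ball 0 (1 / (norm z)\<^sup>2)"
    then have "norm X < 1 / (norm z)\<^sup>2" by simp
    from termdiffs_strong'[OF summ this]
    show "\<exists>f'. ((\<lambda>X. \<Sum>k. A k * X ^ k) has_field_derivative f') (at X)" by blast
  qed
  \<comment> \<open>The sign is chosen to make Re s0 = |Im z|, which is positive exactly because z
    is nonreal.\<close>
  define s0 where "s0 = (if Im z < 0 then \<i> * z else - \<i> * z)"
  have Im0: "Im z \<noteq> 0" using z by (simp add: complex_is_Real_iff)
  have s0: "Re s0 > 0" "s0\<^sup>2 = - (z\<^sup>2)" "norm s0 = norm z"
    using Im0 by (auto simp: s0_def power_mult_distrib norm_mult)
  \<comment> \<open>A convex, hence connected, region containing both the large reals, where the
    expansion is known, and the ray t s0 for t > 1. By Cauchy-Schwarz |s| > |z| on it, so the series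
    in 1/s^2 converges there.\<close>
  define S where "S = {s. Re s > 0} \<inter> {s. s0 \<bullet> s > (norm z)\<^sup>2}"
  have opn: "open S" unfolding S_def by (intro open_Int open_halfspace_Re_gt open_halfspace_gt)
  have conn: "connected S" unfolding S_def
    by (intro convex_connected convex_Int convex_halfspace_Re_gt convex_halfspace_gt)
  have norm_S: "norm (1 / s\<^sup>2) < 1 / (norm z)\<^sup>2" if s: "s \<in> S" for s
  proof -
    have "(norm z)\<^sup>2 < s0 \<bullet> s" using s by (simp add: S_def)
    also have "\<dots> \<le> norm z * norm s" using norm_cauchy_schwarz[of s0 s] s0(3) by simp
    finally have "norm z < norm s" using z0 by (simp add: power2_eq_square)
    then have "(norm z)\<^sup>2 < (norm s)\<^sup>2" by (intro power_strict_mono) auto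
    then show ?thesis using z0 by (simp add: norm_divide norm_power frac_less2)
  qed
  have eq: "K s = Q (1 / s\<^sup>2)" if s: "s \<in> S" for s
  proof -
    define S0 where "S0 = max (norm z) ((norm z)\<^sup>2 / Re s0)"
    have S0: "of_real x \<in> S" "x > norm z" if "x > S0" for x
    proof -
      show "x > norm z" using that by (simp add: S0_def)
      then have "x > 0" using norm_ge_zero[of z] by linarith
      moreover have "x * Re s0 > (norm z)\<^sup>2" using that s0(1) by (simp add: S0_def divide_less_eq)
      ultimately show "of_real x \<in> S" by (simp add: S_def inner_complex_def mult.commute)
    qed
    have "(\<lambda>s. K s - Q (1 / s\<^sup>2)) s = 0"
    proof (rule analytic_continuation[of "\<lambda>s. K s - Q (1 / s\<^sup>2)" S "of_real ` {S0<..}" "of_real (S0 + 1)"])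
      have sub: "S \<subseteq> {s. Re s > 0}" by (auto simp: S_def)
      have K: "K holomorphic_on S"
        unfolding K_def [abs_def]
        using holomorphic_on_subset[OF H(1) sub] z0
        by (intro holomorphic_intros) (auto simp: S_def c_def complex_nonpos_Reals_iff)
      have "(\<lambda>s. 1 / s\<^sup>2) holomorphic_on S" by (intro holomorphic_intros) (auto simp: S_def)
      moreover have "(\<lambda>s. 1 / s\<^sup>2) ` S \<subseteq> ball 0 (1 / (norm z)\<^sup>2)" using norm_S by auto
      ultimately have "(\<lambda>s. Q (1 / s\<^sup>2)) holomorphic_on S"
        using holomorphic_on_compose_gen[OF _ Qhol, of "\<lambda>s. 1 / s\<^sup>2" S] by (simp add: o_def)
      then show "(\<lambda>s. K s - Q (1 / s\<^sup>2)) holomorphic_on S" by (intro holomorphic_on_diff K)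
      show "of_real ` {S0<..} \<subseteq> S" using S0(1) by auto
      show "complex_of_real (S0 + 1) \<in> S" using S0(1)[of "S0 + 1"] by simp
      show "complex_of_real (S0 + 1) islimpt complex_of_real ` {S0<..}"
        unfolding islimpt_sequential
      proof (intro exI conjI allI)
        fix n :: nat
        show "complex_of_real (S0 + 1 + 1 / real (n + 1)) \<in> complex_of_real ` {S0<..} - {complex_of_real (S0 + 1)}"
        proof (intro DiffI imageI)
          show "S0 + 1 + 1 / real (n + 1) \<in> {S0<..}" by (simp add: add_pos_nonneg)
          have "S0 + 1 + 1 / real (n + 1) \<noteq> S0 + 1" by simp
          then show "complex_of_real (S0 + 1 + 1 / real (n + 1)) \<notin> {complex_of_real (S0 + 1)}"
            by (simp only: singleton_iff of_real_eq_iff not_False_eq_True)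
        qed
      next
        have "(\<lambda>n. S0 + 1 + 1 / real (n + 1)) \<longlonglongrightarrow> S0 + 1 + 0"
          by (intro tendsto_intros LIMSEQ_ignore_initial_segment[OF lim_1_over_n])
        from tendsto_of_real[OF this, where 'a = complex]
        show "(\<lambda>n. complex_of_real (S0 + 1 + 1 / real (n + 1))) \<longlonglongrightarrow> complex_of_real (S0 + 1)"
          by (simp only: add_0_right)
      qed
      show "K w - Q (1 / w\<^sup>2) = 0" if w: "w \<in> of_real ` {S0<..}" for w
      proof -
        obtain x where x: "x > S0" "w = of_real x" using w by auto
        from real_s[OF S0(2)[OF x(1)]] show ?thesis unfolding x(2) Q_def by (simp add: sums_iff)
      qed
    qed (use opn conn s in auto)
    then show ?thesis by simp
  qed
  have in_S: "of_real t * s0 \<in> S" if t: "t > 1" for t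
  proof -
    have "s0 \<bullet> (of_real t * s0) = t * (norm z)\<^sup>2"
      using s0(3) dot_square_norm[of s0] by (simp add: scaleR_conv_of_real[symmetric])
    moreover have "(norm z)\<^sup>2 < t * (norm z)\<^sup>2" using t z0 by simp
    ultimately show ?thesis using s0(1) t by (simp add: S_def)
  qed
  \<comment> \<open>As s0^2 = -z^2, the alternating sign cancels and every term on the ray is real
    and nonnegative.\<close>
  have Q_t: "Q (1 / (of_real t * s0)\<^sup>2) = (\<Sum>k. of_real (laplace_coeff \<nu> k / 4 ^ k * (1 / t\<^sup>2) ^ k))"
    and S_t: "summable (\<lambda>k. laplace_coeff \<nu> k / 4 ^ k * (1 / t\<^sup>2) ^ k)" if t: "t > 1" for t
  proof -
    have "A k * (1 / (of_real t * s0)\<^sup>2) ^ k = of_real (laplace_coeff \<nu> k / 4 ^ k * (1 / t\<^sup>2) ^ k)" for k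
    proof -
      have "(- ((z / 2)\<^sup>2)) * (1 / (of_real t * s0)\<^sup>2) = of_real (1 / 4 * (1 / t\<^sup>2))"
        unfolding power_mult_distrib s0(2) using z0 t by (simp add: power_divide)
      then have "((- ((z / 2)\<^sup>2)) * (1 / (of_real t * s0)\<^sup>2)) ^ k = of_real ((1 / 4 * (1 / t\<^sup>2)) ^ k)"
        by (simp only: of_real_power)
      then have "A k * (1 / (of_real t * s0)\<^sup>2) ^ k = of_real (laplace_coeff \<nu> k) * of_real ((1 / 4 * (1 / t\<^sup>2)) ^ k)"
        unfolding A_def power_mult_distrib by (simp only: mult.assoc)
      then show ?thesis by (simp add: power_mult_distrib power_divide)
    qed
    moreover have "summable (\<lambda>k. A k * (1 / (of_real t * s0)\<^sup>2) ^ k)"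
      by (intro summ norm_S in_S t)
    ultimately show "Q (1 / (of_real t * s0)\<^sup>2) = (\<Sum>k. of_real (laplace_coeff \<nu> k / 4 ^ k * (1 / t\<^sup>2) ^ k))"
      and "summable (\<lambda>k. laplace_coeff \<nu> k / 4 ^ k * (1 / t\<^sup>2) ^ k)"
      unfolding Q_def by (simp_all only: summable_of_real_iff)
  qed
  have pos: "0 \<le> laplace_coeff \<nu> k" for k
    using rGamma_half_bound(1)[OF \<nu>, of k] Gamma_real_pos[of "\<nu> + 2 * real k + 1"] \<nu>
    by (simp add: laplace_coeff_def)
  define t where "t n = 1 + 1 / real (Suc n)" for n
  have t: "t n > 1" "t \<longlonglongrightarrow> 1" for n
  proof -
    show "t n > 1" by (simp add: t_def)
    have "(\<lambda>n. 1 + 1 / real (Suc n)) \<longlonglongrightarrow> 1 + 0"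
      using LIMSEQ_inverse_real_of_nat by (intro tendsto_intros) (simp add: inverse_eq_divide)
    then show "t \<longlonglongrightarrow> 1" by (simp add: t_def [abs_def])
  qed
  have "isCont K s0"
  proof -
    have "K holomorphic_on {s. Re s > 0}"
      unfolding K_def [abs_def] using H(1) z0
      by (intro holomorphic_intros) (auto simp: c_def complex_nonpos_Reals_iff)
    then have "continuous_on {s. Re s > 0} K" by (rule holomorphic_on_imp_continuous_on)
    then show ?thesis using s0(1) open_halfspace_Re_gt[of 0] by (simp add: continuous_on_eq_continuous_at)
  qed
  moreover have "(\<lambda>n. of_real (t n) * s0) \<longlonglongrightarrow> s0"
  proof -
    have "(\<lambda>n. complex_of_real (t n)) \<longlonglongrightarrow> of_real 1" by (rule tendsto_of_real[OF t(2)])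
    from tendsto_mult_right[OF this, of s0] show ?thesis by simp
  qed
  ultimately have limK: "(\<lambda>n. norm (K (of_real (t n) * s0))) \<longlonglongrightarrow> norm (K s0)"
    by (intro tendsto_norm isCont_tendsto_compose[of s0 K])
  \<comment> \<open>At t > 1 a partial sum is at most the full sum, which is \<open>K\<close> at t
    s0. Letting t decrease to 1 with m fixed gives the bound at \<open>s0\<close>, where the series
    need not converge.\<close>
  have "(\<Sum>k<m. laplace_coeff \<nu> k / 4 ^ k) \<le> norm (K s0)" for m
  proof (rule LIMSEQ_le)
    have "(\<lambda>n. \<Sum>k<m. laplace_coeff \<nu> k / 4 ^ k * (1 / (t n)\<^sup>2) ^ k) \<longlonglongrightarrow> (\<Sum>k<m. laplace_coeff \<nu> k / 4 ^ k * (1 / 1\<^sup>2) ^ k)"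
      by (intro tendsto_intros t(2)) auto
    then show "(\<lambda>n. \<Sum>k<m. laplace_coeff \<nu> k / 4 ^ k * (1 / (t n)\<^sup>2) ^ k) \<longlonglongrightarrow> (\<Sum>k<m. laplace_coeff \<nu> k / 4 ^ k)"
      by simp
    show "(\<lambda>n. norm (K (of_real (t n) * s0))) \<longlonglongrightarrow> norm (K s0)" by (rule limK)
    have "(\<Sum>k<m. laplace_coeff \<nu> k / 4 ^ k * (1 / (t n)\<^sup>2) ^ k) \<le> norm (K (of_real (t n) * s0))" for n
    proof -
      have "(\<Sum>k<m. laplace_coeff \<nu> k / 4 ^ k * (1 / (t n)\<^sup>2) ^ k) \<le> (\<Sum>k. laplace_coeff \<nu> k / 4 ^ k * (1 / (t n)\<^sup>2) ^ k)"
        by (rule sum_le_suminf[OF S_t[OF t(1)]]) (use pos in auto)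
      also have "\<dots> \<le> norm (complex_of_real (\<Sum>k. laplace_coeff \<nu> k / 4 ^ k * (1 / (t n)\<^sup>2) ^ k))"
        by (simp only: norm_of_real abs_ge_self)
      also have "complex_of_real (\<Sum>k. laplace_coeff \<nu> k / 4 ^ k * (1 / (t n)\<^sup>2) ^ k) = K (of_real (t n) * s0)"
        unfolding eq[OF in_S[OF t(1)]] Q_t[OF t(1)] by (rule suminf_of_real[OF S_t[OF t(1)]])
      finally show ?thesis .
    qed
    then show "\<exists>N. \<forall>n\<ge>N. (\<Sum>k<m. laplace_coeff \<nu> k / 4 ^ k * (1 / (t n)\<^sup>2) ^ k) \<le> norm (K (of_real (t n) * s0))"
      by blast
  qed
  then show False using laplace_coeff_not_bounded[OF \<nu>] by blast
qed

text \<open>The substitution b to x b carries x into \<alpha> = a x; the principal root commutes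
  with the positive factor x because the sign conditions on real and imaginary parts are
  preserved.\<close>

lemma Bessel_integrand_real_argument:
  fixes \<nu> x :: real
  assumes \<nu>: "\<nu> \<ge> - 1 / 2" and x: "x > 0" and a: "Re a > 0"
  shows "Bessel_integrand a \<nu> (of_real x) integrable_on {0<..}"
    and "integral {0<..} (Bessel_integrand a \<nu> (of_real x)) = bessel_G 0 (of_real \<nu>) (a * of_real x)"
proof -
  have Re: "Re (complex_of_real \<nu>) > - 1" "Re (a * of_real x) > 0" using \<nu> a x by auto
  define g where "g b = bessel_cyl (- 1) (of_real \<nu>) (of_real b) / ker_root (a * of_real x) b" for b
  have g: "g absolutely_integrable_on {0<..}" "integral {0<..} g = bessel_G 0 (of_real \<nu>) (a * of_real x)"
    using bessel_G_absolutely_integrable[OF Re, of 0] by (simp_all add: g_def [abs_def] bessel_G_def)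
  note sc = has_integral_scale_positive_reals[OF g(1) x]
  have eq: "Bessel_integrand a \<nu> (of_real x) = (\<lambda>b. of_real x * g (x * b))"
  proof
    fix b
    have "ker_root (a * of_real x) (x * b) = of_real x * csqrt ((of_real b)\<^sup>2 + 4 * a\<^sup>2)"
      unfolding ker_root_def
    proof (rule csqrt_unique)
      show "(of_real x * csqrt ((of_real b)\<^sup>2 + 4 * a\<^sup>2))\<^sup>2 = (of_real (x * b))\<^sup>2 + 4 * (a * of_real x)\<^sup>2"
        by (simp add: power_mult_distrib algebra_simps)
      show "0 < Re (of_real x * csqrt ((of_real b)\<^sup>2 + 4 * a\<^sup>2)) \<or>
          Re (of_real x * csqrt ((of_real b)\<^sup>2 + 4 * a\<^sup>2)) = 0 \<and> 0 \<le> Im (of_real x * csqrt ((of_real b)\<^sup>2 + 4 * a\<^sup>2))"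
        using csqrt_principal[of "(of_real b)\<^sup>2 + 4 * a\<^sup>2"] x by (auto simp del: csqrt.sel)
    qed
    then show "Bessel_integrand a \<nu> (of_real x) b = of_real x * g (x * b)"
      using x by (simp add: Bessel_integrand_def g_def Bessel_J_conv mult.commute)
  qed
  show "Bessel_integrand a \<nu> (of_real x) integrable_on {0<..}"
    unfolding eq using sc(1) by (intro integrable_on_mult_right set_lebesgue_integral_eq_integral(1))
  show "integral {0<..} (Bessel_integrand a \<nu> (of_real x)) = bessel_G 0 (of_real \<nu>) (a * of_real x)"
    unfolding eq using x g(2) by (simp add: sc(2))
qed

theorem theorem11:
  fixes a z :: complex and \<nu> :: real
  assumes "Re a > 0" and "\<nu> \<ge> - 1 / 2" and "z \<notin> \<real>\<^sub>\<le>\<^sub>0"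
  shows "(z \<in> \<real> \<longrightarrow> Bessel_integrand a \<nu> z integrable_on {0<..}) \<and>
    (Bessel_integrand a \<nu> z integrable_on {0<..} \<longrightarrow>
      integral {0<..} (Bessel_integrand a \<nu> z) =
        Bessel_I (of_real (\<nu> / 2)) (a * z) * Bessel_K (of_real (\<nu> / 2)) (a * z))"
proof (cases "z \<in> \<real>")
  case True
  then obtain x where z: "z = of_real x" by (elim Reals_cases)
  have x: "x > 0" using assms(3) by (simp add: z complex_nonpos_Reals_iff)
  have "bessel_G 0 (2 * of_real (\<nu> / 2)) (a * z) =
      Bessel_I (of_real (\<nu> / 2)) (a * z) * Bessel_K (of_real (\<nu> / 2)) (a * z)"
    by (rule bessel_G_eq_I_K) (use assms x z in auto)
  then show ?thesis
    using Bessel_integrand_real_argument[OF assms(2) x assms(1)] by (simp add: z)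
next
  \<comment> \<open>For nonreal z both implications are vacuous, the second because the integral
    does not exist.\<close>
  case False
  then show ?thesis using Bessel_integrand_not_integrable[OF assms(2) _ assms(1)] by simp
qed

end
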